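(* Let $l$ and $m$ be integers with $l>m\ge 0$, and let $a\ge 1$ and $b$ be integers such that $a+b\ge 1$ and $\gcd(a,b)=1$. For each integer $r$ with $1\le r\le a$ and $\gcd(r,a)=1$, put $$K_r:=\left\lfloor\frac{al-(l-m)r}{a(l-m)}\right\rfloor$$ and $$A_r:=\begin{cases}\dfrac{l}{r}, & \text{if } l\ge \dfrac{(a+r)m}{r},\\[2mm] \displaystyle\sum_{i=0}^{K_r-1}\frac{l-m}{r+ai}+\frac{l}{r+aK_r}, & \text{if } m<l<\dfrac{(a+r)m}{r}.\end{cases}$$ Then $$\log \operatorname{lcm}_{mn<i\le ln}\{ai+b\}\sim \frac{an}{\varphi(a)}\sum_{\substack{r=1\\ \gcd(r,a)=1}}^{a}A_r$$ as $n\to\infty$ through the positive integers.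
   Context: For a positive integer $n$, $\operatorname{lcm}_{mn<i\le ln}\{ai+b\}$ denotes the least common multiple of the positive integers $ai+b$, where $i$ runs over all integers with $mn<i\le ln$. $\varphi(a)$ is the number of integers between $1$ and $a$ that are relatively prime to $a$. $\lfloor x\rfloor$ is the largest integer not exceeding $x$. $f(n)\sim g(n)$ means $f(n)/g(n)\to 1$. *)

theory Defs
  imports
    Complex_Main
    "HOL-Library.Landau_Symbols"
    "HOL-Number_Theory.Totient"
begin

definition K :: "int \<Rightarrow> int \<Rightarrow> int \<Rightarrow> int \<Rightarrow> int" where
  "K l m a r = \<lfloor>of_int (a * l - (l - m) * r) / (of_int (a * (l - m)) :: real)\<rfloor>"

(* The two cases are l >= (a + r) m / r and m < l < (a + r) m / r. They are exhaustive
   because A is used only for l > m. *)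
definition A :: "int \<Rightarrow> int \<Rightarrow> int \<Rightarrow> int \<Rightarrow> real" where
  "A l m a r =
     (if of_int l \<ge> (of_int ((a + r) * m) / of_int r :: real)
      then of_int l / of_int r
      else (\<Sum>i = 0..K l m a r - 1. of_int (l - m) / of_int (r + a * i))
             + of_int l / of_int (r + a * K l m a r))"

end

theory Submission
  imports
    Defs
    "HOL-Complex_Analysis.Complex_Analysis"
    "HOL-Number_Theory.Number_Theory"
begin

text \<open>
  The logarithm of the least common multiple is the sum of \<open>\<Lambda>(d)\<close> over all \<open>d\<close> dividing some term.
  Such a \<open>d\<close> has a cofactor \<open>q \<equiv> r\<close> modulo \<open>a\<close> with \<open>r\<close> coprime to \<open>a\<close>, which puts \<open>d\<close> into one residue
  class and into the union of the intervals \<open>(a m n / q, a l n / q]\<close>, \<open>q = r + a i\<close>. From \<open>i = K\<^sub>r\<close> on, these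
  intervals overlap, so the union has total length about \<open>a n A\<^sub>r\<close>, and the prime number theorem for
  arithmetic progressions gives the contribution \<open>a n A\<^sub>r / \<phi>(a)\<close>.

  The prime number theorem is proved by Newman's method: \<open>L(s, X) \<noteq> 0\<close> on the line \<open>Re s = 1\<close> follows from
  the inequality \<open>3 + 4 cos t + cos (2 t) \<ge> 0\<close>, except for real characters at \<open>s = 1\<close>, where Monsky's
  argument with a Lambert series is used; Newman's contour integral then yields the convergence of
  \<open>\<Sum>(\<psi>(n) - n / \<phi>(a)) / (n (n + 1))\<close>, which forces \<open>\<psi>(n) \<sim> n / \<phi>(a)\<close> since \<open>\<psi>\<close> is monotone.
\<close>

section \<open>Dirichlet characters\<close>

text \<open>Write q = r + a i. Asymptotically the intervals for q and q + a leave a gap exactly when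
  l q < m (q + a), which stops once (l - m) q > a m; \<open>K\<close> counts the indices before
  that, abutting intervals included. Hence \<open>A\<close> consists of \<open>K\<close> separate
  pieces (l - m) / q and one piece l / q for the initial segment that all later intervals fill. The
  number of endpoints involved does not depend on n and each is \<alpha> n + O(1), so the prime
  number theorem enters as a bare limit, without an error term. The shift b is harmless because
  integrality sharpens (l - m) q > a m to a difference of at least 1, which after multiplication by
  n outweighs b. The inequality with weights 3, 4, 1 compares orders at 1, 1 + i t and 1 + 2 i t:
  one pole counted three times cannot pay for a zero counted four times. The count breaks down only
  when X^2 has a pole at 1 + 2 i t as well, that is for t = 0 and X^2 principal, hence the separate
  argument for real characters.\<close>

definition dchars :: "nat \<Rightarrow> (nat \<Rightarrow> complex) set" where
  "dchars a = {X. (\<forall>n. X (n + a) = X n) \<and> (\<forall>m n. X (m * n) = X m * X n) \<and> X 1 = 1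
     \<and> (\<forall>n. X n = 0 \<longleftrightarrow> \<not> coprime n a)}"

definition princ :: "nat \<Rightarrow> nat \<Rightarrow> complex" where
  "princ a = (\<lambda>n. if coprime n a then 1 else 0)"

lemma periodic_mult_add:
  fixes f :: "nat \<Rightarrow> 'b"
  assumes "\<And>n. f (n + a) = f n"
  shows "f (n + k * a) = f n"
proof (induction k)
  case (Suc k)
  have "f (n + Suc k * a) = f ((n + k * a) + a)" by (simp add: add_ac)
  with Suc assms show ?case by simp
qed simp

lemma periodic_mod:
  fixes f :: "nat \<Rightarrow> 'b"
  assumes "\<And>n. f (n + a) = f n"
  shows "f (n mod a) = f n"
  using periodic_mult_add[of f a "n mod a" "n div a"] assms by simp

lemma periodic_cong:
  fixes f :: "nat \<Rightarrow> 'b"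
  assumes "\<And>n. f (n + a) = f n" "[m = n] (mod a)"
  shows "f m = f n"
  using periodic_mod[of f a m] periodic_mod[of f a n] assms by (simp add: unique_euclidean_semiring_class.cong_def)

context
  fixes a :: nat and X :: "nat \<Rightarrow> complex"
  assumes chi: "X \<in> dchars a"
begin

lemma dchars_mult: "X (m * n) = X m * X n"
  and dchars_1: "X 1 = 1"
  and dchars_Suc_0: "X (Suc 0) = 1"
  and dchars_eq_0_iff: "X n = 0 \<longleftrightarrow> \<not> coprime n a"
  and dchars_add: "X (n + a) = X n"
  using chi by (auto simp: dchars_def)

lemma dchars_cong: "[m = n] (mod a) \<Longrightarrow> X m = X n"
  by (rule periodic_cong[of X a]) (rule dchars_add)

lemma dchars_power: "X (n ^ k) = X n ^ k"
  by (induction k) (simp_all add: dchars_mult dchars_Suc_0)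

lemma dchars_power_totient:
  assumes "coprime n a"
  shows "X n ^ totient a = 1"
  using dchars_cong[OF euler_theorem[OF assms]] by (simp add: dchars_power dchars_Suc_0)

end

lemma norm_dchars:
  assumes "X \<in> dchars a" "a > 0"
  shows "norm (X n) = (if coprime n a then 1 else 0)"
proof (cases "coprime n a")
  case True
  have "norm (X n) ^ totient a = 1"
    using dchars_power_totient[OF assms(1) True] by (metis norm_one norm_power)
  then have "norm (X n) = 1"
    using power_eq_iff_eq_base[of "totient a" "norm (X n)" 1] assms(2) by (simp add: totient_gt_0_iff)
  with True show ?thesis by simp
qed (use assms dchars_eq_0_iff in auto)

lemma norm_dchars_le: "X \<in> dchars a \<Longrightarrow> a > 0 \<Longrightarrow> norm (X n) \<le> 1"
  by (simp add: norm_dchars)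

lemma coprime_add_right_nat: "coprime (n + a) a \<longleftrightarrow> coprime n (a::nat)"
  unfolding coprime_iff_gcd_eq_1 by (simp only: gcd_add1)

lemma princ_in_dchars: "princ a \<in> dchars a"
  unfolding dchars_def princ_def mem_Collect_eq
  by (intro conjI allI) (simp_all add: coprime_add_right_nat)

lemma dchars_times: "X \<in> dchars a \<Longrightarrow> \<psi> \<in> dchars a \<Longrightarrow> (\<lambda>n. X n * \<psi> n) \<in> dchars a"
  unfolding dchars_def mem_Collect_eq by (intro conjI allI) simp_all

text \<open>By periodicity a character is determined by its values on \<open>{..<a}\<close>, and
  each of them is 0 or a root of unity of order dividing \<open>totient a\<close>.\<close>

lemma finite_dchars:
  assumes "a > 0" shows "finite (dchars a)"
proof -
  let ?V = "insert 0 {z::complex. z ^ totient a = 1}"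
  have "totient a > 0" using assms by (simp add: totient_gt_0_iff)
  then have V: "finite ?V" using finite_nth_roots[of "totient a" 1] by simp
  let ?h = "\<lambda>X::nat \<Rightarrow> complex. restrict X {..<a}"
  have "?h ` dchars a \<subseteq> {..<a} \<rightarrow>\<^sub>E ?V"
    using dchars_power_totient dchars_eq_0_iff by (intro image_subsetI) (auto simp: restrict_PiE_iff)
  then have "finite (?h ` dchars a)"
    using V by (meson finite_PiE finite_lessThan finite_subset)
  moreover have "inj_on ?h (dchars a)"
  proof (rule inj_onI, rule ext)
    fix X \<psi> :: "nat \<Rightarrow> complex" and n
    assume c: "X \<in> dchars a" "\<psi> \<in> dchars a" and eq: "?h X = ?h \<psi>"
    have "X (n mod a) = \<psi> (n mod a)"
      using fun_cong[OF eq, of "n mod a"] assms by simp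
    then show "X n = \<psi> n"
      using periodic_mod[of X a n] periodic_mod[of \<psi> a n] dchars_add[OF c(1)] dchars_add[OF c(2)] by simp
  qed
  ultimately show ?thesis by (rule finite_imageD)
qed

section \<open>Existence of enough characters\<close>

text \<open>Characters are found as joint eigenfunctions of the translations \<open>f \<mapsto> (x \<mapsto> f (g * x))\<close>:
  averaging \<open>w ^ j * f (g ^ j * x)\<close> over \<open>j\<close> projects to the eigenvalue \<open>1 / w\<close>, and these
  projections, over all roots of unity \<open>w\<close>, add up to \<open>f\<close>.\<close>

lemma sum_roots_unity_power:
  assumes "N > 0" "j < N"
  shows "(\<Sum>w | w ^ N = 1. w ^ j) = (if j = 0 then of_nat N else (0::complex))"
proof (cases "j = 0")
  case True
  then show ?thesis using card_roots_unity_eq[OF assms(1)] by simp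
next
  case False
  define z where "z = cis (2 * pi / N)"
  have "real N * (2 * pi / real N) = 2 * pi" using assms by simp
  then have zN: "z ^ N = 1" by (simp only: z_def Complex.DeMoivre cis_2pi)
  have zj: "z ^ j \<noteq> 1"
  proof
    assume "z ^ j = 1"
    then have "cis (j * (2 * pi / N)) = 1" by (simp add: z_def Complex.DeMoivre)
    then have "cos (j * (2 * pi / N)) = 1" by (metis cis.simps(1) one_complex.simps(1))
    then obtain n :: int where n: "j * (2 * pi / N) = real_of_int n * 2 * pi"
      using cos_one_2pi_int by blast
    then have "real j = n * real N" using assms by (simp add: field_simps)
    then have "int j = n * int N" by (metis of_int_eq_iff of_int_mult of_int_of_nat_eq)
    then have "N dvd j" by (metis dvd_triv_right int_dvd_int_iff)
    then show False using False assms by (auto dest: dvd_imp_le)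
  qed
  have "bij_betw (\<lambda>w. z * w) {w. w ^ N = 1} {w. w ^ N = 1}"
  proof (rule bij_betwI[where g = "\<lambda>w. w / z"])
    have "z \<noteq> 0" by (simp add: z_def)
    then show "z * x / z = x" "z * (x / z) = x" for x by auto
  qed (use zN in \<open>auto simp: power_mult_distrib power_divide\<close>)
  then have "(\<Sum>w | w ^ N = 1. w ^ j) = (\<Sum>w | w ^ N = 1. (z * w) ^ j)"
    by (rule sum.reindex_bij_betw[symmetric])
  also have "\<dots> = z ^ j * (\<Sum>w | w ^ N = 1. w ^ j)"
    by (simp add: power_mult_distrib sum_distrib_left)
  finally have "(1 - z ^ j) * (\<Sum>w | w ^ N = 1. w ^ j) = 0" by (simp add: algebra_simps)
  with zj False show ?thesis by auto
qed

lemma sum_root_weights: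
  fixes F :: "nat \<Rightarrow> complex"
  assumes N: "N > 0"
  shows "(\<Sum>w | w ^ N = 1. \<Sum>j<N. w ^ j * F j) = of_nat N * F 0"
proof -
  have "(\<Sum>w | w ^ N = 1. \<Sum>j<N. w ^ j * F j) = (\<Sum>j<N. (\<Sum>w | w ^ N = 1. w ^ j) * F j)"
    by (subst sum.swap) (simp add: sum_distrib_right)
  also have "\<dots> = (\<Sum>j<N. if j = 0 then of_nat N * F 0 else 0)"
    using N by (intro sum.cong) (auto simp: sum_roots_unity_power)
  finally show ?thesis using N by simp
qed

text \<open>Translating by g and multiplying by w shifts the summation index by one; the term that
  drops out at j = 0 comes back at j = N, because w ^ N = 1 and, by Euler's theorem, g ^ N is 1
  modulo a.\<close>

lemma eigen_projection:
  fixes f :: "nat \<Rightarrow> complex"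
  assumes f: "\<And>n. f (n + a) = f n" and g: "coprime g a" and a: "a > 0"
    and N: "N = totient a"
    and w: "w ^ N = 1"
  defines "h \<equiv> (\<lambda>x. \<Sum>j<N. w ^ j * f (g ^ j * x))"
  shows "h (n + a) = h n" "w * h (g * x) = h x"
proof -
  have "f (g ^ j * (n + a)) = f (g ^ j * n)" for j
    using periodic_mult_add[of f a "g ^ j * n" "g ^ j"] f by (simp add: algebra_simps)
  then show "h (n + a) = h n" by (simp add: h_def)
  have N0: "N > 0" using a N by (simp add: totient_gt_0_iff)
  have "[g ^ N * x = 1 * x] (mod a)"
    using euler_theorem[OF g] N by (intro cong_mult cong_refl) simp
  then have gN: "f (g ^ N * x) = f x"
    using periodic_cong[of f a "g ^ N * x" "1 * x"] f by simp
  have "w * h (g * x) = (\<Sum>j<N. w ^ Suc j * f (g ^ Suc j * x))"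
    by (simp add: h_def sum_distrib_left mult_ac)
  also have "\<dots> = (\<Sum>j<N. w ^ j * f (g ^ j * x)) + w ^ N * f (g ^ N * x) - f x"
    using sum.lessThan_Suc_shift[of "\<lambda>j. w ^ j * f (g ^ j * x)" N] by simp
  also have "\<dots> = h x" using w gN by (simp add: h_def)
  finally show "w * h (g * x) = h x" .
qed

text \<open>The base case secures an eigenvalue of g other than 1. Each further s is handled by
  projecting to an eigenspace of the translation by s: projections commute with all translations, so
  the eigenvalues already obtained survive, and the root w is chosen so that the projection does not
  vanish at the old point \<open>n0\<close>.\<close>

lemma exists_joint_eigenfunction:
  fixes a g :: nat
  assumes a: "a > 0" and g: "coprime g a" "\<not> [g = 1] (mod a)" and S: "finite S" "\<forall>s\<in>S. coprime s a"
  shows "\<exists>f :: nat \<Rightarrow> complex. (\<forall>n. f (n + a) = f n) \<and> (\<exists>n. coprime n a \<and> f n \<noteq> 0)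
           \<and> (\<exists>c. c \<noteq> 1 \<and> (\<forall>x. f (g * x) = c * f x)) \<and> (\<forall>s\<in>S. \<exists>c. \<forall>x. f (s * x) = c * f x)"
  using S
proof (induction S rule: finite_induct)
  case empty
  define N where "N = totient a"
  have N: "N > 0" using a by (simp add: N_def totient_gt_0_iff)
  define f :: "nat \<Rightarrow> complex" where "f = (\<lambda>n. if [n = 1] (mod a) then 1 else 0)"
  have f: "f (n + a) = f n" for n by (simp add: f_def unique_euclidean_semiring_class.cong_def)
  define h where "h = (\<lambda>w x. \<Sum>j<N. w ^ j * f (g ^ j * x))"
  have h: "h w (n + a) = h w n" "w * h w (g * x) = h w x" if "w ^ N = 1" for w n x
    using eigen_projection[of f a g N w] f g a that by (auto simp: N_def h_def)
  have total: "(\<Sum>w | w ^ N = 1. h w x) = of_nat N * f x" for x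
    unfolding h_def using sum_root_weights[OF N, of "\<lambda>j. f (g ^ j * x)"] by simp
  text \<open>If only the eigenvalue 1 occurred, the indicator function of the residue 1 would be
    invariant under \<open>g\<close>.\<close>
  have "\<exists>w x. w ^ N = 1 \<and> w \<noteq> 1 \<and> coprime x a \<and> h w x \<noteq> 0"
  proof (rule ccontr)
    assume none: "\<nexists>w x. w ^ N = 1 \<and> w \<noteq> 1 \<and> coprime x a \<and> h w x \<noteq> 0"
    have eq: "h 1 x = of_nat N * f x" if "coprime x a" for x
    proof -
      have fin: "finite {w::complex. w ^ N = 1}" using finite_nth_roots[OF N, of 1] by simp
      have "(\<Sum>w | w ^ N = 1. h w x) = (\<Sum>w\<in>{1}. h w x)"
        using none that fin by (intro sum.mono_neutral_right) auto
      then show ?thesis using total by simp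
    qed
    have "of_nat N * f (g * 1) = of_nat N * f 1"
      using h(2)[of 1 1] eq[of "g * 1"] eq[of 1] g by simp
    then show False using N g by (simp add: f_def)
  qed
  then obtain w x where wx: "w ^ N = 1" "w \<noteq> 1" "coprime x a" "h w x \<noteq> 0" by blast
  have "w \<noteq> 0" using wx(1) N by (auto simp: power_0_left)
  then have "\<forall>x. h w (g * x) = inverse w * h w x"
    using h(2)[OF wx(1)] by (metis mult.assoc left_inverse mult_1)
  moreover have "inverse w \<noteq> 1" using wx(2) by auto
  ultimately have "\<exists>c. c \<noteq> 1 \<and> (\<forall>x. h w (g * x) = c * h w x)" by blast
  then show ?case using h(1)[OF wx(1)] wx by (intro exI[of _ "h w"]) auto
next
  case (insert s S)
  then obtain f c n0 where f: "\<And>n. f (n + a) = f n" "coprime n0 a" "f n0 \<noteq> (0::complex)" "c \<noteq> 1"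
      "\<And>x. f (g * x) = c * f x" and fS: "\<And>t. t \<in> S \<Longrightarrow> \<exists>c. \<forall>x. f (t * x) = c * f x"
    by (metis insert_iff)
  define N where "N = totient a"
  have N: "N > 0" using a by (simp add: N_def totient_gt_0_iff)
  define h where "h = (\<lambda>w x. \<Sum>j<N. w ^ j * f (s ^ j * x))"
  have h: "h w (n + a) = h w n" "w * h w (s * x) = h w x" if "w ^ N = 1" for w n x
    using eigen_projection[of f a s N w] f a insert.prems that by (auto simp: N_def h_def)
  have total: "(\<Sum>w | w ^ N = 1. h w x) = of_nat N * f x" for x
    unfolding h_def using sum_root_weights[OF N, of "\<lambda>j. f (s ^ j * x)"] by simp
  have "\<exists>w. w ^ N = 1 \<and> h w n0 \<noteq> 0"
    using total[of n0] f(3) N by (metis (mono_tags, lifting) mem_Collect_eq mult_eq_0_iff of_nat_eq_0_iff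
        less_irrefl sum.neutral)
  then obtain w where w: "w ^ N = 1" "h w n0 \<noteq> 0" by blast
  have "w \<noteq> 0" using w(1) N by (auto simp: power_0_left)
  then have "\<forall>x. h w (s * x) = inverse w * h w x"
    using h(2)[OF w(1)] by (metis mult.assoc left_inverse mult_1)
  moreover have tr: "h w (t * x) = c' * h w x" if "\<And>x. f (t * x) = c' * f x" for t c' x
    unfolding h_def sum_distrib_left
    using that[of "s ^ j * x" for j] by (intro sum.cong refl) (simp add: mult_ac)
  ultimately have "\<forall>t\<in>insert s S. \<exists>c. \<forall>x. h w (t * x) = c * h w x"
    using fS by blast
  note all = this
  have hg: "\<forall>x. h w (g * x) = c * h w x" using tr[OF f(5)] by simp
  show ?case
  proof (intro exI[of _ "h w"] conjI)
    show "\<forall>n. h w (n + a) = h w n" using h(1)[OF w(1)] by simp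
    show "\<exists>n. coprime n a \<and> h w n \<noteq> 0" using f(2) w(2) by auto
    show "\<exists>c. c \<noteq> 1 \<and> (\<forall>x. h w (g * x) = c * h w x)" using f(4) hg by (intro exI[of _ c] conjI)
  qed (rule all)
qed

text \<open>A joint eigenfunction of all translations by units is a character up to normalisation:
  the eigenvalue of the translation by t is f t / f 1, and composing translations multiplies
  eigenvalues. Here f 1 cannot vanish, since every f n with n coprime to a is a multiple of
  it.\<close>

lemma exists_dchar_neq_1:
  assumes a: "a > 0" and g: "coprime g a" "\<not> [g = 1] (mod a)"
  shows "\<exists>X\<in>dchars a. X g \<noteq> 1"
proof -
  let ?S = "{s\<in>{..<a}. coprime s a}"
  have S: "finite ?S" "\<forall>s\<in>?S. coprime s a" by auto
  obtain f :: "nat \<Rightarrow> complex" where "((\<forall>n. f (n + a) = f n) \<and> (\<exists>n. coprime n a \<and> f n \<noteq> 0))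
      \<and> (\<exists>c. c \<noteq> 1 \<and> (\<forall>x. f (g * x) = c * f x)) \<and> (\<forall>s\<in>?S. \<exists>c. \<forall>x. f (s * x) = c * f x)"
    using exists_joint_eigenfunction[OF a g S] unfolding conj_assoc by (rule exE)
  note F = this[THEN conjunct1] this[THEN conjunct2]
  obtain n0 where n0: "coprime n0 a" "f n0 \<noteq> 0" using F(1) by blast
  obtain c where c: "c \<noteq> 1" "\<And>x. f (g * x) = c * f x" using conjunct1[OF F(2)] by blast
  note f = spec[OF conjunct1[OF F(1)]] n0 c
  note fS = bspec[OF conjunct2[OF F(2)]]
  have fS': "\<exists>c. \<forall>x. f (t * x) = c * f x" if "coprime t a" for t
  proof -
    have "t mod a \<in> ?S" using that a by simp
    then obtain c where "\<forall>x. f (t mod a * x) = c * f x" using fS by blast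
    moreover have "f (t mod a * x) = f (t * x)" for x
      by (rule periodic_cong[of f a, OF f(1)]) (simp add: unique_euclidean_semiring_class.cong_def mod_mult_left_eq)
    ultimately show ?thesis by auto
  qed
  have f1: "f (t * x) * f 1 = f t * f x" if t: "coprime t a" for t x
  proof -
    obtain c where "\<And>x. f (t * x) = c * f x" using fS'[OF t] by blast
    note this[of x] this[of 1]
    then show ?thesis by (metis mult.assoc mult.commute mult.right_neutral)
  qed
  have "f 1 \<noteq> 0"
  proof -
    obtain c where "\<forall>x. f (n0 * x) = c * f x" using fS'[OF f(2)] by blast
    then have "f (n0 * 1) = c * f 1" by blast
    then show ?thesis using f(3) by auto
  qed
  define X where "X = (\<lambda>n. if coprime n a then f n / f 1 else 0)"
  have nz: "f n \<noteq> 0" if n: "coprime n a" for n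
  proof
    assume "f n = 0"
    obtain m where "[n * m = Suc 0] (mod a)" using cong_solve_coprime_nat[OF n] ..
    then have m: "[n * m = 1] (mod a)" by simp
    have "f (n * m) * f 1 = 0" using f1[OF n] \<open>f n = 0\<close> by simp
    moreover have "f (n * m) = f 1" using m by (rule periodic_cong[of f a, OF f(1)])
    ultimately show False using \<open>f 1 \<noteq> 0\<close> by simp
  qed
  have X0: "X n = 0 \<longleftrightarrow> \<not> coprime n a" for n
    using nz \<open>f 1 \<noteq> 0\<close> by (simp add: X_def)
  have Xadd: "X (n + a) = X n" for n
    using f(1)[of n] by (simp add: X_def coprime_add_right_nat)
  have Xmult: "X (m * n) = X m * X n" for m n
  proof (cases "coprime m a \<and> coprime n a")
    case True
    then have "f (m * n) * f 1 = f m * f n" using f1 by blast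
    with True show ?thesis using \<open>f 1 \<noteq> 0\<close> by (simp add: X_def field_simps)
  qed (auto simp: X_def)
  have X1: "X 1 = 1" using \<open>f 1 \<noteq> 0\<close> by (simp add: X_def)
  have X: "X \<in> dchars a"
    unfolding dchars_def using X0 Xadd Xmult X1 by blast
  have "f g = c * f 1" using f(5)[of 1] by (simp only: mult_1_right)
  then have "X g = c" using g \<open>f 1 \<noteq> 0\<close> by (simp add: X_def)
  then have "X g \<noteq> 1" using f(4) by simp
  then show ?thesis using bexI[of "\<lambda>X. X g \<noteq> 1" X "dchars a"] X by simp
qed

section \<open>Orthogonality relations\<close>

lemma sum_dchar:
  assumes a: "a > 0" and chi: "X \<in> dchars a"
  shows "(\<Sum>n<a. X n) = (if X = princ a then of_nat (totient a) else 0)"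
proof (cases "X = princ a")
  case True
  have "(\<Sum>n<a. princ a n) = of_nat (card {n\<in>{..<a}. coprime n a})"
    unfolding princ_def by (subst sum.inter_filter[symmetric]) auto
  \<comment> \<open>\<open>totatives a\<close> lies in {1..a} and the residues in
    \<open>{..<a}\<close>. The two sets differ only for a = 1, where the totative 1 corresponds to
    the residue 0.\<close>
  also have "{n\<in>{..<a}. coprime n a} = (\<lambda>n. n mod a) ` totatives a"
  proof -
    have "{n\<in>{..<a}. coprime n a} \<subseteq> (\<lambda>n. n mod a) ` totatives a"
    proof
      fix n assume n: "n \<in> {n\<in>{..<a}. coprime n a}"
      show "n \<in> (\<lambda>n. n mod a) ` totatives a"
      proof (cases "n = 0")
        case True
        then show ?thesis using n by (auto simp: totatives_def image_iff intro!: exI[of _ 1])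
      next
        case False
        then show ?thesis using n by (auto simp: totatives_def image_iff intro!: bexI[of _ n])
      qed
    qed
    moreover have "(\<lambda>n. n mod a) ` totatives a \<subseteq> {n\<in>{..<a}. coprime n a}"
      using a by (auto simp: totatives_def)
    ultimately show ?thesis by blast
  qed
  also have "card \<dots> = card (totatives a)"
  proof (rule card_image, rule inj_onI)
    fix x y assume xy: "x \<in> totatives a" "y \<in> totatives a" "x mod a = y mod a"
    show "x = y"
    proof (cases "x = a \<or> y = a")
      case True
      then show ?thesis using xy
        by (auto simp: totatives_def dest!: mod_0_imp_dvd dvd_imp_le sym[of 0])
    next
      case False
      then show ?thesis using xy by (auto simp: totatives_def le_less)
    qed
  qed
  finally show ?thesis using True by (simp add: totient_def)
next
  case False
  then obtain g where g: "X g \<noteq> princ a g" by auto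
  have cg: "coprime g a" "X g \<noteq> 1"
    using g dchars_eq_0_iff[OF chi, of g] by (auto simp: princ_def split: if_splits)
  have "bij_betw (\<lambda>n. g * n mod a) {..<a} {..<a}"
  proof -
    have "inj_on (\<lambda>n. g * n mod a) {..<a}"
      using cg(1) by (auto intro!: inj_onI simp: unique_euclidean_semiring_class.cong_def[symmetric] cong_mult_lcancel_nat dest: cong_less_modulus_unique_nat)
    moreover have "(\<lambda>n. g * n mod a) ` {..<a} \<subseteq> {..<a}" using a by auto
    ultimately show ?thesis
      by (metis bij_betw_def endo_inj_surj finite_lessThan)
  qed
  then have "(\<Sum>n<a. X n) = (\<Sum>n<a. X (g * n mod a))"
    by (rule sum.reindex_bij_betw[symmetric])
  also have "\<dots> = (\<Sum>n<a. X g * X n)"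
    by (intro sum.cong refl) (metis dchars_mult[OF chi] periodic_mod[of X] dchars_add[OF chi])
  also have "\<dots> = X g * (\<Sum>n<a. X n)" by (rule sum_distrib_left[symmetric])
  finally have "(1 - X g) * (\<Sum>n<a. X n) = 0" by (simp add: algebra_simps)
  then show ?thesis using cg False by simp
qed

text \<open>For a unit n other than 1, multiplication by a character \<psi> with \<psi> n different
  from 1 permutes the characters and scales the sum by \<psi> n, so the sum is 0.\<close>

lemma sum_over_dchars:
  assumes a: "a > 0"
  shows "(\<Sum>X\<in>dchars a. X n) = (if [n = 1] (mod a) then of_nat (card (dchars a)) else 0)"
proof (cases "coprime n a")
  case False
  have "\<not> [n = 1] (mod a)" using False by (metis cong_imp_coprime cong_sym coprime_1_left)
  moreover have "X n = 0" if "X \<in> dchars a" for X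
    using dchars_eq_0_iff[OF that] False by blast
  ultimately show ?thesis by (auto intro: sum.neutral)
next
  case True
  show ?thesis
  proof (cases "[n = 1] (mod a)")
    case True
    have "X n = 1" if "X \<in> dchars a" for X
      using dchars_cong[OF that True] dchars_1[OF that] by simp
    then have "(\<Sum>X\<in>dchars a. X n) = (\<Sum>X\<in>dchars a. 1)" by (rule sum.cong[OF refl])
    with True show ?thesis by simp
  next
    case False
    obtain \<psi> where psi: "\<psi> \<in> dchars a" "\<psi> n \<noteq> 1" using exists_dchar_neq_1[OF a True False] by blast
    have inj: "inj_on (\<lambda>X k. \<psi> k * X k) (dchars a)"
    proof (rule inj_onI, rule ext)
      fix X X' k assume c: "X \<in> dchars a" "X' \<in> dchars a" "(\<lambda>k. \<psi> k * X k) = (\<lambda>k. \<psi> k * X' k)"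
      show "X k = X' k"
        using fun_cong[OF c(3), of k] dchars_eq_0_iff[OF psi(1), of k] dchars_eq_0_iff[OF c(1), of k]
          dchars_eq_0_iff[OF c(2), of k] by auto
    qed
    have "bij_betw (\<lambda>X k. \<psi> k * X k) (dchars a) (dchars a)"
      using inj endo_inj_surj[OF finite_dchars[OF a] _ inj] dchars_times[OF psi(1)]
      by (auto simp: bij_betw_def)
    then have "(\<Sum>X\<in>dchars a. X n) = (\<Sum>X\<in>dchars a. \<psi> n * X n)"
      by (rule sum.reindex_bij_betw[symmetric, where g = "\<lambda>X. X n"])
    also have "\<dots> = \<psi> n * (\<Sum>X\<in>dchars a. X n)" by (rule sum_distrib_left[symmetric])
    finally have "(1 - \<psi> n) * (\<Sum>X\<in>dchars a. X n) = 0" by (simp add: algebra_simps)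
    with psi False show ?thesis by simp
  qed
qed

text \<open>The double sum of X n over characters and residues is evaluated in both orders: summing
  over n first leaves only the principal character, summing over X first leaves only n = 1.\<close>

lemma card_dchars:
  assumes a: "a > 0"
  shows "card (dchars a) = totient a"
proof -
  have "(\<Sum>X\<in>dchars a. \<Sum>n<a. X n) = of_nat (totient a)"
    using finite_dchars[OF a] princ_in_dchars by (simp add: sum_dchar[OF a] sum.delta')
  then have "of_nat (totient a) = (\<Sum>X\<in>dchars a. \<Sum>n<a. X n)" ..
  also have "\<dots> = (\<Sum>n<a. if [n = 1] (mod a) then of_nat (card (dchars a)) else (0::complex))"
    by (subst sum.swap) (simp add: sum_over_dchars[OF a])
  \<comment> \<open>For a = 1 the residue of 1 is 0, hence \<open>1 mod a\<close>.\<close>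
  also have "\<dots> = (\<Sum>n<a. if n = 1 mod a then of_nat (card (dchars a)) else 0)"
    by (intro sum.cong refl) (simp add: unique_euclidean_semiring_class.cong_def)
  also have "\<dots> = of_nat (card (dchars a))" using a by simp
  finally have "(of_nat (totient a) :: complex) = of_nat (card (dchars a))" .
  then show ?thesis by simp
qed

text \<open>Values at units have modulus 1, so \<open>cnj (X r)\<close> is X at the inverse q of r,
  and the sum becomes the sum of X (q n) over all characters.\<close>

lemma dchars_orthogonality:
  assumes a: "a > 0" and r: "coprime r a"
  shows "(\<Sum>X\<in>dchars a. cnj (X r) * X n) = (if [n = r] (mod a) then of_nat (totient a) else 0)"
proof -
  obtain q where "[r * q = Suc 0] (mod a)" using cong_solve_coprime_nat[OF r] ..
  then have q: "[r * q = 1] (mod a)" by simp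
  have "cnj (X r) = X q" if "X \<in> dchars a" for X
  proof -
    have "X r * X q = 1"
      using dchars_cong[OF that q] dchars_mult[OF that] dchars_Suc_0[OF that] by simp
    moreover have "X r * cnj (X r) = 1"
      using norm_dchars[OF that a, of r] r complex_norm_square[of "X r"] by simp
    ultimately show ?thesis by (metis mult.assoc mult.commute mult_1)
  qed
  then have "(\<Sum>X\<in>dchars a. cnj (X r) * X n) = (\<Sum>X\<in>dchars a. X (q * n))"
    by (intro sum.cong refl) (simp add: dchars_mult)
  also have "\<dots> = (if [q * n = 1] (mod a) then of_nat (totient a) else 0)"
    by (simp add: sum_over_dchars[OF a] card_dchars[OF a])
  also have "[q * n = 1] (mod a) \<longleftrightarrow> [n = r] (mod a)"
  proof
    assume "[q * n = 1] (mod a)"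
    then have "[r * (q * n) = r * 1] (mod a)" by (intro cong_mult cong_refl)
    moreover have "[r * q * n = 1 * n] (mod a)" using q by (intro cong_mult cong_refl)
    ultimately show "[n = r] (mod a)" by (simp add: mult.assoc) (meson cong_sym cong_trans)
  next
    assume "[n = r] (mod a)"
    then have "[q * n = q * r] (mod a)" by (intro cong_mult cong_refl)
    with q show "[q * n = 1] (mod a)" by (metis cong_trans mult.commute)
  qed
  finally show ?thesis .
qed

section \<open>Dirichlet series\<close>

text \<open>The term for \<open>n = 0\<close> vanishes because \<open>0 powr z = 0\<close>.\<close>

definition dser :: "(nat \<Rightarrow> complex) \<Rightarrow> complex \<Rightarrow> complex" where
  "dser f s = (\<Sum>n. f n * of_nat n powr (-s))"

lemma norm_nat_powr: "norm (of_nat n powr z :: complex) = real n powr Re z"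
  using norm_powr_real_powr[of "of_nat n" z] by (cases "n = 0") auto

text \<open>A local Weierstrass test: the majorant \<open>h\<close> may depend on the point, since
  on an open half plane the bounds degenerate towards the boundary.\<close>

lemma holomorphic_suminf:
  fixes f :: "nat \<Rightarrow> complex \<Rightarrow> complex"
  assumes S: "open S" and f: "\<And>n. f n holomorphic_on S"
    and bound: "\<And>x. x \<in> S \<Longrightarrow> \<exists>d h. 0 < d \<and> summable h \<and> (\<forall>n. \<forall>y\<in>ball x d \<inter> S. norm (f n y) \<le> h n)"
  shows "(\<lambda>x. \<Sum>n. f n x) holomorphic_on S"
proof -
  have "\<exists>g g'. \<forall>x\<in>S. ((\<lambda>n. f n x) sums g x) \<and> ((\<lambda>n. deriv (f n) x) sums g' x) \<and> (g has_field_derivative g' x) (at x)"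
  proof (rule series_and_derivative_comparison_local[OF S])
    show "(f n has_field_derivative deriv (f n) x) (at x)" if "x \<in> S" for n x
      using holomorphic_derivI[OF f S that] .
    show "\<exists>d h. 0 < d \<and> summable h \<and> (\<forall>\<^sub>F n in sequentially. \<forall>y\<in>ball x d \<inter> S. norm (f n y) \<le> h n)"
      if x: "x \<in> S" for x
    proof -
      obtain d h where "0 < d" "summable h" "\<forall>n. \<forall>y\<in>ball x d \<inter> S. norm (f n y) \<le> h n"
        using bound[OF x] by blast
      then show ?thesis by (intro exI[of _ d] exI[of _ h]) (auto intro: always_eventually)
    qed
  qed
  then obtain g g' where g: "\<And>x. x \<in> S \<Longrightarrow> (\<lambda>n. f n x) sums g x" "\<And>x. x \<in> S \<Longrightarrow> (g has_field_derivative g' x) (at x)"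
    by blast
  have "g holomorphic_on S" using g(2) S by (auto simp: holomorphic_on_open)
  moreover have "(\<Sum>n. f n x) = g x" if "x \<in> S" for x
    using g(1)[OF that] by (simp add: sums_iff)
  ultimately show ?thesis by (metis (no_types, lifting) holomorphic_transform)
qed

lemma summable_log_powr:
  assumes "\<sigma> > 1"
  shows "summable (\<lambda>n. (1 + ln (real n)) * real n powr (-\<sigma>))"
proof -
  \<comment> \<open>Half of the surplus of \<sigma> over 1 pays for the logarithm, which is at most
    n^e / e; the remaining exponent e - \<sigma> is still below -1.\<close>
  define e where "e = (\<sigma> - 1) / 2"
  have e: "e > 0" using assms by (simp add: e_def)
  have "summable (\<lambda>n. (1 + 1 / e) * real n powr (e - \<sigma>))"
    using assms by (intro summable_mult) (simp add: summable_real_powr_iff e_def field_simps)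
  then show ?thesis
  proof (rule summable_comparison_test_ev[rotated])
    show "\<forall>\<^sub>F n in sequentially. norm ((1 + ln (real n)) * real n powr (-\<sigma>)) \<le> (1 + 1 / e) * real n powr (e - \<sigma>)"
      using eventually_gt_at_top[of 0]
    proof eventually_elim
      case (elim n)
      have "ln (real n) \<le> real n powr e / e" using elim e by (intro ln_powr_bound) auto
      moreover have "1 \<le> real n powr e" using elim e by (intro ge_one_powr_ge_zero) auto
      ultimately have "1 + ln (real n) \<le> (1 + 1 / e) * real n powr e" by (simp add: algebra_simps)
      moreover have "0 \<le> 1 + ln (real n)" using elim by simp
      ultimately have "norm ((1 + ln (real n)) * real n powr (-\<sigma>)) \<le> (1 + 1 / e) * real n powr e * real n powr (-\<sigma>)"
        by (simp add: abs_mult mult_right_mono)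
      then show ?case by (simp add: powr_add[symmetric] mult.assoc)
    qed
  qed
qed

context
  fixes f :: "nat \<Rightarrow> complex"
  assumes f: "\<And>n. n > 0 \<Longrightarrow> norm (f n) \<le> 1 + ln (real n)"
begin

text \<open>The growth bound 1 + ln n covers all coefficients that occur: X n, X n ln n,
  \<open>mangoldt n * X n\<close> and the differences between the von Mangoldt function on a residue
  class and its mean.\<close>

lemma dser_term_bound:
  assumes "Re s \<ge> \<sigma>"
  shows "norm (f n * of_nat n powr (-s)) \<le> (1 + ln (real n)) * real n powr (-\<sigma>)"
proof (cases "n = 0")
  case False
  then have "norm (f n * of_nat n powr (-s)) \<le> (1 + ln (real n)) * real n powr (- Re s)"
    unfolding norm_mult norm_nat_powr using f[of n] by (simp add: mult_right_mono)
  also have "\<dots> \<le> (1 + ln (real n)) * real n powr (-\<sigma>)"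
    using False assms by (intro mult_left_mono powr_mono) auto
  finally show ?thesis .
qed simp

lemma dser_abs_summable:
  assumes "Re s > 1"
  shows "summable (\<lambda>n. norm (f n * of_nat n powr (-s)))"
  using summable_log_powr[OF assms]
  by (rule summable_comparison_test[rotated]) (use dser_term_bound[of "Re s" s] in auto)

lemma dser_summable: "Re s > 1 \<Longrightarrow> summable (\<lambda>n. f n * of_nat n powr (-s))"
  using dser_abs_summable by (rule summable_norm_cancel)

lemma dser_sums: "Re s > 1 \<Longrightarrow> (\<lambda>n. f n * of_nat n powr (-s)) sums dser f s"
  using dser_summable by (simp add: dser_def summable_sums)

lemma dser_has_sum: "Re s > 1 \<Longrightarrow> ((\<lambda>n. f n * of_nat n powr (-s)) has_sum dser f s) UNIV"
  by (rule norm_summable_imp_has_sum[OF dser_abs_summable dser_sums])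

lemma dser_local_bound:
  assumes "Re x > 1"
  shows "\<exists>d h. 0 < d \<and> summable h \<and> (\<forall>n. \<forall>y\<in>ball x d \<inter> S. norm (f n * of_nat n powr (-y)) \<le> h n)"
proof (intro exI conjI allI ballI)
  let ?d = "(Re x - 1) / 2"
  show "?d > 0" using assms by simp
  show "summable (\<lambda>n. (1 + ln (real n)) * real n powr (-(1 + ?d)))"
    using assms by (intro summable_log_powr) simp
  fix n y assume "y \<in> ball x ?d \<inter> S"
  then have "\<bar>Re (x - y)\<bar> < ?d" using abs_Re_le_cmod[of "x - y"] by (simp add: dist_norm)
  then show "norm (f n * of_nat n powr (-y)) \<le> (1 + ln (real n)) * real n powr (-(1 + ?d))"
  proof (intro dser_term_bound)
    have "Re x - Re y < ?d" using \<open>\<bar>Re (x - y)\<bar> < ?d\<close> unfolding minus_complex.sel by linarith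
    then show "1 + ?d \<le> Re y" by argo
  qed
qed

lemma dser_derivative:
  assumes "Re s > 1"
  shows "(dser f has_field_derivative dser (\<lambda>n. - f n * of_real (ln (real n))) s) (at s)"
proof -
  let ?S = "{s. Re s > 1}"
  have S: "open ?S" by (rule open_halfspace_Re_gt)
  have "\<exists>g g'. \<forall>x\<in>?S. ((\<lambda>n. f n * of_nat n powr (-x)) sums g x)
      \<and> ((\<lambda>n. - f n * of_real (ln (real n)) * of_nat n powr (-x)) sums g' x) \<and> (g has_field_derivative g' x) (at x)"
  proof (rule series_and_derivative_comparison_local[OF S])
    show "((\<lambda>x. f n * of_nat n powr (-x)) has_field_derivative - f n * of_real (ln (real n)) * of_nat n powr (-x)) (at x)" for n x
    proof (cases "n = 0")
      case False
      have "Ln (of_nat n) = of_real (ln (real n))"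
        using Ln_of_real[of "real n"] False by simp
      moreover have "((\<lambda>x. of_nat n powr (-x)) has_field_derivative (Ln (of_nat n) * of_nat n powr (-x) * (-1))) (at x)"
        using False by (intro DERIV_chain2[OF has_field_derivative_powr_right]) (auto intro!: derivative_eq_intros)
      ultimately show ?thesis using DERIV_cmult[of _ _ x UNIV "f n"] by (fastforce simp: mult_ac)
    qed simp
    show "\<exists>d h. 0 < d \<and> summable h \<and> (\<forall>\<^sub>F n in sequentially. \<forall>y\<in>ball x d \<inter> ?S. norm (f n * of_nat n powr (-y)) \<le> h n)"
      if x: "x \<in> ?S" for x
    proof -
      obtain d h where "0 < d" "summable h" "\<forall>n. \<forall>y\<in>ball x d \<inter> ?S. norm (f n * of_nat n powr (-y)) \<le> h n"
        using dser_local_bound[of x ?S] x by auto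
      then show ?thesis by (intro exI[of _ d] exI[of _ h]) (auto intro: always_eventually)
    qed
  qed
  then obtain g g' where g: "\<And>x. Re x > 1 \<Longrightarrow> (\<lambda>n. f n * of_nat n powr (-x)) sums g x"
    "\<And>x. Re x > 1 \<Longrightarrow> (\<lambda>n. - f n * of_real (ln (real n)) * of_nat n powr (-x)) sums g' x"
    "\<And>x. Re x > 1 \<Longrightarrow> (g has_field_derivative g' x) (at x)"
    by auto
  have "g x = dser f x" if "Re x > 1" for x
    using g(1)[OF that] by (simp add: dser_def sums_iff)
  moreover have "g' s = dser (\<lambda>n. - f n * of_real (ln (real n))) s"
    using g(2)[OF assms] by (simp add: dser_def sums_iff)
  ultimately show ?thesis
    using has_field_derivative_transform_within_open[OF g(3)[OF assms] S, of "dser f"] assms by simp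
qed

lemma dser_holomorphic: "dser f holomorphic_on {s. Re s > 1}"
  using dser_derivative by (auto simp: holomorphic_on_open open_halfspace_Re_gt)

end

text \<open>Pairs (d, m) are collected by their product n = d m. This serves both the product of
  Dirichlet series and the expansion of the Lambert series.\<close>

lemma has_sum_dirichlet_regroup:
  fixes F :: "nat \<times> nat \<Rightarrow> complex"
  assumes "(F has_sum T) ({0<..} \<times> {0<..})"
  shows "((\<lambda>n. \<Sum>d | d dvd n. F (d, n div d)) has_sum T) {0<..}"
proof -
  have "((\<lambda>(n, d). F (d, n div d)) has_sum T) (Sigma {0<..} (\<lambda>n. {d. d dvd n})) \<longleftrightarrow> (F has_sum T) ({0<..} \<times> {0<..})"
    by (rule has_sum_reindex_bij_witness[where j = "\<lambda>(n, d). (d, n div d)" and i = "\<lambda>(d, m). (d * m, d)"])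
       (auto elim!: dvdE)
  with assms have "((\<lambda>(n, d). F (d, n div d)) has_sum T) (Sigma {0<..} (\<lambda>n. {d. d dvd n}))" by simp
  then show ?thesis
    by (rule has_sum_SigmaD) (auto intro!: has_sum_finiteI)
qed

lemma mangoldt_le_ln: "n > 0 \<Longrightarrow> mangoldt n \<le> ln (real n)"
proof -
  assume n: "n > 0"
  have "mangoldt n \<le> (\<Sum>d | d dvd n. mangoldt d :: real)"
    using n by (intro member_le_sum) (auto simp: mangoldt_nonneg)
  then show ?thesis using mangoldt_sum[of n, where ?'a = real] n by simp
qed

lemma has_sum_Times_complex:
  fixes f g :: "nat \<Rightarrow> complex"
  assumes f: "(f has_sum S) I" and g: "(g has_sum T) J"
  shows "((\<lambda>(x, y). f x * g y) has_sum (S * T)) (I \<times> J)"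
proof (rule has_sum_SigmaI[where g = "\<lambda>x. f x * T"])
  show "((\<lambda>y. case (x, y) of (x, y) \<Rightarrow> f x * g y) has_sum f x * T) J" for x
    using has_sum_cmult_right[OF g] by simp
  show "((\<lambda>x. f x * T) has_sum S * T) I" using has_sum_cmult_left[OF f] .
  have "(\<lambda>x. norm (f x)) summable_on I" "(\<lambda>x. norm (g x)) summable_on J"
    using f g summable_on_iff_abs_summable_on_complex by (auto simp: summable_on_def)
  then have "(\<lambda>z. norm (case z of (x, y) \<Rightarrow> f x * g y)) summable_on I \<times> J"
    by (intro Infinite_Sum.abs_summable_on_Sigma_iff[THEN iffD2] conjI ballI)
       (auto simp: norm_mult abs_mult infsum_cmult_right' intro!: summable_on_cmult_right summable_on_cmult_left)
  then show "(\<lambda>(x, y). f x * g y) summable_on I \<times> J" by (rule Infinite_Sum.abs_summable_summable)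
qed

text \<open>In the product of the two series the coefficient at n is the sum of
  \<open>mangoldt d * X d * X (n div d)\<close> over the divisors d. Complete multiplicativity pulls
  out X n and leaves the divisor sum of the von Mangoldt function, which is ln n.\<close>

theorem dser_log_mult:
  assumes X: "\<And>m n. X (m * n) = X m * X n" "\<And>n. norm (X n) \<le> 1" and s: "Re s > 1"
  shows "dser (\<lambda>n. X n * of_real (ln (real n))) s = dser X s * dser (\<lambda>n. mangoldt n * X n) s"
proof -
  have b1: "norm (X n) \<le> 1 + ln (real n)" if "n > 0" for n
    using X(2)[of n] that by (smt (verit) ln_ge_zero of_nat_1 of_nat_less_iff One_nat_def Suc_leI of_nat_le_iff)
  have b2: "norm (mangoldt n * X n) \<le> 1 + ln (real n)" if "n > 0" for n
  proof -
    have "norm (mangoldt n :: complex) = (mangoldt n :: real)"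
      using mangoldt_nonneg[of n] of_real_mangoldt[of n, where ?'a = complex, symmetric] by (simp del: of_real_mangoldt)
    then have "norm (mangoldt n * X n) \<le> (mangoldt n :: real) * 1"
      unfolding norm_mult using X(2)[of n] mangoldt_nonneg[of n] by (intro mult_mono) auto
    then show ?thesis using mangoldt_le_ln[OF that] by simp
  qed
  have b3: "norm (X n * of_real (ln (real n))) \<le> 1 + ln (real n)" if "n > 0" for n
    using X(2)[of n] that by (simp add: norm_mult) (smt (verit) mult_left_le_one_le ln_ge_zero norm_ge_zero One_nat_def Suc_leI of_nat_1 of_nat_le_iff)
  have restrict: "(g has_sum T) {0<..}" if "(g has_sum T) UNIV" "g 0 = 0" for g :: "nat \<Rightarrow> complex" and T
    using that by (subst has_sum_cong_neutral[where T = UNIV and g = g]) auto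
  have h1: "((\<lambda>n. X n * of_nat n powr (-s)) has_sum dser X s) {0<..}"
    by (rule restrict[OF dser_has_sum[OF b1 s]]) auto
  have h2: "((\<lambda>n. mangoldt n * X n * of_nat n powr (-s)) has_sum dser (\<lambda>n. mangoldt n * X n) s) {0<..}"
    by (rule restrict[OF dser_has_sum[OF b2 s]]) auto
  have h3: "((\<lambda>n. X n * of_real (ln (real n)) * of_nat n powr (-s)) has_sum dser (\<lambda>n. X n * of_real (ln (real n))) s) {0<..}"
    by (rule restrict[OF dser_has_sum[OF b3 s]]) auto
  let ?F = "\<lambda>(d, m). mangoldt d * X d * of_nat d powr (-s) * (X m * of_nat m powr (-s))"
  have "((\<lambda>n. \<Sum>d | d dvd n. ?F (d, n div d)) has_sum (dser (\<lambda>n. mangoldt n * X n) s * dser X s)) {0<..}"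
    by (rule has_sum_dirichlet_regroup[OF has_sum_Times_complex[OF h2 h1]])
  moreover have "(\<Sum>d | d dvd n. ?F (d, n div d)) = X n * of_real (ln (real n)) * of_nat n powr (-s)" if "n \<in> {0<..}" for n
  proof -
    have "?F (d, n div d) = mangoldt d * (X n * of_nat n powr (-s))" if "d dvd n" for d
    proof -
      have n: "n = d * (n div d)" using that by simp
      have "of_nat n powr (-s) = of_nat d powr (-s) * (of_nat (n div d) powr (-s) :: complex)"
        by (subst n, subst of_nat_mult, subst powr_times_real) auto
      moreover have "X n = X d * X (n div d)" by (subst n) (rule X(1))
      ultimately show ?thesis by simp
    qed
    then have "(\<Sum>d | d dvd n. ?F (d, n div d)) = (\<Sum>d | d dvd n. mangoldt d * (X n * of_nat n powr (-s)))"
      by (intro sum.cong) auto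
    also have "\<dots> = of_real (ln (real n)) * (X n * of_nat n powr (-s))"
      using that by (subst mangoldt_sum[symmetric]) (auto simp: sum_distrib_right)
    finally show ?thesis by (simp add: mult_ac)
  qed
  ultimately have "((\<lambda>n. X n * of_real (ln (real n)) * of_nat n powr (-s)) has_sum (dser (\<lambda>n. mangoldt n * X n) s * dser X s)) {0<..}"
    by (subst has_sum_cong[symmetric]) auto
  with h3 show ?thesis using has_sum_unique by (fastforce simp: mult.commute)
qed

text \<open>A first-order Taylor remainder, by two mean value inequalities on the segment from x to
  x + a: one for z^(-s), and, with its result as derivative bound, one for z^(1-s) minus its linear
  part at x.\<close>

lemma powr_second_difference_bound:
  fixes x a :: real and s :: complex
  assumes x: "x > 0" and a: "a \<ge> 0" and s: "Re s > 0"
  shows "norm (of_real (x + a) powr (1 - s) - of_real x powr (1 - s) - (1 - s) * of_real a * of_real x powr (-s))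
    \<le> norm (1 - s) * norm s * a\<^sup>2 * x powr (- Re s - 1)"
proof -
  let ?x = "of_real x :: complex" and ?y = "of_real (x + a) :: complex"
  let ?S = "closed_segment ?x ?y"
  have S: "z \<notin> \<real>\<^sub>\<le>\<^sub>0" "norm (z powr w) \<le> x powr Re w" "norm (z - ?x) \<le> a"
    if z: "z \<in> ?S" and w: "Re w \<le> 0" for z w
  proof -
    from z obtain u where u: "0 \<le> u" "u \<le> 1" "z = (1 - u) *\<^sub>R ?x + u *\<^sub>R ?y" by (auto simp: in_segment)
    define t where "t = x + u * a"
    have t: "z = of_real t" "t \<ge> x" "t - x \<le> a"
      using u a by (auto simp: t_def scaleR_conv_of_real algebra_simps mult_left_le)
    show "z \<notin> \<real>\<^sub>\<le>\<^sub>0" using t x by (auto simp: complex_nonpos_Reals_iff)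
    have "norm (z powr w) = t powr Re w" using t x norm_powr_real_powr[of z w] by simp
    also have "\<dots> \<le> x powr Re w" using t x w by (intro powr_mono2') auto
    finally show "norm (z powr w) \<le> x powr Re w" .
    have "norm (z - ?x) = \<bar>t - x\<bar>" unfolding t(1) by (metis norm_of_real of_real_diff)
    then show "norm (z - ?x) \<le> a" using t by simp
  qed
  have A: "norm (z powr (-s) - ?x powr (-s)) \<le> norm s * x powr (- Re s - 1) * a" if z: "z \<in> ?S" for z
  proof -
    have "norm (z powr (-s) - ?x powr (-s)) \<le> norm s * x powr (- Re s - 1) * norm (z - ?x)"
    proof (rule field_differentiable_bound[of ?S _ "\<lambda>z. (-s) * z powr (-s - 1)"])
      fix z assume z: "z \<in> ?S"
      show "((\<lambda>z. z powr (-s)) has_field_derivative (-s) * z powr (-s - 1)) (at z within ?S)"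
        using S(1)[OF z, of 0] by (auto intro!: derivative_eq_intros)
      have "norm (z powr (-s - 1)) \<le> x powr (- Re s - 1)" using S(2)[OF z, of "-s - 1"] s by simp
      then show "norm (- s * z powr (- s - 1)) \<le> norm s * x powr (- Re s - 1)"
        by (simp add: norm_mult mult_left_mono)
    qed (use z in auto)
    also have "\<dots> \<le> norm s * x powr (- Re s - 1) * a"
      using S(3)[OF z, of 0] by (intro mult_left_mono) auto
    finally show ?thesis .
  qed
  have "norm ((?y powr (1 - s) - (1 - s) * ?y * ?x powr (-s)) - (?x powr (1 - s) - (1 - s) * ?x * ?x powr (-s)))
     \<le> norm (1 - s) * (norm s * x powr (- Re s - 1) * a) * norm (?y - ?x)"
  proof (rule field_differentiable_bound[of ?S _ "\<lambda>z. (1 - s) * (z powr (-s) - ?x powr (-s))"])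
    fix z assume z: "z \<in> ?S"
    show "((\<lambda>z. z powr (1 - s) - (1 - s) * z * ?x powr (-s)) has_field_derivative
        (1 - s) * (z powr (-s) - ?x powr (-s))) (at z within ?S)"
      using S(1)[OF z, of 0] by (auto intro!: derivative_eq_intros simp: algebra_simps)
    show "norm ((1 - s) * (z powr (-s) - ?x powr (-s))) \<le> norm (1 - s) * (norm s * x powr (- Re s - 1) * a)"
      using A[OF z] by (simp add: norm_mult mult_left_mono)
  qed auto
  moreover have "norm (?y - ?x) = a" using a by simp
  ultimately show ?thesis by (simp add: algebra_simps power2_eq_square)
qed

text \<open>Since \<open>f\<close> is periodic, the sum of \<open>f n * ((n + a) powr (1 - s) - n powr (1 - s))\<close> telescopes with
  lag \<open>a\<close>. Adding \<open>1 / a\<close> times it to \<open>(s - 1) * dser f s\<close> leaves terms of order \<open>n powr (- Re s - 1)\<close>.\<close>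

theorem dser_continuation:
  fixes f :: "nat \<Rightarrow> complex"
  assumes a: "a > 0" and per: "\<And>n. f (n + a) = f n" and f1: "\<And>n. norm (f n) \<le> 1"
  obtains G where "G holomorphic_on {s. Re s > 0}" "\<And>s. Re s > 1 \<Longrightarrow> G s = (s - 1) * dser f s"
    "G 1 = (\<Sum>n<a. f n) / of_nat a"
proof -
  let ?S = "{s. Re s > 0}"
  define T where "T = (\<lambda>n s. f (Suc n) * ((s - 1) * of_nat (Suc n) powr (-s)
      + (of_nat (Suc n + a) powr (1 - s) - of_nat (Suc n) powr (1 - s)) / of_nat a))"
  \<comment> \<open>The first a terms, which telescoping with lag a leaves over.\<close>
  define E where "E = (\<lambda>s. (\<Sum>n<a. f (Suc n) * of_nat (Suc n) powr (1 - s)) / of_nat a)"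
  define G where "G = (\<lambda>s. (\<Sum>n. T n s) + E s)"
  have nz: "of_nat (Suc n) \<noteq> (0::complex)" "of_nat (Suc n + a) \<noteq> (0::complex)" for n
    by (simp_all only: of_nat_eq_0_iff)
  have Tb: "norm (T n s) \<le> norm (1 - s) * norm s * real a * real (Suc n) powr (- Re s - 1)" if "Re s > 0" for n s
  proof -
    have eq: "T n s = f (Suc n) * ((of_real (real (Suc n) + real a) powr (1 - s) - of_real (real (Suc n)) powr (1 - s)
        - (1 - s) * of_real (real a) * of_real (real (Suc n)) powr (-s)) / of_nat a)"
      using a unfolding T_def of_nat_add[of "Suc n" a] by (simp add: field_simps del: of_nat_Suc)
    have "norm (T n s) \<le> 1 * (norm (1 - s) * norm s * (real a)\<^sup>2 * real (Suc n) powr (- Re s - 1) / real a)"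
      unfolding eq norm_mult norm_divide
      using powr_second_difference_bound[of "real (Suc n)" "real a" s] that f1 a
      by (intro mult_mono divide_mono) auto
    then show ?thesis using a by (simp add: power2_eq_square mult_ac)
  qed
  have holT: "(\<lambda>s. \<Sum>n. T n s) holomorphic_on ?S"
  proof (rule holomorphic_suminf)
    show "open ?S" by (rule open_halfspace_Re_gt)
    show "T n holomorphic_on ?S" for n
      unfolding T_def using nz[of n] a by (intro holomorphic_intros) (auto simp del: of_nat_Suc of_nat_add)
    show "\<exists>d h. 0 < d \<and> summable h \<and> (\<forall>n. \<forall>y\<in>ball x d \<inter> ?S. norm (T n y) \<le> h n)" if x: "x \<in> ?S" for x
    proof (intro exI conjI allI ballI)
      let ?d = "Re x / 2" and ?M = "1 + norm x + Re x / 2"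
      show "?d > 0" using x by simp
      have "summable (\<lambda>n. real n powr (- ?d - 1))" using x by (simp add: summable_real_powr_iff)
      then have "summable (\<lambda>n. real (Suc n) powr (- ?d - 1))" by (subst summable_Suc_iff)
      then show "summable (\<lambda>n. ?M * ?M * real a * real (Suc n) powr (- ?d - 1))" by (rule summable_mult)
      fix n y assume "y \<in> ball x ?d \<inter> ?S"
      then have y: "norm (x - y) < ?d" "Re y > 0" by (auto simp: dist_norm)
      have "\<bar>Re (x - y)\<bar> < ?d" using abs_Re_le_cmod[of "x - y"] y(1) by linarith
      then have Rey: "Re y \<ge> ?d" by (auto simp: abs_if split: if_splits)
      have ny: "norm y \<le> norm x + ?d" using norm_triangle_sub[of y x] y(1) by (simp add: norm_minus_commute)
      have n1: "norm (1 - y) \<le> 1 + norm y" using norm_triangle_ineq4[of 1 y] by simp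
      have "norm (T n y) \<le> norm (1 - y) * norm y * real a * real (Suc n) powr (- Re y - 1)" using Tb y by blast
      also have "\<dots> \<le> ?M * ?M * real a * real (Suc n) powr (- ?d - 1)"
      proof -
        have M: "0 \<le> ?M" using x norm_ge_zero[of x] by (simp del: norm_ge_zero)
        show ?thesis using Rey ny n1 M x by (intro mult_mono powr_mono mult_nonneg_nonneg) auto
      qed
      finally show "norm (T n y) \<le> ?M * ?M * real a * real (Suc n) powr (- ?d - 1)" .
    qed
  qed
  moreover have "E holomorphic_on ?S"
    unfolding E_def using nz a by (intro holomorphic_intros) (auto simp del: of_nat_Suc)
  ultimately have "G holomorphic_on ?S" unfolding G_def by (intro holomorphic_intros)
  moreover have "G s = (s - 1) * dser f s" if s: "Re s > 1" for s
  proof -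
    have b: "norm (f n) \<le> 1 + ln (real n)" if "n > 0" for n
    proof -
      have "0 \<le> ln (real n)" using that by simp
      with f1[of n] show ?thesis by linarith
    qed
    define u where "u = (\<lambda>n. f n * of_nat n powr (1 - s))"
    have "(\<lambda>n. f n * of_nat n powr (-s)) sums dser f s" by (rule dser_sums[OF b s])
    then have D: "(\<lambda>n. f (Suc n) * of_nat (Suc n) powr (-s)) sums dser f s"
      by (subst sums_Suc_iff) simp
    have u0: "u \<longlonglongrightarrow> 0"
    proof (rule Lim_null_comparison)
      show "\<forall>\<^sub>F n in sequentially. norm (u n) \<le> real n powr (1 - Re s)"
        unfolding u_def norm_mult norm_nat_powr using f1 by (auto intro!: always_eventually mult_left_le_one_le)
      show "(\<lambda>n. real n powr (1 - Re s)) \<longlonglongrightarrow> 0"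
        using s by (intro tendsto_neg_powr filterlim_real_sequentially) auto
    qed
    have tel: "(\<Sum>n<N. u (Suc n + a) - u (Suc n)) = (\<Sum>n<a. u (Suc n + N)) - (\<Sum>n<a. u (Suc n))" for N
    proof (induction N)
      case (Suc N)
      have "(\<Sum>n<a. u (Suc n + Suc N)) = (\<Sum>n<a. u (Suc n + N)) + u (Suc N + a) - u (Suc N)"
        using sum.lessThan_Suc_shift[of "\<lambda>n. u (Suc n + N)" a] by (simp add: add_ac)
      then show ?case using Suc by simp
    qed simp
    have "(\<lambda>N. (\<Sum>n<a. u (Suc n + N)) - (\<Sum>n<a. u (Suc n))) \<longlonglongrightarrow> (\<Sum>n<a. 0) - (\<Sum>n<a. u (Suc n))"
    proof (intro tendsto_diff tendsto_sum tendsto_const)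
      show "(\<lambda>N. u (Suc n + N)) \<longlonglongrightarrow> 0" for n
        using LIMSEQ_ignore_initial_segment[OF u0, of "Suc n"] by (simp only: add.commute)
    qed
    then have U: "(\<lambda>n. u (Suc n + a) - u (Suc n)) sums (- (\<Sum>n<a. u (Suc n)))"
      unfolding sums_def tel by simp
    have Teq: "T n s = (s - 1) * (f (Suc n) * of_nat (Suc n) powr (-s)) + (u (Suc n + a) - u (Suc n)) / of_nat a" for n
      using a unfolding T_def u_def per[of "Suc n"] by (simp add: field_simps del: of_nat_Suc)
    have "(\<lambda>n. T n s) sums ((s - 1) * dser f s + (- (\<Sum>n<a. u (Suc n))) / of_nat a)"
      unfolding Teq by (intro sums_add sums_mult sums_divide D U)
    then show ?thesis by (simp add: G_def E_def u_def sums_iff)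
  qed
  \<comment> \<open>At s = 1 every \<open>T n\<close> vanishes, so only \<open>E 1\<close> remains:
    the mean of f over a period.\<close>
  moreover have "G 1 = (\<Sum>n<a. f n) / of_nat a"
  proof -
    have "T n 1 = 0" for n using nz[of n] by (simp add: T_def del: of_nat_Suc of_nat_add)
    moreover have "(\<Sum>n<a. f (Suc n)) = (\<Sum>n<a. f n)"
      using sum.lessThan_Suc_shift[of f a] per[of 0] by simp
    ultimately show ?thesis by (simp add: G_def E_def del: of_nat_Suc)
  qed
  ultimately show ?thesis using that by blast
qed

section \<open>The value of real L-functions at 1\<close>

text \<open>Summation by parts with partial sums \<open>D\<close> counted from N: they vanish at N,
  are bounded by 2 M, and the decrements of b telescope. Only n from N on enters, so irregular
  values of b at small n do no harm.\<close>

lemma abel_summation_bound: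
  fixes c :: "nat \<Rightarrow> complex" and b :: "nat \<Rightarrow> real" and N K :: nat
  assumes c: "\<And>n. norm (\<Sum>i<n. c i) \<le> M"
    and b: "\<And>n. n \<ge> N \<Longrightarrow> b (Suc n) \<le> b n" "\<And>n. n \<ge> N \<Longrightarrow> 0 \<le> b n" and NK: "N \<le> K"
  shows "norm (\<Sum>n=N..<K. c n * of_real (b n)) \<le> 2 * M * b N"
proof -
  define D where "D = (\<lambda>n. (\<Sum>i<n. c i) - (\<Sum>i<N. c i))"
  have D: "norm (D n) \<le> 2 * M" for n
    using norm_triangle_ineq4[of "\<Sum>i<n. c i" "\<Sum>i<N. c i"] c[of n] c[of N] by (simp add: D_def)
  have eq: "(\<Sum>n=N..<K. c n * of_real (b n)) = D K * of_real (b K) + (\<Sum>n=N..<K. D (Suc n) * of_real (b n - b (Suc n)))"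
    using NK
  proof (induction K rule: dec_induct)
    case (step K)
    then show ?case by (simp add: D_def algebra_simps)
  qed (simp add: D_def)
  have "norm (\<Sum>n=N..<K. D (Suc n) * of_real (b n - b (Suc n))) \<le> (\<Sum>n=N..<K. 2 * M * (b n - b (Suc n)))"
  proof (rule sum_norm_le)
    fix n assume "n \<in> {N..<K}"
    then show "norm (D (Suc n) * of_real (b n - b (Suc n))) \<le> 2 * M * (b n - b (Suc n))"
      unfolding norm_mult norm_of_real using b(1)[of n] D[of "Suc n"] by (simp add: mult_right_mono)
  qed
  also have "\<dots> = 2 * M * (b N - b K)"
    using NK by (induction K rule: dec_induct) (simp_all add: algebra_simps)
  finally have "norm (\<Sum>n=N..<K. D (Suc n) * of_real (b n - b (Suc n))) \<le> 2 * M * (b N - b K)" .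
  moreover have "norm (D K * of_real (b K)) \<le> 2 * M * b K"
    unfolding norm_mult norm_of_real using b(2)[of K] NK D[of K] by (simp add: mult_right_mono)
  ultimately show ?thesis
    unfolding eq using norm_triangle_ineq[of "D K * of_real (b K)" "\<Sum>n=N..<K. D (Suc n) * of_real (b n - b (Suc n))"]
    by (simp add: algebra_simps)
qed

lemma sum_lessThan_add:
  fixes f :: "nat \<Rightarrow> 'a::comm_monoid_add"
  shows "(\<Sum>n<m + k. f n) = (\<Sum>n<m. f n) + (\<Sum>n<k. f (m + n))"
  by (induction k) (simp_all add: add_ac)

text \<open>Full periods sum to 0, which leaves fewer than a terms of modulus at most 1.\<close>

lemma dchar_partial_sum_bound:
  assumes a: "a > 0" and X: "X \<in> dchars a" "X \<noteq> princ a"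
  shows "norm (\<Sum>n<N. X n) \<le> real a"
proof -
  have shift: "X (k * a + n) = X n" for k n
    using periodic_mult_add[of X a n k] dchars_add[OF X(1)] by (simp add: add.commute)
  have block: "(\<Sum>n<k * a + r. X n) = (\<Sum>n<r. X n)" for k r
  proof -
    have zero: "(\<Sum>n<k * a. X n) = 0" for k
    proof (induction k)
      case (Suc k)
      have "(\<Sum>n<Suc k * a. X n) = (\<Sum>n<k * a. X n) + (\<Sum>n<a. X (k * a + n))"
        using sum_lessThan_add[of X "k * a" a] by (simp add: add.commute)
      then show ?case using Suc sum_dchar[OF a X(1)] X(2) by (simp add: shift)
    qed simp
    show ?thesis by (simp add: sum_lessThan_add zero shift)
  qed
  have "norm (\<Sum>n<N. X n) = norm (\<Sum>n<N mod a. X n)"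
    using block[of "N div a" "N mod a"] by simp
  also have "\<dots> \<le> (\<Sum>n<N mod a. 1)"
    using norm_dchars_le[OF X(1) a] by (intro sum_norm_le) auto
  also have "\<dots> \<le> real a" using a by simp
  finally show ?thesis .
qed

text \<open>The mean of X over a period is 0, so the singularity at 1 is removable. The value there
  is identified with the conditionally convergent series by bounding the tails for real \<sigma> > 1
  through partial summation and letting \<sigma> tend to 1; the tail bound 2 a N^(-\<sigma>)
  survives the limit.\<close>

lemma dser_nonprincipal:
  assumes a: "a > 0" and X: "X \<in> dchars a" "X \<noteq> princ a"
  obtains H where "H holomorphic_on {s. Re s > 0}" "\<And>s. Re s > 1 \<Longrightarrow> H s = dser X s"
    "(\<lambda>n. X n / of_nat n) sums H 1"
proof -
  obtain G where G: "G holomorphic_on {s. Re s > 0}" "\<And>s. Re s > 1 \<Longrightarrow> G s = (s - 1) * dser X s"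
    "G 1 = (\<Sum>n<a. X n) / of_nat a"
    by (rule dser_continuation[of a X, OF a dchars_add[OF X(1)] norm_dchars_le[OF X(1) a]]) (rule that; assumption)
  define H where "H = (\<lambda>s. if s = 1 then deriv G 1 else (G s - G 1) / (s - 1))"
  have S: "open {s. Re s > 0}" by (rule open_halfspace_Re_gt)
  have H: "H holomorphic_on {s. Re s > 0}" unfolding H_def by (rule pole_lemma_open[OF G(1) S])
  have G1: "G 1 = 0" using G(3) sum_dchar[OF a X(1)] X(2) by simp
  have Heq: "H s = dser X s" if "Re s > 1" for s
    using G(2)[OF that] that G1 by (auto simp: H_def)
  have Xb: "norm (X n) \<le> 1 + ln (real n)" if "n > 0" for n
  proof -
    have "0 \<le> ln (real n)" using that by simp
    with norm_dchars_le[OF X(1) a, of n] show ?thesis by linarith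
  qed
  have tail: "norm (H (of_real \<sigma>) - (\<Sum>n<N. X n * of_nat n powr (- of_real \<sigma>))) \<le> 2 * real a * real N powr (-\<sigma>)"
    if \<sigma>: "\<sigma> > 1" and N: "N > 0" for \<sigma> N
  proof -
    let ?t = "\<lambda>n. X n * of_nat n powr (- of_real \<sigma>)"
    have t: "?t n = X n * of_real (real n powr (-\<sigma>))" for n
      using powr_of_real[of "real n" "-\<sigma>"] by simp
    have "?t sums H (of_real \<sigma>)"
      using dser_sums[OF Xb, of "of_real \<sigma>"] \<sigma> by (simp add: Heq)
    then have "(\<lambda>K. (\<Sum>n<K. ?t n) - (\<Sum>n<N. ?t n)) \<longlonglongrightarrow> H (of_real \<sigma>) - (\<Sum>n<N. ?t n)"
      unfolding sums_def by (intro tendsto_diff tendsto_const)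
    then have "(\<lambda>K. norm ((\<Sum>n<K. ?t n) - (\<Sum>n<N. ?t n))) \<longlonglongrightarrow> norm (H (of_real \<sigma>) - (\<Sum>n<N. ?t n))"
      by (rule tendsto_norm)
    then show ?thesis
    proof (rule tendsto_upperbound)
      show "\<forall>\<^sub>F K in sequentially. norm ((\<Sum>n<K. ?t n) - (\<Sum>n<N. ?t n)) \<le> 2 * real a * real N powr (-\<sigma>)"
        using eventually_ge_at_top[of N]
      proof eventually_elim
        case (elim K)
        have "(\<Sum>n<K. ?t n) - (\<Sum>n<N. ?t n) = (\<Sum>n=N..<K. ?t n)"
          using elim by (simp add: lessThan_atLeast0 sum_diff_nat_ivl)
        also have "norm \<dots> \<le> 2 * real a * real N powr (-\<sigma>)"
          unfolding t using elim N \<sigma>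
          by (intro abel_summation_bound dchar_partial_sum_bound a X powr_mono2') auto
        finally show ?case .
      qed
    qed simp
  qed
  have "norm ((\<Sum>n<N. X n / of_nat n) - H 1) \<le> 2 * real a / real N" if N: "N > 0" for N
  proof -
    have "isCont H 1"
      using holomorphic_on_imp_continuous_on[OF H] S by (simp add: continuous_on_eq_continuous_at)
    then have Hlim: "((\<lambda>\<sigma>. H (of_real \<sigma>)) \<longlongrightarrow> H 1) (at_right 1)"
      by (rule isCont_tendsto_compose) (use tendsto_of_real[OF tendsto_ident_at[of 1 "{1<..}"], where ?'a = complex] in simp)
    have "((\<lambda>\<sigma>. X n * of_nat n powr (- of_real \<sigma>)) \<longlongrightarrow> X n / of_nat n) (at_right 1)" for n
    proof (cases "n = 0")
      case False
      have "((\<lambda>\<sigma>. X n * of_real (real n powr (-\<sigma>))) \<longlongrightarrow> X n * of_real (real n powr (-1))) (at_right 1)"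
        using False by (intro tendsto_intros) auto
      moreover have "X n * of_nat n powr (- of_real \<sigma>) = X n * of_real (real n powr (-\<sigma>))" for \<sigma>
        using powr_of_real[of "real n" "-\<sigma>"] by simp
      ultimately have "((\<lambda>\<sigma>. X n * of_nat n powr (- of_real \<sigma>)) \<longlongrightarrow> X n * of_real (real n powr (-1))) (at_right 1)"
        by (simp only:)
      moreover have "X n * of_real (real n powr (-1)) = X n / of_nat n"
        by (simp add: powr_minus divide_inverse)
      ultimately show ?thesis by (simp only:)
    qed simp
    then have "((\<lambda>\<sigma>. norm (H (of_real \<sigma>) - (\<Sum>n<N. X n * of_nat n powr (- of_real \<sigma>)))) \<longlongrightarrow> norm (H 1 - (\<Sum>n<N. X n / of_nat n))) (at_right 1)"
      by (intro tendsto_norm tendsto_diff tendsto_sum Hlim)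
    moreover have "((\<lambda>\<sigma>. 2 * real a * real N powr (-\<sigma>)) \<longlongrightarrow> 2 * real a * real N powr (-1)) (at_right 1)"
      using N by (intro tendsto_intros) auto
    moreover have "\<forall>\<^sub>F \<sigma> in at_right 1. norm (H (of_real \<sigma>) - (\<Sum>n<N. X n * of_nat n powr (- of_real \<sigma>))) \<le> 2 * real a * real N powr (-\<sigma>)"
      using eventually_at_right_less[of "1::real"] by eventually_elim (rule tail[OF _ N])
    ultimately have "norm (H 1 - (\<Sum>n<N. X n / of_nat n)) \<le> 2 * real a * real N powr (-1)"
      by (intro tendsto_le[of "at_right (1::real)"]) auto
    then show ?thesis using N by (simp add: powr_minus field_simps norm_minus_commute)
  qed
  then have ev: "\<forall>\<^sub>F N in sequentially. norm ((\<Sum>n<N. X n / of_nat n) - H 1) \<le> 2 * real a / real N"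
    using eventually_gt_at_top[of 0] by (rule eventually_mono[rotated])
  have "(\<lambda>N. 2 * real a / real N) \<longlonglongrightarrow> 0" by (rule lim_const_over_n)
  with ev have "(\<lambda>N. (\<Sum>n<N. X n / of_nat n) - H 1) \<longlonglongrightarrow> 0"
    by (rule Lim_null_comparison)
  then have "(\<lambda>n. X n / of_nat n) sums H 1"
    unfolding sums_def by (simp add: LIM_zero_iff)
  with H Heq show ?thesis using that by blast
qed

section \<open>Real characters: divisor sums and the Lambert series\<close>

context
  fixes x :: "nat \<Rightarrow> real"
  assumes x_mult: "\<And>m n. x (m * n) = x m * x n" and x_1: "x 1 = 1"
    and x_range: "\<And>n. x n \<in> {-1, 0, 1}"
begin

text \<open>The divisors of p^(k+1) m not divisible by p are the divisors of m; the others are p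
  times the divisors of p^k m.\<close>

lemma divisor_sum_prime_power_mult:
  assumes p: "prime p" and m: "\<not> p dvd m" "m > 0"
  shows "(\<Sum>d | d dvd p ^ k * m. x d) = (\<Sum>i\<le>k. x p ^ i) * (\<Sum>d | d dvd m. x d)"
proof (induction k)
  case (Suc k)
  have p0: "p > 0" using p by (rule prime_gt_0_nat)
  have split: "{d. d dvd p ^ Suc k * m} = {d. d dvd m} \<union> (\<lambda>e. p * e) ` {e. e dvd p ^ k * m}"
  proof (intro equalityI subsetI)
    fix d assume d: "d \<in> {d. d dvd p ^ Suc k * m}"
    show "d \<in> {d. d dvd m} \<union> (\<lambda>e. p * e) ` {e. e dvd p ^ k * m}"
    proof (cases "p dvd d")
      case True
      then obtain e where "d = p * e" by (elim dvdE)
      with d p0 show ?thesis by (auto simp: mult.assoc)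
    next
      case False
      then have "coprime p d" using p by (intro prime_imp_coprime)
      then have "coprime d (p ^ Suc k)"
        by (simp add: coprime_commute)
      with d show ?thesis by (simp add: coprime_dvd_mult_right_iff)
    qed
  qed (auto simp: mult.assoc)
  have disj: "{d. d dvd m} \<inter> (\<lambda>e. p * e) ` {e. e dvd p ^ k * m} = {}"
    using m by (auto dest: dvd_mult_left)
  have "(\<Sum>d | d dvd p ^ Suc k * m. x d) = (\<Sum>d | d dvd m. x d) + (\<Sum>d\<in>(\<lambda>e. p * e) ` {e. e dvd p ^ k * m}. x d)"
    unfolding split using m p0 disj by (intro sum.union_disjoint) auto
  also have "(\<Sum>d\<in>(\<lambda>e. p * e) ` {e. e dvd p ^ k * m}. x d) = (\<Sum>e | e dvd p ^ k * m. x p * x e)"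
    using p0 by (subst sum.reindex) (auto simp: inj_on_def x_mult)
  also have "\<dots> = x p * (\<Sum>e | e dvd p ^ k * m. x e)" by (rule sum_distrib_left[symmetric])
  also have "\<dots> = x p * (\<Sum>i\<le>k. x p ^ i) * (\<Sum>d | d dvd m. x d)" using Suc by simp
  also have "x p * (\<Sum>i\<le>k. x p ^ i) = (\<Sum>i\<le>Suc k. x p ^ i) - 1"
    by (simp add: sum.atMost_Suc_shift sum_distrib_left del: sum.atMost_Suc)
  finally show ?case by (simp add: algebra_simps del: sum.atMost_Suc)
qed simp

lemma geometric_sum_sign:
  fixes y :: real
  assumes "y \<in> {-1, 0, 1}"
  shows "(\<Sum>i\<le>k. y ^ i) \<ge> 0" "even k \<Longrightarrow> (\<Sum>i\<le>k. y ^ i) \<ge> 1"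
proof -
  have neg: "(\<Sum>i\<le>k. (-1::real) ^ i) = (if even k then 1 else 0)"
    by (induction k) auto
  have zero: "(\<Sum>i\<le>k. (0::real) ^ i) = 1"
    by (induction k) auto
  show "(\<Sum>i\<le>k. y ^ i) \<ge> 0" "even k \<Longrightarrow> (\<Sum>i\<le>k. y ^ i) \<ge> 1"
    using assms neg zero by auto
qed

text \<open>Splitting off the full power of one prime multiplies the divisor sum by a geometric sum
  in x p, which is nonnegative, and at least 1 for an even exponent. For a square the exponent is
  even and the cofactor is again a square.\<close>

lemma divisor_sum_nonneg_square:
  "n > 0 \<Longrightarrow> (\<Sum>d | d dvd n. x d) \<ge> 0 \<and> (\<forall>k. n = k\<^sup>2 \<longrightarrow> (\<Sum>d | d dvd n. x d) \<ge> 1)"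
proof (induction n rule: less_induct)
  case (less n)
  show ?case
  proof (cases "n = 1")
    case True
    then have "{d. d dvd n} = {1}" by auto
    then have eq: "(\<Sum>d | d dvd n. x d) = 1" using x_1 by simp
    show ?thesis unfolding eq by simp
  next
    case False
    then obtain p where p: "prime p" "p dvd n" using prime_factor_nat by blast
    define k where "k = multiplicity p n"
    have p1: "\<not> is_unit p" using p(1) not_prime_unit by blast
    obtain m where m: "n = p ^ k * m" "\<not> p dvd m"
      using multiplicity_decompose'[of n p] less.prems p1 unfolding k_def by (metis neq0_conv)
    have m0: "m > 0" using m less.prems by (cases m) auto
    have k0: "k > 0" using p less.prems p1 by (simp add: k_def multiplicity_gt_zero_iff)
    have "p ^ k > 1" using one_less_power[OF prime_gt_1_nat[OF p(1)] k0] .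
    then have "m < n" using m m0 by simp
    then have IH: "(\<Sum>d | d dvd m. x d) \<ge> 0" "\<And>j. m = j\<^sup>2 \<Longrightarrow> (\<Sum>d | d dvd m. x d) \<ge> 1"
      using less.IH m0 by blast+
    have eq: "(\<Sum>d | d dvd n. x d) = (\<Sum>i\<le>k. x p ^ i) * (\<Sum>d | d dvd m. x d)"
      unfolding m(1) by (rule divisor_sum_prime_power_mult[OF p(1) m(2) m0])
    have "(\<Sum>d | d dvd n. x d) \<ge> 1" if j: "n = j\<^sup>2" for j
    proof -
      have j0: "j \<noteq> 0" using j less.prems by auto
      have k2: "k = 2 * multiplicity p j"
        unfolding k_def j using p(1) j0 by (simp add: prime_elem_multiplicity_power_distrib)
      then have "even k" by simp
      obtain i where i: "j = p ^ multiplicity p j * i" "\<not> p dvd i"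
        using multiplicity_decompose'[of j p] j0 p1 by metis
      have "p ^ k * m = p ^ k * i\<^sup>2"
      proof -
        have "p ^ k * m = (p ^ multiplicity p j * i)\<^sup>2" using m(1) j i(1) by metis
        then show ?thesis by (simp only: k2 power_mult_distrib power_mult mult.commute[of 2])
      qed
      then have "m = i\<^sup>2" using prime_gt_0_nat[OF p(1)] by simp
      then have "(\<Sum>d | d dvd m. x d) \<ge> 1" by (rule IH(2))
      moreover have "(\<Sum>i\<le>k. x p ^ i) \<ge> 1" using geometric_sum_sign(2)[OF x_range \<open>even k\<close>] .
      ultimately show ?thesis unfolding eq using mult_mono[of 1 "\<Sum>i\<le>k. x p ^ i" 1 "\<Sum>d | d dvd m. x d"] by simp
    qed
    moreover have "(\<Sum>d | d dvd n. x d) \<ge> 0"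
      unfolding eq using IH(1) geometric_sum_sign(1)[OF x_range] by simp
    ultimately show ?thesis by blast
  qed
qed

text \<open>Expanded as a power series in \<open>t\<close>, the Lambert series of \<open>x\<close> has the divisor sums of \<open>x\<close> as
  coefficients; they are nonnegative, and at least 1 at the squares.\<close>

lemma lambert_series_lower_bound:
  fixes t :: real
  assumes t: "0 < t" "t < 1"
  obtains f where "(\<lambda>n. x n * (t ^ n / (1 - t ^ n))) sums f" "\<And>K. (\<Sum>k=1..K. t ^ (k\<^sup>2)) \<le> f"
proof -
  let ?P = "{0<..} :: nat set"
  have tn: "t ^ n < 1" if "n > 0" for n using that t by (simp add: power_less_one_iff)
  have x1: "\<bar>x n\<bar> \<le> 1" for n using x_range[of n] by auto
  have geo: "((\<lambda>m. t ^ (d * m)) has_sum t ^ d / (1 - t ^ d)) ?P" if d: "d > 0" for d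
  proof -
    have "(\<lambda>m. (t ^ d) ^ m) sums (1 / (1 - t ^ d))"
      using tn[OF d] t by (intro geometric_sums) simp
    then have "(\<lambda>m. (t ^ d) ^ Suc m) sums (1 / (1 - t ^ d) - 1)"
      by (subst sums_Suc_iff) simp
    then have "(\<lambda>m. t ^ (d * Suc m)) sums (t ^ d / (1 - t ^ d))"
    proof -
      have "1 / (1 - t ^ d) - 1 = t ^ d / (1 - t ^ d)" using tn[OF d] by (simp add: field_simps)
      with \<open>(\<lambda>m. (t ^ d) ^ Suc m) sums _\<close> show ?thesis by (simp only: power_mult)
    qed
    then have "((\<lambda>m. t ^ (d * Suc m)) has_sum t ^ d / (1 - t ^ d)) UNIV"
      using t by (intro sums_nonneg_imp_has_sum) auto
    then show ?thesis
      by (subst (asm) has_sum_reindex_bij_witness[where j = Suc and i = "\<lambda>n. n - 1" and T = ?P and h = "\<lambda>m. t ^ (d * m)"]) auto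
  qed
  have outer_le: "t ^ d / (1 - t ^ d) \<le> t ^ d / (1 - t)" if "d > 0" for d
  proof -
    have "t ^ d \<le> t ^ 1" using that t by (intro power_decreasing) auto
    then show ?thesis using t tn[OF that] by (intro divide_left_mono mult_pos_pos) auto
  qed
  have gsum: "summable (\<lambda>d. t ^ d / (1 - t))" using t by (intro summable_divide summable_geometric) simp
  have lam_abs: "summable (\<lambda>n. norm (x n * (t ^ n / (1 - t ^ n))))"
  proof (rule summable_comparison_test[OF _ gsum], intro exI allI impI)
    fix n :: nat
    show "norm (norm (x n * (t ^ n / (1 - t ^ n)))) \<le> t ^ n / (1 - t)"
    proof (cases "n = 0")
      case False
      then have "0 \<le> t ^ n / (1 - t ^ n)" using tn[of n] t by simp
      then have "\<bar>t ^ n / (1 - t ^ n)\<bar> = t ^ n / (1 - t ^ n)" by (rule abs_of_nonneg)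
      then have "\<bar>x n\<bar> * \<bar>t ^ n / (1 - t ^ n)\<bar> \<le> 1 * (t ^ n / (1 - t))"
        using outer_le[of n] x1[of n] False \<open>0 \<le> t ^ n / (1 - t ^ n)\<close>
        by (simp only:) (intro mult_mono; simp)
      then show ?thesis by (simp only: real_norm_def abs_mult abs_idempotent)
    qed (use t in simp)
  qed
  define f where "f = (\<Sum>n. x n * (t ^ n / (1 - t ^ n)))"
  have fs: "(\<lambda>n. x n * (t ^ n / (1 - t ^ n))) sums f"
    unfolding f_def by (rule summable_sums[OF summable_norm_cancel[OF lam_abs]])
  have "((\<lambda>n. x n * (t ^ n / (1 - t ^ n))) has_sum f) UNIV"
    using lam_abs fs by (rule norm_summable_imp_has_sum)
  \<comment> \<open>The term n = 0 is 0, because t^0 / (1 - t^0) divides by zero.\<close>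
  then have fP: "((\<lambda>n. x n * (t ^ n / (1 - t ^ n))) has_sum f) ?P"
    by (subst has_sum_cong_neutral[where T = UNIV and g = "\<lambda>n. x n * (t ^ n / (1 - t ^ n))"]) auto
  let ?F = "\<lambda>(d, m). x d * t ^ (d * m)"
  have "(\<lambda>z. norm (?F z)) summable_on ?P \<times> ?P"
  proof (intro Infinite_Sum.abs_summable_on_Sigma_iff[THEN iffD2] conjI ballI)
    fix d assume d: "d \<in> ?P"
    show "(\<lambda>m. norm (?F (d, m))) summable_on ?P"
      using has_sum_cmult_right[OF geo[of d], of "\<bar>x d\<bar>"] d t by (auto simp: summable_on_def abs_mult)
  next
    have inf: "(\<Sum>\<^sub>\<infinity>m\<in>?P. norm (?F (d, m))) = \<bar>x d\<bar> * (t ^ d / (1 - t ^ d))" if "d \<in> ?P" for d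
      using infsumI[OF has_sum_cmult_right[OF geo[of d], of "\<bar>x d\<bar>"]] that t by (simp add: abs_mult)
    have "(\<lambda>n. norm (x n * (t ^ n / (1 - t ^ n)))) summable_on ?P"
      using summable_on_subset_banach[OF norm_summable_imp_summable_on[of "\<lambda>n. norm (x n * (t ^ n / (1 - t ^ n)))"]] lam_abs
      by simp
    moreover have "norm (x d * (t ^ d / (1 - t ^ d))) = norm (\<Sum>\<^sub>\<infinity>m\<in>?P. norm (?F (d, m)))" if "d \<in> ?P" for d
      using inf[OF that] that t tn[of d] by (simp add: abs_mult)
    ultimately show "(\<lambda>d. norm (\<Sum>\<^sub>\<infinity>m\<in>?P. norm (?F (d, m)))) summable_on ?P"
      by (subst summable_on_cong[symmetric]) auto
  qed
  then have summ: "?F summable_on ?P \<times> ?P" by (rule Infinite_Sum.abs_summable_summable)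
  have "(?F has_sum f) (?P \<times> ?P)"
  proof (rule has_sum_SigmaI[OF _ fP summ])
    fix d assume "d \<in> ?P"
    then show "((\<lambda>m. ?F (d, m)) has_sum x d * (t ^ d / (1 - t ^ d))) ?P"
      using has_sum_cmult_right[OF geo[of d], of "x d"] by simp
  qed
  \<comment> \<open>\<open>has_sum_dirichlet_regroup\<close> is about complex families, hence the
    detour through \<open>of_real\<close> and \<open>Re\<close>.\<close>
  then have "((\<lambda>z. complex_of_real (?F z)) has_sum of_real f) (?P \<times> ?P)" by (rule has_sum_of_real)
  from has_sum_dirichlet_regroup[OF this]
  have "((\<lambda>n. Re (\<Sum>d | d dvd n. complex_of_real (?F (d, n div d)))) has_sum Re (of_real f)) ?P"
    by (rule has_sum_Re)
  then have "((\<lambda>n. \<Sum>d | d dvd n. x d * t ^ (d * (n div d))) has_sum f) ?P" by simp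
  moreover have "(\<Sum>d | d dvd n. x d * t ^ (d * (n div d))) = (\<Sum>d | d dvd n. x d) * t ^ n" for n
    unfolding sum_distrib_right by (intro sum.cong) auto
  ultimately have main: "((\<lambda>n. (\<Sum>d | d dvd n. x d) * t ^ n) has_sum f) ?P" by simp
  have "(\<Sum>k=1..K. t ^ (k\<^sup>2)) \<le> f" for K
  proof -
    have "(\<Sum>k=1..K. t ^ (k\<^sup>2)) = (\<Sum>n\<in>(\<lambda>k. k\<^sup>2) ` {1..K}. t ^ n)"
      by (subst sum.reindex) (auto simp: inj_on_def)
    also have "\<dots> \<le> (\<Sum>n\<in>(\<lambda>k. k\<^sup>2) ` {1..K}. (\<Sum>d | d dvd n. x d) * t ^ n)"
    proof (rule sum_mono)
      fix n assume "n \<in> (\<lambda>k. k\<^sup>2) ` {1..K}"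
      then have "(\<Sum>d | d dvd n. x d) \<ge> 1" using divisor_sum_nonneg_square[of n] by auto
      then show "t ^ n \<le> (\<Sum>d | d dvd n. x d) * t ^ n" using t by simp
    qed
    also have "\<dots> \<le> f"
    proof (rule has_sum_mono_neutral[OF has_sum_finite main])
      show "finite ((\<lambda>k. k\<^sup>2) ` {1..K})" by simp
    qed (use t divisor_sum_nonneg_square in \<open>auto intro!: mult_nonneg_nonneg\<close>)
    finally show ?thesis .
  qed
  with fs show ?thesis using that by blast
qed

text \<open>The terms j and n - 1 - j have geometric mean u^(n-1), so each such pair contributes at
  least twice that. The induction in steps of two removes the outermost pair.\<close>

lemma geometric_sum_ge_sqrt:
  fixes u :: real
  assumes "u \<ge> 0"
  shows "real n * u ^ (n - 1) \<le> (\<Sum>j<n. u ^ (2 * j))"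
proof (induction n rule: induct_nat_012)
  case (ge2 n)
  have "2 * v \<le> 1 + v\<^sup>2" for v :: real using zero_le_power2[of "1 - v"] by (simp add: power2_diff)
  then have "2 * u ^ Suc n \<le> 1 + u ^ (2 * Suc n)" unfolding power_even_eq .
  moreover have "real n * u ^ Suc n \<le> u\<^sup>2 * (\<Sum>j<n. u ^ (2 * j))"
  proof (cases n)
    case (Suc k)
    have "u\<^sup>2 * (real n * u ^ (n - 1)) \<le> u\<^sup>2 * (\<Sum>j<n. u ^ (2 * j))"
      using ge2(1) by (intro mult_left_mono) auto
    then show ?thesis using Suc by (simp add: power2_eq_square mult_ac)
  qed simp
  moreover have "(\<Sum>j<Suc (Suc n). u ^ (2 * j)) = 1 + u\<^sup>2 * (\<Sum>j<n. u ^ (2 * j)) + u ^ (2 * Suc n)"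
  proof -
    have "(\<Sum>j<Suc n. u ^ (2 * j)) = u ^ (2 * 0) + (\<Sum>j<n. u ^ (2 * Suc j))" by (rule sum.lessThan_Suc_shift)
    also have "(\<Sum>j<n. u ^ (2 * Suc j)) = u\<^sup>2 * (\<Sum>j<n. u ^ (2 * j))"
      by (simp add: sum_distrib_left power2_eq_square mult_ac)
    finally show ?thesis by simp
  qed
  ultimately show ?case by (simp add: algebra_simps)
qed auto

text \<open>Monsky's argument: if \<open>\<Sum>x(n)/n\<close> vanished, the Lambert series would stay bounded
  as \<open>t \<longlongrightarrow> 1\<close>, being the sum of \<open>x(n)\<close> against the decreasing weights \<open>b n\<close>.\<close>

lemma real_character_sum_nonzero:
  assumes M: "\<And>N. \<bar>\<Sum>n<N. x n\<bar> \<le> M"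
  shows "\<not> (\<lambda>n. x n / real n) sums 0"
proof
  assume zero: "(\<lambda>n. x n / real n) sums 0"
  have bound: "(\<Sum>k=1..K. t ^ (k\<^sup>2)) \<le> 2 * M" if t: "0 < t" "t < 1" for t K
  proof -
    obtain f where f: "(\<lambda>n. x n * (t ^ n / (1 - t ^ n))) sums f" "\<And>K. (\<Sum>k=1..K. t ^ (k\<^sup>2)) \<le> f"
      using lambert_series_lower_bound[OF t] by blast
    \<comment> \<open>Near t = 1 the weight t^n / (1 - t^n) behaves like 1 / (n (1 - t)).
      Subtracting it from that main part costs nothing, since the sum of x n / n is assumed to
      vanish, and leaves bounded weights.\<close>
    define b where "b = (\<lambda>n. 1 / (real n * (1 - t)) - t ^ n / (1 - t ^ n))"
    define S where "S = (\<lambda>n. \<Sum>j<n. t ^ j)"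
    have S: "1 - t ^ n = (1 - t) * S n" for n by (simp add: S_def one_diff_power_eq)
    have Spos: "S n > 0" if "n > 0" for n
      unfolding S_def using t that by (intro sum_pos) auto
    have bS: "b n = (1 / real n - t ^ n / S n) / (1 - t)" for n
      by (simp add: b_def S diff_divide_distrib mult.commute)
    have S1: "S (Suc n) = 1 + t * S n" for n
      unfolding S_def by (subst sum.lessThan_Suc_shift) (simp add: sum_distrib_left)
    \<comment> \<open>With denominators cleared, this says that b decreases. The bounds for S n and
      S (n + 1) by the geometric means of their terms multiply to u^(2n-1), which is at least u^(2n)
      = t^n.\<close>
    have prod: "real n * real (Suc n) * t ^ n \<le> S n * S (Suc n)" if n: "n > 0" for n
    proof -
      define u where "u = sqrt t"
      have u: "u \<ge> 0" "u \<le> 1" "t = u\<^sup>2" using t by (auto simp: u_def)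
      have Su: "real n * u ^ (n - 1) \<le> S n" for n
        using geometric_sum_ge_sqrt[OF u(1), of n] by (simp add: S_def u(3) power_mult[symmetric])
      have "real n * real (Suc n) * t ^ n = real n * real (Suc n) * u ^ (2 * n)" by (simp add: u(3) power_mult[symmetric])
      also have "\<dots> \<le> real n * real (Suc n) * u ^ ((n - 1) + (Suc n - 1))"
        using u n by (intro mult_left_mono power_decreasing) auto
      also have "\<dots> = (real n * u ^ (n - 1)) * (real (Suc n) * u ^ (Suc n - 1))" by (simp only: power_add) (simp add: mult_ac)
      also have "\<dots> \<le> S n * S (Suc n)"
        using u Spos[OF n] by (intro mult_mono Su) auto
      finally show ?thesis .
    qed
    have dec: "b (Suc n) \<le> b n" if n: "n \<ge> 1" for n
    proof -
      have pos: "S n > 0" "S (Suc n) > 0" using Spos n by auto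
      have "t ^ n / S n - t ^ Suc n / S (Suc n) = t ^ n * (S (Suc n) - t * S n) / (S n * S (Suc n))"
        using pos by (simp add: field_simps)
      also have "\<dots> = t ^ n / (S n * S (Suc n))" by (simp add: S1)
      also have "\<dots> \<le> 1 / (real n * real (Suc n))"
        using prod[of n] n pos by (simp add: divide_simps mult_ac)
      also have "\<dots> = 1 / real n - 1 / real (Suc n)" using n by (simp add: field_simps)
      finally show ?thesis unfolding bS using t by (intro divide_right_mono) auto
    qed
    have nonneg: "0 \<le> b n" if n: "n \<ge> 1" for n
    proof -
      have "real n * t ^ n = (\<Sum>j<n. t ^ n)" by simp
      also have "\<dots> \<le> S n" unfolding S_def using t by (intro sum_mono power_decreasing) auto
      finally show ?thesis unfolding bS using t n Spos[of n] by (simp add: field_simps)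
    qed
    have b1: "b 1 = 1" unfolding bS using t by (simp add: S_def)
    have part: "\<bar>\<Sum>n<K. x n * b n\<bar> \<le> 2 * M" if K: "K \<ge> 1" for K
    proof -
      have "norm (\<Sum>n<N. complex_of_real (x n)) \<le> M" for N
        using M[of N] by (metis norm_of_real of_real_sum)
      then have "norm (\<Sum>n=1..<K. complex_of_real (x n) * of_real (b n)) \<le> 2 * M * b 1"
        by (rule abel_summation_bound) (use dec nonneg K in auto)
      then have "\<bar>\<Sum>n=1..<K. x n * b n\<bar> \<le> 2 * M"
        unfolding of_real_mult[symmetric] of_real_sum[symmetric] norm_of_real b1 by simp
      \<comment> \<open>Both fractions in \<open>b 0\<close> divide by zero, so
        \<open>b 0 = 0\<close>.\<close>
      moreover have "(\<Sum>n<K. x n * b n) = (\<Sum>n=1..<K. x n * b n)"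
        by (rule sum.mono_neutral_right) (auto simp: b_def Suc_le_eq)
      ultimately show ?thesis by simp
    qed
    have "(\<lambda>n. x n / real n * (1 / (1 - t)) - x n * (t ^ n / (1 - t ^ n))) sums (0 * (1 / (1 - t)) - f)"
      by (intro sums_diff sums_mult2 zero f(1))
    then have "(\<lambda>n. x n * b n) sums (- f)" by (simp add: b_def right_diff_distrib)
    then have "(\<lambda>K. \<bar>\<Sum>n<K. x n * b n\<bar>) \<longlonglongrightarrow> \<bar>- f\<bar>" unfolding sums_def by (rule tendsto_rabs)
    then have "\<bar>- f\<bar> \<le> 2 * M"
      by (rule tendsto_upperbound) (auto intro!: eventually_mono[OF eventually_ge_at_top[of 1]] part)
    then show ?thesis using f(2)[of K] by simp
  qed
  \<comment> \<open>As t tends to 1 from the left, each of the K squares contributes 1, while the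
    bound 2 M does not depend on t or K.\<close>
  have "real K \<le> 2 * M" for K
  proof -
    have "((\<lambda>t. \<Sum>k=1..K. t ^ (k\<^sup>2)) \<longlongrightarrow> (\<Sum>k=1..K. 1 ^ (k\<^sup>2) :: real)) (at_left 1)"
      by (intro tendsto_intros)
    moreover have "\<forall>\<^sub>F t in at_left (1::real). (\<Sum>k=1..K. t ^ (k\<^sup>2)) \<le> 2 * M"
    proof -
      have "\<forall>\<^sub>F t in at_left (1::real). t \<in> {0<..<1}" by (rule eventually_at_left_real) simp
      then show ?thesis by eventually_elim (use bound in auto)
    qed
    ultimately have "(\<Sum>k=1..K. 1 ^ (k\<^sup>2) :: real) \<le> 2 * M"
      by (rule tendsto_upperbound) simp
    then show ?thesis by simp
  qed
  then show False using reals_Archimedean2[of "2 * M"] by (meson not_le)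
qed

end

section \<open>Non-vanishing on the line of real part 1\<close>

definition von_mangoldt_series :: "(nat \<Rightarrow> complex) \<Rightarrow> complex \<Rightarrow> complex" where
  "von_mangoldt_series X s = dser (\<lambda>n. mangoldt n * X n) s"

lemma norm_mangoldt: "norm (mangoldt n :: complex) = mangoldt n"
  using mangoldt_nonneg[of n] of_real_mangoldt[of n, where ?'a = complex, symmetric] by (simp del: of_real_mangoldt)

lemma bounded_coeff:
  assumes "norm (X n) \<le> (1::real)" "n > 0"
  shows "norm (X n) \<le> 1 + ln (real n)" "norm (mangoldt n * X n :: complex) \<le> 1 + ln (real n)"
proof -
  have l: "0 \<le> ln (real n)" using assms(2) by simp
  with assms show "norm (X n) \<le> 1 + ln (real n)" by linarith
  have "norm (mangoldt n * X n :: complex) \<le> (mangoldt n :: real) * 1"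
    unfolding norm_mult norm_mangoldt using assms mangoldt_nonneg[of n] by (intro mult_left_mono) auto
  then show "norm (mangoldt n * X n :: complex) \<le> 1 + ln (real n)" using mangoldt_le_ln[OF assms(2)] by simp
qed

context
  fixes a :: nat
  assumes a: "a > 0"
begin

lemma dchar_coeff:
  assumes "X \<in> dchars a" "n > 0"
  shows "norm (X n) \<le> 1 + ln (real n)" "norm (mangoldt n * X n) \<le> 1 + ln (real n)"
  using bounded_coeff[of X n] norm_dchars_le[OF assms(1) a] assms(2) by auto

lemma dser_dchar_derivative:
  assumes X: "X \<in> dchars a" and s: "Re s > 1"
  shows "(dser X has_field_derivative - (dser X s * von_mangoldt_series X s)) (at s)"
proof -
  have b: "norm (X n * of_real (ln (real n))) \<le> 1 + ln (real n)" if "n > 0" for n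
  proof -
    have "0 \<le> ln (real n)" using that by simp
    then have "norm (X n) * \<bar>ln (real n)\<bar> \<le> 1 * ln (real n)"
      using norm_dchars_le[OF X a, of n] by (intro mult_mono) auto
    then show ?thesis by (simp add: norm_mult)
  qed
  have "dser (\<lambda>n. - X n * of_real (ln (real n))) s = - dser (\<lambda>n. X n * of_real (ln (real n))) s"
    using suminf_minus[OF dser_summable[OF b s]] by (simp add: dser_def)
  then show ?thesis
    using dser_derivative[OF dchar_coeff(1)[OF X] s] dser_log_mult[of X, OF dchars_mult[OF X] norm_dchars_le[OF X a] s]
    by (simp add: von_mangoldt_series_def)
qed

lemma von_mangoldt_series_holomorphic:
  "X \<in> dchars a \<Longrightarrow> von_mangoldt_series X holomorphic_on {s. Re s > 1}"
  unfolding von_mangoldt_series_def[abs_def] by (rule dser_holomorphic[OF dchar_coeff(2)])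

text \<open>One point without a zero is what the constancy argument on Re s > 1 starts from. At 3
  the terms from n = 2 on sum to at most 1/2, by comparison of 1 / (n + 2)^3 with half of 1 / (n +
  1) - 1 / (n + 2).\<close>

lemma dser_dchar_3_nonzero:
  assumes X: "X \<in> dchars a"
  shows "dser X 3 \<noteq> 0"
proof -
  let ?t = "\<lambda>n. X n * of_nat n powr (-3)"
  have "?t sums dser X 3" using dser_sums[OF dchar_coeff(1)[OF X], of 3] by simp
  then have "(\<lambda>N. norm ((\<Sum>n<N. ?t n) - 1)) \<longlonglongrightarrow> norm (dser X 3 - 1)"
    unfolding sums_def by (intro tendsto_norm tendsto_diff tendsto_const)
  then have "(\<lambda>N. norm ((\<Sum>n<N + 2. ?t n) - 1)) \<longlonglongrightarrow> norm (dser X 3 - 1)"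
    by (rule LIMSEQ_ignore_initial_segment)
  then have "norm (dser X 3 - 1) \<le> 1 / 2"
  proof (rule tendsto_upperbound)
    have "norm ((\<Sum>n<N + 2. ?t n) - 1) \<le> 1 / 2" for N
    proof -
      have "(\<Sum>n<N + 2. ?t n) - 1 = (\<Sum>n<N. ?t (2 + n))"
        using sum_lessThan_add[of ?t 2 N] dchars_1[OF X] by (simp add: add.commute numeral_2_eq_2)
      also have "norm \<dots> \<le> (\<Sum>n<N. (1 / real (n + 1) - 1 / real (n + 2)) / 2)"
      proof (rule sum_norm_le)
        fix n
        have "norm (?t (2 + n)) \<le> 1 * real (2 + n) powr (-3)"
          unfolding norm_mult norm_nat_powr using norm_dchars_le[OF X a] by (intro mult_mono) auto
        also have "\<dots> = 1 / real (2 + n) ^ 3" by (simp add: powr_minus powr_numeral field_simps)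
        also have "\<dots> \<le> 1 / (2 * (real (n + 1) * real (n + 2)))"
        proof -
          have "2 * real (n + 1) * real (n + 2) \<le> real (2 + n) * real (2 + n) * real (2 + n)"
            using mult_right_mono[of "2 * real (n + 1)" "real (2 + n) * real (2 + n)" "real (2 + n)"]
            by (simp add: algebra_simps)
          then show ?thesis by (intro divide_left_mono) (auto simp: power3_eq_cube mult_ac)
        qed
        also have "\<dots> = (1 / real (n + 1) - 1 / real (n + 2)) / 2" by (simp add: field_simps)
        finally show "norm (?t (2 + n)) \<le> (1 / real (n + 1) - 1 / real (n + 2)) / 2" .
      qed
      also have "\<dots> = (1 - 1 / real (N + 1)) / 2"
        using sum_lessThan_telescope'[of "\<lambda>n. 1 / real (n + 1)" N]
        unfolding sum_divide_distrib[symmetric] by (simp add: add.commute)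
      also have "\<dots> \<le> 1 / 2" by simp
      finally show ?thesis .
    qed
    then show "\<forall>\<^sub>F N in sequentially. norm ((\<Sum>n<N + 2. ?t n) - 1) \<le> 1 / 2" by (intro always_eventually allI)
  qed simp
  then show ?thesis by auto
qed

text \<open>\<open>L' = -L \<Phi>\<close> makes \<open>L * exp (\<integral>\<Phi>)\<close> constant on \<open>Re s > 1\<close>, so \<open>L\<close> has no zero there.\<close>

lemma dser_dchar_nonzero:
  assumes X: "X \<in> dchars a" and s: "Re s > 1"
  shows "dser X s \<noteq> 0"
proof
  assume zero: "dser X s = 0"
  let ?S = "{s. Re s > 1}"
  have S: "convex ?S" "open ?S" by (auto intro: convex_halfspace_Re_gt open_halfspace_Re_gt)
  have hol: "von_mangoldt_series X holomorphic_on ?S" by (rule von_mangoldt_series_holomorphic[OF X])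
  have "\<exists>F. \<forall>x\<in>?S. (F has_field_derivative von_mangoldt_series X x) (at x within ?S)"
  proof (rule holomorphic_convex_primitive[OF S(1) finite.emptyI holomorphic_on_imp_continuous_on[OF hol]])
    fix x assume "x \<in> interior ?S - {}"
    then show "von_mangoldt_series X field_differentiable at x"
      using holomorphic_on_imp_differentiable_at[OF hol S(2)] interior_open[OF S(2)] by simp
  next
    fix g assume "\<And>x. x \<in> ?S \<Longrightarrow> (g has_field_derivative von_mangoldt_series X x) (at x within ?S)"
    then show "\<exists>F. \<forall>x\<in>?S. (F has_field_derivative von_mangoldt_series X x) (at x within ?S)"
      by (intro exI[of _ g] ballI)
  qed
  then obtain F where F: "\<And>x. x \<in> ?S \<Longrightarrow> (F has_field_derivative von_mangoldt_series X x) (at x within ?S)"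
    by auto
  have F': "(F has_field_derivative von_mangoldt_series X x) (at x)" if "x \<in> ?S" for x
    using F[OF that] at_within_open[OF that S(2)] by simp
  have "((\<lambda>x. dser X x * exp (F x)) has_field_derivative 0) (at x within ?S)" if "x \<in> ?S" for x
  proof -
    have "Re x > 1" using that by simp
    then have "((\<lambda>x. dser X x * exp (F x)) has_field_derivative
       - (dser X x * von_mangoldt_series X x) * exp (F x) + exp (F x) * von_mangoldt_series X x * dser X x) (at x)"
      by (intro DERIV_mult dser_dchar_derivative[OF X] DERIV_fun_exp F'[OF that])
    then have "((\<lambda>x. dser X x * exp (F x)) has_field_derivative 0) (at x)" by (simp add: mult_ac)
    then show ?thesis by (rule has_field_derivative_at_within)
  qed
  then obtain c where c: "\<And>x. x \<in> ?S \<Longrightarrow> dser X x * exp (F x) = c"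
  proof -
    have "\<exists>c. \<forall>x\<in>?S. dser X x * exp (F x) = c"
      by (rule has_field_derivative_zero_constant[OF S(1)]) fact
    then show ?thesis using that by auto
  qed
  have "c = 0" using c[of s] s zero by simp
  then have "dser X 3 = 0" using c[of 3] by simp
  with dser_dchar_3_nonzero[OF X] show False ..
qed

end

text \<open>The limit n is the order of the zero of H at s0: with H = (w - s0)^n g and g nonzero
  near s0, the logarithmic derivative at s0 + \<epsilon> is n / \<epsilon> plus a bounded term. The
  point s1 keeps H from vanishing identically.\<close>

lemma logderiv_limit_at_zero:
  fixes H :: "complex \<Rightarrow> complex"
  assumes H: "H holomorphic_on S" and S: "open S" "connected S" "s0 \<in> S" and s1: "s1 \<in> S" "H s1 \<noteq> 0"
  shows "\<exists>n::nat. ((\<lambda>\<epsilon>::real. of_real \<epsilon> * (deriv H (s0 + of_real \<epsilon>) / H (s0 + of_real \<epsilon>))) \<longlongrightarrow> of_nat n) (at_right 0)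
           \<and> (n = 0 \<longleftrightarrow> H s0 \<noteq> 0)"
proof (cases "H s0 = 0")
  case False
  have "isCont H s0" "isCont (deriv H) s0"
    using holomorphic_on_imp_continuous_on[OF H] holomorphic_on_imp_continuous_on[OF holomorphic_deriv[OF H S(1)]] S
    by (auto simp: continuous_on_eq_continuous_at)
  moreover have "((\<lambda>\<epsilon>. s0 + complex_of_real \<epsilon>) \<longlongrightarrow> s0 + of_real 0) (at_right 0)"
    by (intro tendsto_intros)
  then have "((\<lambda>\<epsilon>. s0 + complex_of_real \<epsilon>) \<longlongrightarrow> s0) (at_right 0)" by simp
  ultimately have lims: "((\<lambda>\<epsilon>. H (s0 + complex_of_real \<epsilon>)) \<longlongrightarrow> H s0) (at_right 0)"
      "((\<lambda>\<epsilon>. deriv H (s0 + complex_of_real \<epsilon>)) \<longlongrightarrow> deriv H s0) (at_right 0)"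
    by - (rule isCont_tendsto_compose, assumption+)+
  have "((\<lambda>\<epsilon>. of_real \<epsilon> * (deriv H (s0 + of_real \<epsilon>) / H (s0 + of_real \<epsilon>))) \<longlongrightarrow> of_real 0 * (deriv H s0 / H s0)) (at_right 0)"
    using False by (intro tendsto_mult tendsto_divide tendsto_of_real tendsto_ident_at lims) auto
  then show ?thesis using False by (intro exI[of _ 0]) simp
next
  case True
  have "\<not> H constant_on S"
    using True s1 S(3) by (metis constant_on_def)
  from holomorphic_factor_zero_nonconstant[OF H S(1,2,3) True this]
  obtain g r n where n: "0 < n" "0 < r" "ball s0 r \<subseteq> S" "g holomorphic_on ball s0 r"
    "\<And>w. w \<in> ball s0 r \<Longrightarrow> H w = (w - s0) ^ n * g w" "\<And>w. w \<in> ball s0 r \<Longrightarrow> g w \<noteq> 0"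
    by metis
  have eq: "of_real \<epsilon> * (deriv H (s0 + of_real \<epsilon>) / H (s0 + of_real \<epsilon>))
      = of_nat n + of_real \<epsilon> * (deriv g (s0 + of_real \<epsilon>) / g (s0 + of_real \<epsilon>))" if \<epsilon>: "0 < \<epsilon>" "\<epsilon> < r" for \<epsilon> :: real
  proof -
    let ?w = "s0 + of_real \<epsilon>"
    have w: "?w \<in> ball s0 r" using \<epsilon> by (simp add: dist_norm)
    have "((\<lambda>w. (w - s0) ^ n * g w) has_field_derivative
        of_nat n * (?w - s0) ^ (n - 1) * g ?w + deriv g ?w * (?w - s0) ^ n) (at ?w)"
      using holomorphic_derivI[OF n(4) open_ball w] by (auto intro!: derivative_eq_intros)
    then have "(H has_field_derivative of_nat n * (?w - s0) ^ (n - 1) * g ?w + deriv g ?w * (?w - s0) ^ n) (at ?w)"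
      by (rule has_field_derivative_transform_within_open[OF _ open_ball w]) (simp add: n(5))
    then have "deriv H ?w = of_nat n * of_real \<epsilon> ^ (n - 1) * g ?w + deriv g ?w * of_real \<epsilon> ^ n"
      by (simp add: DERIV_imp_deriv)
    moreover have "of_real \<epsilon> ^ n = of_real \<epsilon> * (of_real \<epsilon> ^ (n - 1) :: complex)"
      using n(1) by (simp add: power_eq_if)
    ultimately show ?thesis
      using n(5)[OF w] n(6)[OF w] \<epsilon> by (simp add: field_simps)
  qed
  have s0: "s0 \<in> ball s0 r" using n by simp
  have "isCont g s0" "isCont (deriv g) s0"
    using holomorphic_on_imp_continuous_on[OF n(4)] holomorphic_on_imp_continuous_on[OF holomorphic_deriv[OF n(4) open_ball]] s0
    by (auto simp: continuous_on_eq_continuous_at)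
  moreover have "((\<lambda>\<epsilon>. s0 + complex_of_real \<epsilon>) \<longlongrightarrow> s0 + of_real 0) (at_right 0)"
    by (intro tendsto_intros)
  then have "((\<lambda>\<epsilon>. s0 + complex_of_real \<epsilon>) \<longlongrightarrow> s0) (at_right 0)" by simp
  ultimately have lims: "((\<lambda>\<epsilon>. g (s0 + complex_of_real \<epsilon>)) \<longlongrightarrow> g s0) (at_right 0)"
      "((\<lambda>\<epsilon>. deriv g (s0 + complex_of_real \<epsilon>)) \<longlongrightarrow> deriv g s0) (at_right 0)"
    by - (rule isCont_tendsto_compose, assumption+)+
  have "((\<lambda>\<epsilon>. of_nat n + of_real \<epsilon> * (deriv g (s0 + of_real \<epsilon>) / g (s0 + of_real \<epsilon>))) \<longlongrightarrow> of_nat n + of_real 0 * (deriv g s0 / g s0)) (at_right 0)"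
    using n(6)[OF s0] by (intro tendsto_add tendsto_const tendsto_mult tendsto_divide tendsto_of_real tendsto_ident_at lims) auto
  moreover have "\<forall>\<^sub>F \<epsilon> in at_right (0::real). \<epsilon> \<in> {0<..<r}" using n(2) by (rule eventually_at_right_real)
  then have "\<forall>\<^sub>F \<epsilon> in at_right (0::real). of_nat n + of_real \<epsilon> * (deriv g (s0 + of_real \<epsilon>) / g (s0 + of_real \<epsilon>))
      = of_real \<epsilon> * (deriv H (s0 + of_real \<epsilon>) / H (s0 + of_real \<epsilon>))"
  proof eventually_elim
    case (elim \<epsilon>)
    then show ?case using eq[of \<epsilon>] by simp
  qed
  ultimately have "((\<lambda>\<epsilon>. of_real \<epsilon> * (deriv H (s0 + of_real \<epsilon>) / H (s0 + of_real \<epsilon>))) \<longlongrightarrow> of_nat n) (at_right 0)"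
    by (auto dest: Lim_transform_eventually)
  then show ?thesis using True n(1) by (intro exI[of _ n]) simp
qed

section \<open>Continuation to Re s > 0 and zeros on the line Re s = 1\<close>

context
  fixes a :: nat
  assumes a: "a > 0"
begin

definition pole_order :: "(nat \<Rightarrow> complex) \<Rightarrow> nat" where
  "pole_order X = (if X = princ a then 1 else 0)"

text \<open>Only the principal character has a pole, from its nonzero mean; the factor s - 1 cancels
  it and leaves that mean as the value at 1. For the other characters the value at 1 is recorded as
  a series for the later contradiction with its vanishing.\<close>

lemma regularized_L_function:
  assumes X: "X \<in> dchars a"
  shows "\<exists>H. H holomorphic_on {s. Re s > 0} \<and> (\<forall>s. Re s > 1 \<longrightarrow> H s = (s - 1) ^ pole_order X * dser X s)
           \<and> (X = princ a \<longrightarrow> H 1 \<noteq> 0) \<and> (X \<noteq> princ a \<longrightarrow> (\<lambda>n. X n / of_nat n) sums H 1)"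
proof (cases "X = princ a")
  case True
  obtain G where G: "G holomorphic_on {s. Re s > 0}" "\<And>s. Re s > 1 \<Longrightarrow> G s = (s - 1) * dser X s"
    "G 1 = (\<Sum>n<a. X n) / of_nat a"
    by (rule dser_continuation[of a X, OF a dchars_add[OF X] norm_dchars_le[OF X a]]) (rule that; assumption)
  have "G 1 \<noteq> 0" using G(3) sum_dchar[OF a X] True a by (simp add: totient_gt_0_iff)
  with G True show ?thesis by (intro exI[of _ G]) (simp add: pole_order_def)
next
  case False
  obtain H where H: "H holomorphic_on {s. Re s > 0}" "\<And>s. Re s > 1 \<Longrightarrow> H s = dser X s"
    "(\<lambda>n. X n / of_nat n) sums H 1"
    by (rule dser_nonprincipal[OF a X False]) (rule that; assumption)
  with False show ?thesis by (intro exI[of _ H]) (simp add: pole_order_def)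
qed

text \<open>Some continuation of \<open>(s - 1) ^ pole_order X * dser X s\<close>; it is unspecified for \<open>Re s \<le> 0\<close>.\<close>

definition L_reg :: "(nat \<Rightarrow> complex) \<Rightarrow> complex \<Rightarrow> complex" where
  "L_reg X = (SOME H. H holomorphic_on {s. Re s > 0} \<and> (\<forall>s. Re s > 1 \<longrightarrow> H s = (s - 1) ^ pole_order X * dser X s)
           \<and> (X = princ a \<longrightarrow> H 1 \<noteq> 0) \<and> (X \<noteq> princ a \<longrightarrow> (\<lambda>n. X n / of_nat n) sums H 1))"

context
  fixes X assumes X: "X \<in> dchars a"
begin

lemma L_reg: "L_reg X holomorphic_on {s. Re s > 0}"
    "Re s > 1 \<Longrightarrow> L_reg X s = (s - 1) ^ pole_order X * dser X s"
    "X = princ a \<Longrightarrow> L_reg X 1 \<noteq> 0" "X \<noteq> princ a \<Longrightarrow> (\<lambda>n. X n / of_nat n) sums L_reg X 1"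
  using someI_ex[OF regularized_L_function[OF X]] unfolding L_reg_def[symmetric] by auto

lemma L_reg_nonzero_right:
  assumes "Re s > 1" shows "L_reg X s \<noteq> 0"
  using L_reg(2)[OF assms] dser_dchar_nonzero[OF a X assms] assms by auto

lemma von_mangoldt_series_eq:
  assumes s: "Re s > 1"
  shows "von_mangoldt_series X s = of_nat (pole_order X) / (s - 1) - deriv (L_reg X) s / L_reg X s"
proof -
  let ?\<delta> = "pole_order X"
  have s1: "s - 1 \<noteq> 0" using s by auto
  have "((\<lambda>s. (s - 1) ^ ?\<delta> * dser X s) has_field_derivative
      of_nat ?\<delta> * (s - 1) ^ (?\<delta> - 1) * dser X s + - (dser X s * von_mangoldt_series X s) * (s - 1) ^ ?\<delta>) (at s)"
    using dser_dchar_derivative[OF a X s] by (auto intro!: derivative_eq_intros)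
  then have "(L_reg X has_field_derivative
      of_nat ?\<delta> * (s - 1) ^ (?\<delta> - 1) * dser X s + - (dser X s * von_mangoldt_series X s) * (s - 1) ^ ?\<delta>) (at s)"
    by (rule has_field_derivative_transform_within_open[OF _ open_halfspace_Re_gt[of 1]]) (use s in \<open>auto simp: L_reg(2)\<close>)
  then have d: "deriv (L_reg X) s = of_nat ?\<delta> * (s - 1) ^ (?\<delta> - 1) * dser X s - dser X s * von_mangoldt_series X s * (s - 1) ^ ?\<delta>"
    by (simp add: DERIV_imp_deriv)
  have "(of_nat ?\<delta> * u ^ (?\<delta> - 1) * D - D * V * u ^ ?\<delta>) / (u ^ ?\<delta> * D) = of_nat ?\<delta> / u - V"
    if "u \<noteq> 0" "D \<noteq> 0" for u D V :: complex
    using that by (auto simp: pole_order_def field_simps)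
  from this[OF s1 dser_dchar_nonzero[OF a X s], of "von_mangoldt_series X s"] show ?thesis
    unfolding L_reg(2)[OF s] d by simp
qed

text \<open>The limit isolates the residue of the series at 1 + i t: the order of the pole of the
  L-function there minus the order n of the zero of \<open>L_reg\<close>.\<close>

lemma von_mangoldt_series_limit:
  fixes t :: real
  shows "\<exists>n::nat. ((\<lambda>\<epsilon>::real. of_real \<epsilon> * von_mangoldt_series X (1 + \<i> * t + of_real \<epsilon>))
            \<longlongrightarrow> of_nat (if t = 0 then pole_order X else 0) - of_nat n) (at_right 0)
          \<and> (n = 0 \<longleftrightarrow> L_reg X (1 + \<i> * t) \<noteq> 0)"
proof -
  let ?S = "{s. Re s > 0}" and ?s0 = "1 + \<i> * of_real t"
  have "convex ?S" by (rule convex_halfspace_Re_gt)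
  then have S: "open ?S" "connected ?S" "?s0 \<in> ?S" "2 \<in> ?S"
    by (auto intro: open_halfspace_Re_gt convex_connected)
  obtain n :: nat where n: "((\<lambda>\<epsilon>::real. of_real \<epsilon> * (deriv (L_reg X) (?s0 + of_real \<epsilon>) / L_reg X (?s0 + of_real \<epsilon>))) \<longlongrightarrow> of_nat n) (at_right 0)"
    "n = 0 \<longleftrightarrow> L_reg X ?s0 \<noteq> 0"
    using logderiv_limit_at_zero[OF L_reg(1) S L_reg_nonzero_right[of 2]] by auto
  let ?p = "of_nat (pole_order X) :: complex"
  have p: "((\<lambda>\<epsilon>::real. of_real \<epsilon> * (?p / (?s0 + of_real \<epsilon> - 1))) \<longlongrightarrow> of_nat (if t = 0 then pole_order X else 0)) (at_right 0)"
  proof (cases "t = 0")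
    case True
    have "\<forall>\<^sub>F \<epsilon> in at_right (0::real). ?p = of_real \<epsilon> * (?p / (?s0 + of_real \<epsilon> - 1))"
      using eventually_at_right_less[of "0::real"] by eventually_elim (use True in simp)
    then have "((\<lambda>\<epsilon>::real. of_real \<epsilon> * (?p / (?s0 + of_real \<epsilon> - 1))) \<longlongrightarrow> ?p) (at_right 0)"
      by (rule Lim_transform_eventually[OF tendsto_const])
    then show ?thesis using True by simp
  next
    case False
    have "((\<lambda>\<epsilon>::real. of_real \<epsilon> * (?p / (?s0 + of_real \<epsilon> - 1))) \<longlongrightarrow> of_real 0 * (?p / (?s0 + of_real 0 - 1))) (at_right 0)"
      using False by (intro tendsto_intros) auto
    then show ?thesis using False by simp
  qed
  have "((\<lambda>\<epsilon>::real. of_real \<epsilon> * (?p / (?s0 + of_real \<epsilon> - 1)) - of_real \<epsilon> * (deriv (L_reg X) (?s0 + of_real \<epsilon>) / L_reg X (?s0 + of_real \<epsilon>)))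
      \<longlongrightarrow> of_nat (if t = 0 then pole_order X else 0) - of_nat n) (at_right 0)"
    by (intro tendsto_diff p n(1))
  moreover have "\<forall>\<^sub>F \<epsilon> in at_right (0::real). of_real \<epsilon> * (?p / (?s0 + of_real \<epsilon> - 1)) - of_real \<epsilon> * (deriv (L_reg X) (?s0 + of_real \<epsilon>) / L_reg X (?s0 + of_real \<epsilon>))
     = of_real \<epsilon> * von_mangoldt_series X (?s0 + of_real \<epsilon>)"
    using eventually_at_right_less[of "0::real"]
    by eventually_elim (simp add: von_mangoldt_series_eq right_diff_distrib)
  ultimately have "((\<lambda>\<epsilon>::real. of_real \<epsilon> * von_mangoldt_series X (?s0 + of_real \<epsilon>))
            \<longlongrightarrow> of_nat (if t = 0 then pole_order X else 0) - of_nat n) (at_right 0)"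
    by (rule Lim_transform_eventually)
  with n(2) show ?thesis by (intro exI[of _ n] conjI)
qed

text \<open>Termwise, with z = X n n^(-i t) of modulus 1, the combination is a nonnegative multiple
  of 3 + 4 z + z^2, whose real part is 2 (1 + Re z)^2. Terms with n not coprime to a vanish.\<close>

lemma mertens_inequality:
  fixes t \<epsilon> :: real
  assumes \<epsilon>: "\<epsilon> > 0"
  shows "0 \<le> Re (3 * von_mangoldt_series (princ a) (1 + of_real \<epsilon>) + 4 * von_mangoldt_series X (1 + \<i> * t + of_real \<epsilon>)
           + von_mangoldt_series (\<lambda>n. X n * X n) (1 + \<i> * (2 * t) + of_real \<epsilon>))"
proof -
  let ?s0 = "1 + of_real \<epsilon> :: complex" and ?s1 = "1 + \<i> * of_real t + of_real \<epsilon>" and ?s2 = "1 + \<i> * of_real (2 * t) + of_real \<epsilon>"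
  have S: "(\<lambda>n. mangoldt n * Y n * of_nat n powr (-s)) sums von_mangoldt_series Y s" if "Y \<in> dchars a" "Re s > 1" for Y s
    unfolding von_mangoldt_series_def using dser_sums[OF dchar_coeff(2)[OF a that(1)] that(2)] .
  have X2: "(\<lambda>n. X n * X n) \<in> dchars a" by (rule dchars_times[OF X X])
  have sums: "(\<lambda>n. Re (3 * (mangoldt n * princ a n * of_nat n powr (-?s0)) + 4 * (mangoldt n * X n * of_nat n powr (-?s1))
       + mangoldt n * (X n * X n) * of_nat n powr (-?s2)))
      sums Re (3 * von_mangoldt_series (princ a) ?s0 + 4 * von_mangoldt_series X ?s1 + von_mangoldt_series (\<lambda>n. X n * X n) ?s2)"
    using \<epsilon> by (intro sums_Re sums_add sums_mult S princ_in_dchars X X2) auto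
  have nonneg: "0 \<le> Re (3 * (mangoldt n * princ a n * of_nat n powr (-?s0)) + 4 * (mangoldt n * X n * of_nat n powr (-?s1))
       + mangoldt n * (X n * X n) * of_nat n powr (-?s2))" (is "0 \<le> Re ?T") for n
  proof (cases "n > 0 \<and> coprime n a")
    case False
    then have "?T = 0" using dchars_eq_0_iff[OF X, of n] by (auto simp: princ_def)
    then show ?thesis by simp
  next
    case True
    define z where "z = X n * of_nat n powr (- (\<i> * of_real t))"
    have nz: "norm z = 1" using norm_dchars[OF X a, of n] True by (simp add: z_def norm_mult norm_nat_powr)
    define r where "r = mangoldt n * real n powr (- 1 - \<epsilon>)"
    have r: "r \<ge> 0" by (simp add: r_def mangoldt_nonneg)
    have p0: "(of_nat n :: complex) powr (-?s0) = of_real (real n powr (- 1 - \<epsilon>))"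
      using powr_of_real[of "real n" "- 1 - \<epsilon>"] by simp
    have p1: "(of_nat n :: complex) powr (-?s1) = of_nat n powr (-?s0) * of_nat n powr (- (\<i> * of_real t))"
      using True by (simp add: powr_add[symmetric] algebra_simps)
    have p2: "(of_nat n :: complex) powr (-?s2) = of_nat n powr (-?s0) * (of_nat n powr (- (\<i> * of_real t)) * of_nat n powr (- (\<i> * of_real t)))"
      using True by (simp add: powr_add[symmetric] algebra_simps)
    have T: "?T = of_real r * (3 + 4 * z + z * z)"
      unfolding p1 p2 p0 z_def r_def using True by (simp add: princ_def algebra_simps)
    have "(Re z)\<^sup>2 + (Im z)\<^sup>2 = 1" using nz by (simp add: cmod_power2[symmetric])
    then have "Re (3 + 4 * z + z * z) = 2 * (1 + Re z)\<^sup>2"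
      by (simp add: power2_eq_square algebra_simps)
    then show ?thesis unfolding T using r by simp
  qed
  have "(\<lambda>n::nat. 0::real) sums 0" by simp
  from sums_le[OF nonneg this sums] show ?thesis by simp
qed

lemma L_reg_1_nonzero_real:
  assumes "X \<noteq> princ a" "(\<lambda>n. X n * X n) = princ a"
  shows "L_reg X 1 \<noteq> 0"
proof
  assume zero: "L_reg X 1 = 0"
  define x where "x = (\<lambda>n. Re (X n))"
  have "X n * X n \<in> {0, 1}" for n using fun_cong[OF assms(2), of n] by (auto simp: princ_def split: if_splits)
  then have X3: "X n = -1 \<or> X n = 0 \<or> X n = 1" for n using square_eq_1_iff[of "X n"] by fastforce
  have Xx: "X n = of_real (x n)" for n using X3[of n] by (auto simp: x_def)
  have x_range: "x n \<in> {-1, 0, 1}" for n using X3[of n] by (auto simp: x_def)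
  have mult: "x (m * n) = x m * x n" for m n
  proof -
    have "complex_of_real (x (m * n)) = of_real (x m * x n)"
      using dchars_mult[OF X, of m n] by (simp add: Xx)
    then show ?thesis by (simp only: of_real_eq_iff)
  qed
  have one: "x 1 = 1" using dchars_1[OF X] by (simp add: x_def)
  have "(\<lambda>n. Re (X n / of_nat n)) sums Re 0" using L_reg(4)[OF assms(1)] zero by (intro sums_Re) simp
  then have "(\<lambda>n. x n / real n) sums 0" by (simp add: x_def)
  moreover have "\<bar>\<Sum>n<N. x n\<bar> \<le> real a" for N
    using dchar_partial_sum_bound[OF a X assms(1), of N] by (simp add: Xx of_real_sum[symmetric] del: of_real_sum)
  ultimately show False using real_character_sum_nonzero[of x, OF mult one x_range] by blast
qed

end

text \<open>Multiplying the inequality by \<epsilon> and letting \<epsilon> tend to 0 gives 0 \<le>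
  3 - 4 n1 - n2 for the orders of the zeros at 1 + i t and 1 + 2 i t, so n1 = 0. In the excluded
  case t = 0 with X^2 principal the bound would read 4 - 4 n1 - n2, which permits n1 = 1.\<close>

lemma L_reg_nonzero_line:
  fixes t :: real
  assumes X: "X \<in> dchars a"
  shows "L_reg X (1 + \<i> * t) \<noteq> 0"
proof (cases "t = 0 \<and> (X = princ a \<or> (\<lambda>n. X n * X n) = princ a)")
  case True
  then show ?thesis using L_reg(3)[OF X] L_reg_1_nonzero_real[OF X] by auto
next
  case False
  let ?X2 = "\<lambda>n. X n * X n"
  obtain n0 :: nat where n0: "((\<lambda>\<epsilon>::real. of_real \<epsilon> * von_mangoldt_series (princ a) (1 + \<i> * of_real 0 + of_real \<epsilon>))
      \<longlongrightarrow> of_nat (if 0 = (0::real) then pole_order (princ a) else 0) - of_nat n0) (at_right 0)"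
    "n0 = 0 \<longleftrightarrow> L_reg (princ a) (1 + \<i> * of_real 0) \<noteq> 0"
    using von_mangoldt_series_limit[OF princ_in_dchars, of 0] by blast
  have n00: "n0 = 0" using n0(2) L_reg(3)[OF princ_in_dchars] by simp
  obtain n1 :: nat where n1: "((\<lambda>\<epsilon>::real. of_real \<epsilon> * von_mangoldt_series X (1 + \<i> * of_real t + of_real \<epsilon>))
      \<longlongrightarrow> of_nat (if t = 0 then pole_order X else 0) - of_nat n1) (at_right 0)"
    "n1 = 0 \<longleftrightarrow> L_reg X (1 + \<i> * of_real t) \<noteq> 0"
    using von_mangoldt_series_limit[OF X, of t] by blast
  obtain n2 :: nat where n2: "((\<lambda>\<epsilon>::real. of_real \<epsilon> * von_mangoldt_series ?X2 (1 + \<i> * of_real (2 * t) + of_real \<epsilon>))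
      \<longlongrightarrow> of_nat (if 2 * t = 0 then pole_order ?X2 else 0) - of_nat n2) (at_right 0)"
    using von_mangoldt_series_limit[OF dchars_times[OF X X], of "2 * t"] by blast
  have d: "(if 0 = (0::real) then pole_order (princ a) else 0) = 1"
    "(if t = 0 then pole_order X else 0) = 0" "(if 2 * t = 0 then pole_order ?X2 else 0) = 0"
    using False by (auto simp: pole_order_def)
  have "((\<lambda>\<epsilon>::real. Re (3 * (of_real \<epsilon> * von_mangoldt_series (princ a) (1 + \<i> * of_real 0 + of_real \<epsilon>))
      + 4 * (of_real \<epsilon> * von_mangoldt_series X (1 + \<i> * of_real t + of_real \<epsilon>))
      + of_real \<epsilon> * von_mangoldt_series ?X2 (1 + \<i> * of_real (2 * t) + of_real \<epsilon>)))
      \<longlongrightarrow> Re (3 * (of_nat 1 - of_nat n0) + 4 * (of_nat 0 - of_nat n1) + (of_nat 0 - of_nat n2))) (at_right 0)"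
    using n0(1) n1(1) n2 unfolding d by (intro tendsto_Re tendsto_add tendsto_mult tendsto_const)
  then have "0 \<le> Re (3 * (of_nat 1 - of_nat n0) + 4 * (of_nat 0 - of_nat n1) + (of_nat 0 - of_nat n2))"
  proof (rule tendsto_lowerbound)
    show "\<forall>\<^sub>F \<epsilon> in at_right (0::real). 0 \<le> Re (3 * (of_real \<epsilon> * von_mangoldt_series (princ a) (1 + \<i> * of_real 0 + of_real \<epsilon>))
      + 4 * (of_real \<epsilon> * von_mangoldt_series X (1 + \<i> * of_real t + of_real \<epsilon>))
      + of_real \<epsilon> * von_mangoldt_series ?X2 (1 + \<i> * of_real (2 * t) + of_real \<epsilon>))"
      using eventually_at_right_less[of "0::real"]
    proof eventually_elim
      case (elim \<epsilon>)
      let ?R = "3 * von_mangoldt_series (princ a) (1 + of_real \<epsilon>) + 4 * von_mangoldt_series X (1 + \<i> * of_real t + of_real \<epsilon>)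
           + von_mangoldt_series ?X2 (1 + \<i> * of_real (2 * t) + of_real \<epsilon>)"
      have "3 * (of_real \<epsilon> * von_mangoldt_series (princ a) (1 + \<i> * of_real 0 + of_real \<epsilon>))
      + 4 * (of_real \<epsilon> * von_mangoldt_series X (1 + \<i> * of_real t + of_real \<epsilon>))
      + of_real \<epsilon> * von_mangoldt_series ?X2 (1 + \<i> * of_real (2 * t) + of_real \<epsilon>) = of_real \<epsilon> * ?R"
        by (simp add: distrib_left mult_ac)
      moreover have "0 \<le> \<epsilon> * Re ?R"
        using mertens_inequality[OF X elim, of t] elim by (intro mult_nonneg_nonneg) auto
      moreover have "Re (of_real \<epsilon> * ?R) = \<epsilon> * Re ?R" by (simp only: Re_complex_of_real Im_complex_of_real times_complex.sel)
      ultimately show ?case by (simp only:)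
    qed
  qed simp
  then have "0 \<le> 3 - 4 * real n1 - real n2" using n00 by simp
  then have "n1 = 0" by simp
  then show ?thesis using n1(2) by simp
qed

text \<open>The logarithmic derivative of \<open>L_reg\<close> is holomorphic off the zeros of
  \<open>L_reg\<close>, and the closed half plane Re s \<ge> 1 contains none.\<close>

theorem von_mangoldt_series_extension:
  assumes X: "X \<in> dchars a"
  shows "\<exists>U P. open U \<and> {s. 1 \<le> Re s} \<subseteq> U \<and> P holomorphic_on U \<and>
    (\<forall>s. Re s > 1 \<longrightarrow> von_mangoldt_series X s = of_nat (pole_order X) / (s - 1) + P s)"
proof (intro exI conjI allI impI)
  let ?S = "{s. Re s > 0}"
  let ?U = "?S \<inter> L_reg X -` (- {0})"
  have S: "open ?S" by (rule open_halfspace_Re_gt)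
  have L: "L_reg X holomorphic_on ?S" by (rule L_reg(1)[OF X])
  show U: "open ?U"
    by (rule continuous_open_preimage[OF holomorphic_on_imp_continuous_on[OF L] S]) (simp add: open_Compl)
  show "{s. 1 \<le> Re s} \<subseteq> ?U"
  proof
    fix s assume s: "s \<in> {s. 1 \<le> Re s}"
    have "L_reg X s \<noteq> 0"
    proof (cases "Re s = 1")
      case True
      then have "s = 1 + \<i> * of_real (Im s)" by (simp add: complex_eq_iff)
      then show ?thesis using L_reg_nonzero_line[OF X, of "Im s"] by simp
    next
      case False
      then show ?thesis using L_reg_nonzero_right[OF X, of s] s by simp
    qed
    with s show "s \<in> ?U" by simp
  qed
  show "(\<lambda>s. - (deriv (L_reg X) s / L_reg X s)) holomorphic_on ?U"
    using holomorphic_deriv[OF L S] L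
    by (intro holomorphic_intros U) (auto elim: holomorphic_on_subset)
  show "von_mangoldt_series X s = of_nat (pole_order X) / (s - 1) + - (deriv (L_reg X) s / L_reg X s)" if "1 < Re s" for s
    using von_mangoldt_series_eq[OF X that] by simp
qed

end

section \<open>Newman's Tauberian theorem\<close>

text \<open>P may be any path in W closing the right semicircle without meeting the nonnegative real
  axis; it will be a polygon for g and the left semicircle for the entire partial sums. The winding
  number is 1 because Ln z on the arc and Ln (-z) on P are primitives of 1 / z, each contributing
  \<pi> i.\<close>

lemma D_contour_formula:
  fixes f :: "complex \<Rightarrow> complex" and R :: real
  assumes R: "R > 0" and W: "convex W" "open W" "0 \<in> W" and f: "f holomorphic_on W"
    and P: "valid_path P" "pathstart P = \<i> * R" "pathfinish P = -\<i> * R"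
      "path_image P \<subseteq> W" "\<And>z. z \<in> path_image P \<Longrightarrow> -z \<notin> \<real>\<^sub>\<le>\<^sub>0"
    and A: "path_image (part_circlepath 0 R (-pi/2) (pi/2)) \<subseteq> W"
  shows "contour_integral (part_circlepath 0 R (-pi/2) (pi/2)) (\<lambda>z. f z / z)
           + contour_integral P (\<lambda>z. f z / z) = 2 * pi * \<i> * f 0"
proof -
  let ?A = "part_circlepath 0 R (-pi/2) (pi/2)"
  have cis1: "exp (\<i> * of_real (pi/2)) = \<i>" "exp (- (\<i> * of_real (pi/2))) = -\<i>"
    using cis_conv_exp[of "pi/2"] by (simp_all add: exp_minus)
  have stA: "pathstart ?A = -\<i> * R" "pathfinish ?A = \<i> * R"
    using cis1 by simp_all
  have lnI: "Ln (\<i> * R) = of_real (ln R) + \<i> * (pi/2)" "Ln (-(\<i> * R)) = of_real (ln R) - \<i> * (pi/2)"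
  proof -
    have "\<i> * R = exp (of_real (ln R) + \<i> * (pi/2))"
      using R cis1 by (simp add: exp_add exp_of_real)
    moreover have "-(\<i> * R) = exp (of_real (ln R) - \<i> * (pi/2))"
      unfolding diff_conv_add_uminus exp_add exp_of_real using R cis1 by simp
    moreover have "- pi < pi/2" "pi/2 \<le> pi" "-pi < -(pi/2)" "-(pi/2) \<le> pi" by (simp_all add: field_simps)
    ultimately show "Ln (\<i> * R) = of_real (ln R) + \<i> * (pi/2)" "Ln (-(\<i> * R)) = of_real (ln R) - \<i> * (pi/2)"
      by (simp_all del: exp_Ln)
  qed
  have Apos: "z \<notin> \<real>\<^sub>\<le>\<^sub>0" if "z \<in> path_image ?A" for z
  proof -
    from that obtain x where x: "-pi/2 \<le> x" "x \<le> pi/2" "z = R * exp (\<i> * of_real x)"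
      by (auto simp: path_image_part_circlepath)
    have "cos x \<ge> 0" using x by (intro cos_ge_zero) auto
    moreover have "sin x \<noteq> 0" if "cos x = 0"
      using that sin_cos_squared_add[of x] by auto
    ultimately show ?thesis using R
      by (auto simp: x complex_nonpos_Reals_iff Re_exp Im_exp mult_le_0_iff)
  qed
  have i1: "((\<lambda>z. 1/z) has_contour_integral (Ln (\<i> * R) - Ln (-(\<i> * R)))) ?A"
  proof -
    have "((\<lambda>z. 1/z) has_contour_integral (Ln (pathfinish ?A) - Ln (pathstart ?A))) ?A"
      by (rule contour_integral_primitive[of "-\<real>\<^sub>\<le>\<^sub>0"])
         (use Apos in \<open>auto simp: inverse_eq_divide intro!: derivative_eq_intros\<close>)
    then show ?thesis unfolding stA by simp
  qed
  have i2: "((\<lambda>z. 1/z) has_contour_integral (Ln (\<i> * R) - Ln (-(\<i> * R)))) P"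
  proof -
    have "((\<lambda>z. 1/z) has_contour_integral (Ln (- pathfinish P) - Ln (- pathstart P))) P"
      by (rule contour_integral_primitive[of "{z. -z \<notin> \<real>\<^sub>\<le>\<^sub>0}"])
         (use P in \<open>auto simp: inverse_eq_divide intro!: derivative_eq_intros\<close>)
    then show ?thesis unfolding P(2,3) by simp
  qed
  let ?g = "?A +++ P"
  have vg: "valid_path ?g" using P stA by (intro valid_path_join) auto
  have img: "path_image ?g \<subseteq> W - {0}"
    using P A Apos stA by (subst path_image_join) (force simp: complex_nonpos_Reals_iff)+
  have i3: "((\<lambda>z. 1/z) has_contour_integral (2 * pi * \<i>)) ?g"
    using has_contour_integral_join[OF i1 i2] P(1) lnI by (simp add: mult_ac)
  have "winding_number ?g 0 = 1"
    using winding_number_valid_path[OF vg, of 0] img i3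
    by (auto simp: contour_integral_unique)
  moreover have "0 \<in> interior W" using W by (simp add: interior_open)
  ultimately have "((\<lambda>w. f w / (w - 0)) has_contour_integral (2 * pi * \<i> * 1 * f 0)) ?g"
    using Cauchy_integral_formula_convex_simple[OF W(1) f _ vg img] P stA by auto
  then have h: "((\<lambda>w. f w / w) has_contour_integral (2 * pi * \<i> * f 0)) ?g" by simp
  then have ci: "(\<lambda>w. f w / w) contour_integrable_on ?A" "(\<lambda>w. f w / w) contour_integrable_on P"
    using contour_integrable_join[of ?A P] P stA by (auto simp: contour_integrable_on_def)
  then show ?thesis
    using contour_integral_unique[OF h] contour_integral_join[OF ci] P by simp
qed

text \<open>Dominated convergence: N^z has modulus at most 1 on the segment and tends to 0 at
  interior points, where Re z < 0. An endpoint may lie on the imaginary axis.\<close>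

lemma contour_integral_linepath_powr_tendsto_0:
  fixes h :: "complex \<Rightarrow> complex"
  assumes h: "continuous_on (closed_segment a b) h"
    and ab: "Re a \<le> 0" "Re b \<le> 0" "Re a < 0 \<or> Re b < 0"
  shows "(\<lambda>N. contour_integral (linepath a b) (\<lambda>z. h z * of_nat N powr z)) \<longlonglongrightarrow> 0"
proof -
  obtain M where M: "\<And>z. z \<in> closed_segment a b \<Longrightarrow> norm (h z) \<le> M"
    using compact_continuous_image[OF h compact_segment] by (meson bounded_iff compact_imp_bounded imageI)
  have Re: "Re (linepath a b t) \<le> 0" if "t \<in> {0..1}" for t
    using that ab by (auto simp: linepath_def intro!: add_nonpos_nonpos mult_nonneg_nonpos)
  have Re': "Re (linepath a b t) < 0" if "t \<in> {0<..<1}" for t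
  proof -
    have "(1 - t) * Re a \<le> 0" "t * Re b \<le> 0" "(1 - t) * Re a < 0 \<or> t * Re b < 0"
      using that ab by (auto simp: mult_le_0_iff mult_less_0_iff)
    then show ?thesis by (auto simp: linepath_def)
  qed
  have seg: "linepath a b t \<in> closed_segment a b" if "t \<in> {0..1}" for t
    using that linepath_in_path by blast
  have powr_le: "norm (of_nat N powr z :: complex) \<le> 1" if "Re z \<le> 0" for N z
  proof (cases "N = 0")
    case False
    then have "norm (of_nat N powr z :: complex) = real N powr Re z"
      using norm_powr_real_powr[of "of_nat N" z] by simp
    also have "\<dots> \<le> real N powr 0" using False that by (intro powr_mono) auto
    finally show ?thesis using False by simp
  qed simp
  let ?f = "\<lambda>N t. h (linepath a b t) * of_nat N powr (linepath a b t) * (b - a)"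
  define c where "c = (\<lambda>N. contour_integral (linepath a b) (\<lambda>z. h z * of_nat N powr z))"
  have int: "((?f (Suc N)) has_integral c (Suc N)) {0<..<1}" for N
  proof -
    have "continuous_on (closed_segment a b) (\<lambda>z. h z * of_nat (Suc N) powr z)"
      using of_nat_neq_0[of N] by (intro continuous_intros h) (auto simp del: of_nat_Suc)
    then have "(\<lambda>z. h z * of_nat (Suc N) powr z) contour_integrable_on linepath a b"
      by (rule contour_integrable_continuous_linepath)
    then have "((\<lambda>z. h z * of_nat (Suc N) powr z) has_contour_integral c (Suc N)) (linepath a b)"
      unfolding c_def by (rule has_contour_integral_integral)
    then show ?thesis
      by (simp add: has_contour_integral_linepath has_integral_Icc_iff_Ioo)
  qed
  have lim: "(\<lambda>N. ?f (Suc N) t) \<longlonglongrightarrow> 0" if "t \<in> {0<..<1}" for t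
  proof -
    have "(\<lambda>N. real (Suc N) powr Re (linepath a b t)) \<longlonglongrightarrow> 0"
      using Re'[OF that] by (intro tendsto_neg_powr filterlim_compose[OF filterlim_real_sequentially filterlim_Suc])
    then have "(\<lambda>N. norm (of_nat (Suc N) powr linepath a b t :: complex)) \<longlonglongrightarrow> 0"
      using norm_powr_real_powr[of "of_nat (Suc N)" "linepath a b t" for N] by (simp del: of_nat_Suc)
    then have "(\<lambda>N. of_nat (Suc N) powr linepath a b t :: complex) \<longlonglongrightarrow> 0"
      by (rule tendsto_norm_zero_cancel)
    then show ?thesis
      by (intro tendsto_mult_left_zero tendsto_mult_right_zero)
  qed
  have "(\<lambda>N. integral {0<..<1} (?f (Suc N))) \<longlonglongrightarrow> integral {0<..<1::real} (\<lambda>_. 0)"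
  proof (rule dominated_convergence(2)[where f = "\<lambda>N. ?f (Suc N)" and S = "{0<..<1}" and h = "\<lambda>_. M * 1 * norm (b - a)"])
    show "?f (Suc N) integrable_on {0<..<1}" for N using int by blast
    have "(\<lambda>_. M * 1 * cmod (b - a)) integrable_on {0..1::real}" by (rule integrable_const_ivl)
    then show "(\<lambda>_. M * 1 * cmod (b - a)) integrable_on {0<..<1::real}"
      by (simp only: integrable_on_Icc_iff_Ioo)
    show "norm (?f (Suc N) t) \<le> M * 1 * norm (b - a)" if "t \<in> {0<..<1}" for N t
    proof -
      have M0: "0 \<le> M" using order_trans[OF norm_ge_zero M[of a]] by simp
      have "norm (h (linepath a b t)) \<le> M" using that by (intro M seg) auto
      moreover have "norm (of_nat (Suc N) powr linepath a b t :: complex) \<le> 1"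
        using that by (intro powr_le Re) auto
      ultimately show ?thesis
        unfolding norm_mult using M0 by (intro mult_mono) auto
    qed
    show "(\<lambda>N. ?f (Suc N) t) \<longlonglongrightarrow> 0" if "t \<in> {0<..<1}" for t
      using lim that by blast
  qed
  then have "(\<lambda>N. c (Suc N)) \<longlonglongrightarrow> 0"
    unfolding integral_unique[OF int] by simp
  then show ?thesis unfolding c_def by (rule LIMSEQ_imp_Suc)
qed

text \<open>On the circle, the kernel cancels the factor \<open>1 / Re z\<close> in the bounds for the partial sums.\<close>

lemma newman_kernel_eq:
  assumes "norm z = R" "R > 0"
  shows "(1 + z\<^sup>2 / (of_real R)\<^sup>2) / z = of_real (2 * Re z / R\<^sup>2)"
proof -
  have z: "z \<noteq> 0" using assms by auto
  have "(of_real R)\<^sup>2 = z * cnj z"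
    using assms complex_norm_square[of z] by simp
  then have "(of_real R)\<^sup>2 + z\<^sup>2 = z * of_real (2 * Re z)"
    by (simp add: complex_eq_iff power2_eq_square algebra_simps)
  with z assms(2) show ?thesis
    by (simp add: field_simps)
qed

text \<open>The integrand carries the factor N^z (1 + z^2 / R^2) / z, of modulus 2 |Re z| N^(Re z) /
  R^2 on the circle. Against the assumed bounds this leaves 2 B / R^2, so each semicircle
  contributes at most 2 \<pi> B / R: the right one for g - S N, the left one for S N, which is
  entire. The left part of the contour for g stays close to the axis, and its integral tends to 0
  for fixed R. Dividing by 2 \<pi> bounds the limiting error by 2 B / R, and R is arbitrary.\<close>

theorem newman_tauberian:
  fixes S :: "nat \<Rightarrow> complex \<Rightarrow> complex" and g :: "complex \<Rightarrow> complex"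
  assumes U: "open U" "{z. 0 \<le> Re z} \<subseteq> U" and g: "g holomorphic_on U"
    and S: "\<And>N. S N holomorphic_on UNIV" and B: "B \<ge> 0"
    and right: "\<And>N z. N > 0 \<Longrightarrow> Re z > 0 \<Longrightarrow> norm (g z - S N z) \<le> B * real N powr (-Re z) / Re z"
    and left: "\<And>N z. N > 0 \<Longrightarrow> Re z < 0 \<Longrightarrow> norm (S N z) \<le> B * real N powr (-Re z) / (-Re z)"
  shows "(\<lambda>N. S N 0) \<longlonglongrightarrow> g 0"
proof -
  have key: "\<forall>\<^sub>F N in sequentially. norm (S N 0 - g 0) \<le> 2 * B / R + e" if R: "R > 0" and e: "e > 0" for R e :: real
  proof -
    \<comment> \<open>Compactness of a segment slightly longer than the diameter of the circle gives
      one width d for a strip to the left of the axis inside U.\<close>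
    define I where "I = {z. Re z = 0 \<and> \<bar>Im z\<bar> \<le> R + 1}"
    have "I = cbox (Complex 0 (-R-1)) (Complex 0 (R+1))"
      by (auto simp: I_def in_cbox_complex_iff)
    then have "compact I" by (metis compact_cbox)
    moreover have "I \<subseteq> U" using U by (auto simp: I_def)
    ultimately obtain d where d: "d > 0" "(\<Union>x\<in>I. ball x d) \<subseteq> U"
      using compact_subset_open_imp_ball_epsilon_subset[OF _ U(1)] by metis
    define W where "W = {z. Re z > -d \<and> Im z < R + 1 \<and> Im z > -R - 1}"
    have WU: "W \<subseteq> U"
    proof
      fix z assume z: "z \<in> W"
      show "z \<in> U"
      proof (cases "Re z \<ge> 0")
        case False
        have "Complex 0 (Im z) \<in> I" using z by (auto simp: I_def W_def)
        moreover have "z \<in> ball (Complex 0 (Im z)) d"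
          using z False by (auto simp: W_def dist_norm complex_norm_square cmod_def)
        ultimately show ?thesis using d by blast
      qed (use U in auto)
    qed
    have Weq: "W = {z. Re z > -d} \<inter> {z. Im z < R + 1} \<inter> {z. Im z > -R - 1}"
      by (auto simp: W_def)
    have W: "convex W" "open W" "0 \<in> W"
      using d R unfolding Weq
      by (auto intro!: convex_Int open_Int convex_halfspace_Re_gt convex_halfspace_Im_lt convex_halfspace_Im_gt
          open_halfspace_Re_gt open_halfspace_Im_lt open_halfspace_Im_gt)
    define a where "a = \<i> * R"
    \<comment> \<open>The contour for g goes left only by d/2, within W; on the left semicircle g
      need not be holomorphic.\<close>
    define b where "b = Complex (-d/2) R"
    define c where "c = Complex (-d/2) (-R)"
    define P where "P = linepath a b +++ linepath b c +++ linepath c (-a)"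
    define A where "A = part_circlepath 0 R (-pi/2) (pi/2)"
    define A' where "A' = part_circlepath 0 R (pi/2) (3*pi/2)"
    have segs: "closed_segment a b \<subseteq> W" "closed_segment b c \<subseteq> W" "closed_segment c (-a) \<subseteq> W"
      using R d by (intro closed_segment_subset W; auto simp: W_def a_def b_def c_def)+
    have vP: "valid_path P" "pathstart P = \<i> * R" "pathfinish P = -\<i> * R"
      by (auto simp: P_def a_def intro!: valid_path_join)
    have imP: "path_image P = closed_segment a b \<union> closed_segment b c \<union> closed_segment c (-a)"
      by (auto simp: P_def path_image_join)
    have PW: "path_image P \<subseteq> W" using segs imP by auto
    have Pneg: "-z \<notin> \<real>\<^sub>\<le>\<^sub>0" if "z \<in> path_image P" for z
    proof
      assume z: "-z \<in> \<real>\<^sub>\<le>\<^sub>0"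
      then have z: "Im z = 0" "Re z \<ge> 0" by (auto simp: complex_nonpos_Reals_iff)
      have "closed_segment a b \<subseteq> {z. Im z > 0}" "closed_segment b c \<subseteq> {z. Re z < 0}"
         "closed_segment c (-a) \<subseteq> {z. Im z < 0}"
        using R d by (intro closed_segment_subset convex_halfspace_Im_gt convex_halfspace_Im_lt convex_halfspace_Re_lt;
            simp add: a_def b_def c_def)+
      then show False using that z imP by auto
    qed
    have Aim: "norm z = R \<and> Re z \<ge> 0" if "z \<in> path_image A" for z
    proof -
      from that obtain x where x: "-pi/2 \<le> x" "x \<le> pi/2" "z = R * exp (\<i> * of_real x)"
        by (auto simp: path_image_part_circlepath A_def)
      have "cos x \<ge> 0" using x by (intro cos_ge_zero) auto
      then show ?thesis using R x by (simp add: norm_mult Re_exp)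
    qed
    have A'im: "norm z = R \<and> Re z \<le> 0 \<and> (Re z = 0 \<longrightarrow> Im z \<noteq> 0)" if "z \<in> path_image A'" for z
    proof -
      from that obtain x where x: "pi/2 \<le> x" "x \<le> 3*pi/2" "z = R * exp (\<i> * of_real x)"
        by (auto simp: path_image_part_circlepath A'_def)
      have "cos (x - pi) \<ge> 0" using x by (intro cos_ge_zero) auto
      then have "cos x \<le> 0" by (simp add: cos_diff)
      moreover have "sin x \<noteq> 0" if "cos x = 0"
        using that sin_cos_squared_add[of x] by auto
      ultimately show ?thesis using R x by (simp add: norm_mult Re_exp Im_exp mult_le_0_iff)
    qed
    have AW: "path_image A \<subseteq> W"
    proof
      fix z assume "z \<in> path_image A"
      then have "norm z = R" "Re z \<ge> 0" using Aim by auto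
      then show "z \<in> W" using abs_Im_le_cmod[of z] d by (auto simp: W_def)
    qed
    have vA': "valid_path A'" "pathstart A' = \<i> * R" "pathfinish A' = -\<i> * R"
    proof -
      have "exp (\<i> * of_real (3*pi/2)) = -\<i>"
      proof -
        have "cis (pi + pi/2) = -\<i>" by (simp only: cis_mult[symmetric]) simp
        moreover have "3*pi/2 = pi + pi/2" by simp
        ultimately show ?thesis by (simp only: cis_conv_exp)
      qed
      moreover have "exp (\<i> * of_real (pi/2)) = \<i>"
        using cis_conv_exp[of "pi/2"] by simp
      ultimately show "valid_path A'" "pathstart A' = \<i> * R" "pathfinish A' = -\<i> * R"
        unfolding A'_def by (simp_all add: field_simps)
    qed
    have A'neg: "-z \<notin> \<real>\<^sub>\<le>\<^sub>0" if "z \<in> path_image A'" for z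
      using A'im[OF that] by (auto simp: complex_nonpos_Reals_iff)
    define k where "k = (\<lambda>z::complex. 1 + z\<^sup>2 / (of_real R)\<^sup>2)"
    define hg where "hg = (\<lambda>N z. g z * of_nat N powr z * k z)"
    define hS where "hS = (\<lambda>N z. S N z * of_nat N powr z * k z)"
    have hol_hg: "hg N holomorphic_on W" and hol_hS: "hS N holomorphic_on UNIV" if "N > 0" for N
      using that R unfolding hg_def hS_def k_def
      by (auto intro!: holomorphic_intros holomorphic_on_subset[OF g WU] holomorphic_on_subset[OF S])
    have I1: "contour_integral A (\<lambda>z. hg N z / z) + contour_integral P (\<lambda>z. hg N z / z) = 2 * pi * \<i> * g 0"
      if N: "N > 0" for N
      using D_contour_formula[OF R W hol_hg[OF N] vP PW Pneg] AW N by (simp add: A_def hg_def k_def)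
    have I2: "contour_integral A (\<lambda>z. hS N z / z) + contour_integral A' (\<lambda>z. hS N z / z) = 2 * pi * \<i> * S N 0"
      if N: "N > 0" for N
      using D_contour_formula[OF R convex_UNIV open_UNIV UNIV_I hol_hS[OF N] vA' _ A'neg] N
      by (simp add: A_def hS_def k_def)
    have Pint: "contour_integral P (\<lambda>z. hg N z / z) = contour_integral (linepath a b) (\<lambda>z. (g z * k z / z) * of_nat N powr z)
       + (contour_integral (linepath b c) (\<lambda>z. (g z * k z / z) * of_nat N powr z)
       + contour_integral (linepath c (-a)) (\<lambda>z. (g z * k z / z) * of_nat N powr z))"
      if N: "N > 0" for N
    proof -
      have eq: "(\<lambda>z. hg N z / z) = (\<lambda>z. (g z * k z / z) * of_nat N powr z)"
        by (auto simp: hg_def)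
      have no0: "0 \<notin> path_image P" using Pneg[of 0] by auto
      have co: "continuous_on (path_image P) (\<lambda>z. hg N z / z)"
        using hol_hg[OF N] PW no0
        by (intro continuous_intros) (auto intro: holomorphic_on_imp_continuous_on holomorphic_on_subset)
      have ci: "(\<lambda>z. hg N z / z) contour_integrable_on linepath a b" "(\<lambda>z. hg N z / z) contour_integrable_on linepath b c"
          "(\<lambda>z. hg N z / z) contour_integrable_on linepath c (-a)"
        by (rule contour_integrable_continuous_linepath; rule continuous_on_subset[OF co]; use imP in auto)+
      show ?thesis unfolding P_def eq[symmetric] using ci
        by (subst contour_integral_join, (auto intro!: contour_integrable_joinI valid_path_join)[4])+ auto
    qed
    have Plim: "(\<lambda>N. contour_integral P (\<lambda>z. hg N z / z)) \<longlonglongrightarrow> 0"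
    proof -
      have no0: "0 \<notin> path_image P" using Pneg[of 0] by auto
      have "continuous_on (path_image P) (\<lambda>z. g z * k z / z)"
        using PW no0 WU R holomorphic_on_imp_continuous_on[OF g] unfolding k_def
        by (intro continuous_intros) (auto intro: continuous_on_subset)
      then have co: "continuous_on (closed_segment a b) (\<lambda>z. g z * k z / z)"
          "continuous_on (closed_segment b c) (\<lambda>z. g z * k z / z)"
          "continuous_on (closed_segment c (-a)) (\<lambda>z. g z * k z / z)"
        using imP by (auto intro: continuous_on_subset)
      have "(\<lambda>N. contour_integral (linepath a b) (\<lambda>z. (g z * k z / z) * of_nat N powr z)
       + (contour_integral (linepath b c) (\<lambda>z. (g z * k z / z) * of_nat N powr z)
       + contour_integral (linepath c (-a)) (\<lambda>z. (g z * k z / z) * of_nat N powr z))) \<longlonglongrightarrow> 0 + (0 + 0)"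
        using d by (intro tendsto_add contour_integral_linepath_powr_tendsto_0 co) (auto simp: a_def b_def c_def)
      then show ?thesis unfolding add_0_left
        by (rule Lim_transform_eventually)
          (auto intro!: eventually_mono[OF eventually_gt_at_top[of 0]] simp: Pint)
    qed
    have ev: "\<forall>\<^sub>F N in sequentially. norm (contour_integral P (\<lambda>z. hg N z / z)) < 2 * pi * e"
      using tendstoD[OF Plim, of "2 * pi * e"] e by (simp add: dist_norm)
    show ?thesis
      using ev eventually_gt_at_top[of 0]
    proof eventually_elim
      case (elim N)
      note N = \<open>0 < N\<close>
      have no0A: "0 \<notin> path_image A" and no0A': "0 \<notin> path_image A'" using Aim A'im R by force+
      have np: "norm (of_nat N powr z :: complex) = real N powr Re z" for z
        using norm_powr_real_powr[of "of_nat N" z] N by simp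
      have kz: "norm (k z / z) = 2 * \<bar>Re z\<bar> / R\<^sup>2" if "norm z = R" for z
        unfolding k_def newman_kernel_eq[OF that R] by (simp only: norm_of_real) (simp add: abs_mult)
      have coAg: "continuous_on (path_image A) (\<lambda>z. hg N z / z)"
        using hol_hg[OF N] AW no0A
        by (intro continuous_intros) (auto intro: holomorphic_on_imp_continuous_on holomorphic_on_subset)
      have coAS: "continuous_on (path_image A) (\<lambda>z. hS N z / z)"
        using hol_hS[OF N] no0A
        by (intro continuous_intros) (auto intro: holomorphic_on_imp_continuous_on holomorphic_on_subset)
      have coAS': "continuous_on (path_image A') (\<lambda>z. hS N z / z)"
        using hol_hS[OF N] no0A'
        by (intro continuous_intros) (auto intro: holomorphic_on_imp_continuous_on holomorphic_on_subset)
      have ci: "(\<lambda>z. hg N z / z) contour_integrable_on A" "(\<lambda>z. hS N z / z) contour_integrable_on A"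
          "(\<lambda>z. hS N z / z) contour_integrable_on A'"
        using coAg coAS coAS' unfolding A_def A'_def
        by (blast intro: contour_integrable_continuous_part_circlepath)+
      have b1: "norm (contour_integral A (\<lambda>z. hg N z / z - hS N z / z)) \<le> (2 * B / R\<^sup>2) * R * (pi/2 - (-pi/2))"
        unfolding A_def
      proof (rule has_contour_integral_bound_part_circlepath[OF has_contour_integral_integral])
        show "(\<lambda>z. hg N z / z - hS N z / z) contour_integrable_on part_circlepath 0 R (- pi / 2) (pi / 2)"
          using ci contour_integrable_diff unfolding A_def by blast
        fix z assume "z \<in> path_image (part_circlepath 0 R (- pi / 2) (pi / 2))"
        then have z: "norm z = R" "Re z \<ge> 0" using Aim by (auto simp: A_def)
        have "norm (hg N z / z - hS N z / z) = norm (g z - S N z) * norm (of_nat N powr z :: complex) * norm (k z / z)"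
          unfolding norm_mult[symmetric]
          by (rule arg_cong[where f = norm]) (simp add: hg_def hS_def algebra_simps diff_divide_distrib)
        also have "\<dots> \<le> 2 * B / R\<^sup>2"
        proof (cases "Re z = 0")
          case True
          then show ?thesis using z B by (simp add: kz)
        next
          case False
          then have "norm (g z - S N z) * norm (of_nat N powr z :: complex) * norm (k z / z)
            \<le> (B * real N powr (-Re z) / Re z) * real N powr Re z * (2 * Re z / R\<^sup>2)"
            using z N B unfolding np kz[OF z(1)] by (intro mult_mono right) auto
          also have "\<dots> = 2 * B / R\<^sup>2"
            using False N z by (simp add: powr_minus field_simps)
          finally show ?thesis .
        qed
        finally show "norm (hg N z / z - hS N z / z) \<le> 2 * B / R\<^sup>2" .
      qed (use R B in auto)
      have b2: "norm (contour_integral A' (\<lambda>z. hS N z / z)) \<le> (2 * B / R\<^sup>2) * R * (3*pi/2 - pi/2)"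
        unfolding A'_def
      proof (rule has_contour_integral_bound_part_circlepath[OF has_contour_integral_integral])
        show "(\<lambda>z. hS N z / z) contour_integrable_on part_circlepath 0 R (pi / 2) (3 * pi / 2)"
          using ci unfolding A'_def by blast
        fix z assume "z \<in> path_image (part_circlepath 0 R (pi / 2) (3 * pi / 2))"
        then have z: "norm z = R" "Re z \<le> 0" using A'im by (auto simp: A'_def)
        have "norm (hS N z / z) = norm (S N z) * norm (of_nat N powr z :: complex) * norm (k z / z)"
          unfolding norm_mult[symmetric] by (rule arg_cong[where f = norm]) (simp add: hS_def)
        also have "\<dots> \<le> 2 * B / R\<^sup>2"
        proof (cases "Re z = 0")
          case True
          then show ?thesis using z B by (simp add: kz)
        next
          case False
          then have "norm (S N z) * norm (of_nat N powr z :: complex) * norm (k z / z)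
            \<le> (B * real N powr (-Re z) / (-Re z)) * real N powr Re z * (2 * (-Re z) / R\<^sup>2)"
            using z N B unfolding np kz[OF z(1)]
            by (intro mult_mono left)
               (auto simp: divide_le_0_iff mult_nonneg_nonneg)
          also have "\<dots> = 2 * B / R\<^sup>2"
            using False N z by (simp add: powr_minus field_simps)
          finally show ?thesis .
        qed
        finally show "norm (hS N z / z) \<le> 2 * B / R\<^sup>2" .
      qed (use R B in auto)
      have "2 * pi * \<i> * (S N 0 - g 0) = contour_integral A' (\<lambda>z. hS N z / z)
         - contour_integral A (\<lambda>z. hg N z / z - hS N z / z) - contour_integral P (\<lambda>z. hg N z / z)"
        unfolding right_diff_distrib I1[OF N, symmetric] I2[OF N, symmetric] contour_integral_diff[OF ci(1,2)]
        by simp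
      then have "norm (2 * pi * \<i> * (S N 0 - g 0)) \<le> (2 * B / R\<^sup>2) * R * (3*pi/2 - pi/2) +
          (2 * B / R\<^sup>2) * R * (pi/2 - (-pi/2)) + 2 * pi * e"
        using b1 b2 elim(1) norm_triangle_ineq4 by (smt (verit))
      also have "\<dots> = 2 * pi * (2 * B / R + e)"
        using R by (simp add: field_simps power2_eq_square)
      finally have "2 * pi * norm (S N 0 - g 0) \<le> 2 * pi * (2 * B / R + e)"
        by (simp add: norm_mult)
      then show ?case by simp
    qed
  qed
  show ?thesis
  proof (rule tendstoI)
    fix e :: real assume e: "e > 0"
    \<comment> \<open>This makes 2 B / R less than e / 2; the summand 1 keeps R positive when B =
      0.\<close>
    define R where "R = 4 * (B + 1) / e"
    have R: "R > 0" using B e by (simp add: R_def)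
    have "2 * B / R < e / 2 + e/4" using B e by (simp add: R_def field_simps add_pos_nonneg)
    then show "\<forall>\<^sub>F N in sequentially. dist (S N 0) (g 0) < e"
      using key[OF R, of "e/4"] e by (auto elim!: eventually_mono simp: dist_norm)
  qed
qed

section \<open>Chebyshev bounds and Tauberian theorems\<close>

lemma ln_fact_eq_sum_mangoldt:
  "ln (fact n) = (\<Sum>d=1..n. mangoldt d * real (n div d))"
proof (induction n)
  case (Suc n)
  have div: "real (Suc n div d) = real (n div d) + (if d dvd Suc n then 1 else 0)" for d
    by (simp add: div_Suc dvd_eq_mod_eq_0)
  have "(\<Sum>d=1..Suc n. mangoldt d * real (Suc n div d))
      = (\<Sum>d=1..Suc n. mangoldt d * real (n div d)) + (\<Sum>d=1..Suc n. if d dvd Suc n then mangoldt d else 0)"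
    unfolding div sum.distrib[symmetric] by (intro sum.cong) (auto simp: algebra_simps)
  also have "(\<Sum>d=1..Suc n. if d dvd Suc n then mangoldt d else 0) = (\<Sum>d | d dvd Suc n. mangoldt d :: real)"
    by (subst sum.inter_filter[symmetric]) (auto intro!: sum.cong Nat.gr0I dest: dvd_imp_le simp: Suc_le_eq)
  also have "\<dots> = ln (real (Suc n))" by (subst mangoldt_sum) auto
  also have "(\<Sum>d=1..Suc n. mangoldt d * real (n div d)) = ln (fact n)" using Suc by simp
  finally show ?case by (simp add: ln_mult)
qed simp

definition cheb_psi :: "nat \<Rightarrow> real" where "cheb_psi n = (\<Sum>k=1..n. mangoldt k)"

text \<open>In ln of the central binomial coefficient, \<open>mangoldt d\<close> has the coefficient
  \<open>2 * n div d - 2 * (n div d)\<close>. It is never negative and at least 1 for n < d \<le> 2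
  n, and the binomial coefficient is at most 4^n.\<close>

lemma cheb_psi_double: "cheb_psi (2 * n) \<le> cheb_psi n + 2 * real n * ln 2"
proof -
  have ext: "ln (fact n) = (\<Sum>d=1..2*n. mangoldt d * real (n div d))"
    unfolding ln_fact_eq_sum_mangoldt by (rule sum.mono_neutral_left) auto
  have "cheb_psi (2 * n) - cheb_psi n = (\<Sum>d=1..2*n. if d > n then mangoldt d else 0)"
  proof -
    have "{1..2*n} = {1..n} \<union> {n<..2*n}" by auto
    then have "cheb_psi (2 * n) = cheb_psi n + (\<Sum>d\<in>{n<..2*n}. mangoldt d)"
      unfolding cheb_psi_def by (metis sum.union_disjoint finite_atLeastAtMost finite_greaterThanAtMost ivl_disj_int_two(8))
    also have "(\<Sum>d\<in>{n<..2*n}. mangoldt d) = (\<Sum>d=1..2*n. if d > n then mangoldt d else (0::real))"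
      by (subst sum.inter_filter[symmetric]) (auto intro!: sum.cong)
    finally show ?thesis by simp
  qed
  also have "\<dots> \<le> (\<Sum>d=1..2*n. mangoldt d * (real (2 * n div d) - 2 * real (n div d)))"
  proof (rule sum_mono)
    fix d assume d: "d \<in> {1..2*n}"
    have "2 * (n div d) \<le> 2 * n div d"
      using d by (simp add: less_eq_div_iff_mult_less_eq)
    then have "2 * real (n div d) \<le> real (2 * n div d)" by (metis of_nat_le_iff of_nat_mult of_nat_numeral)
    moreover have "1 \<le> real (2 * n div d)" "n div d = 0" if "d > n"
    proof -
      have "0 < 2 * n div d" using d by (simp add: div_greater_zero_iff)
      then show "1 \<le> real (2 * n div d)" by linarith
    qed (use that in simp)
    ultimately have k: "(if d > n then 1 else 0) \<le> real (2 * n div d) - 2 * real (n div d)" by auto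
    have "(if d > n then mangoldt d else 0) = mangoldt d * (if d > n then 1 else (0::real))" by simp
    also have "\<dots> \<le> mangoldt d * (real (2 * n div d) - 2 * real (n div d))"
      using k mangoldt_nonneg by (rule mult_left_mono)
    finally show "(if d > n then mangoldt d else 0) \<le> mangoldt d * (real (2 * n div d) - 2 * real (n div d))" .
  qed
  also have "\<dots> = ln (fact (2 * n)) - 2 * ln (fact n)"
    unfolding ln_fact_eq_sum_mangoldt[of "2 * n"] ext by (simp add: right_diff_distrib sum_subtractf sum_distrib_left mult_ac)
  also have "\<dots> = ln (real (2 * n choose n))"
  proof -
    have "fact n * fact (2 * n - n) * (2 * n choose n) = fact (2 * n)" by (rule binomial_fact_lemma) simp
    then have "fact n * fact n * real (2 * n choose n) = fact (2 * n)"
      by (metis (no_types, lifting) diff_add_inverse mult_2 of_nat_fact of_nat_mult)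
    then have "ln (fact (2 * n)) = ln (fact n * fact n * real (2 * n choose n))" by simp
    also have "\<dots> = ln (fact n) + ln (fact n) + ln (real (2 * n choose n))"
      using zero_less_binomial[of n "2 * n"] by (simp add: ln_mult)
    finally show ?thesis by simp
  qed
  also have "\<dots> \<le> ln (2 ^ (2 * n))"
  proof -
    have "real (2 * n choose n) \<le> real (2 ^ (2 * n))" unfolding of_nat_le_iff by (rule binomial_le_pow2)
    moreover have "0 < real (2 * n choose n)" using zero_less_binomial[of n "2 * n"] by simp
    ultimately show ?thesis by (subst ln_le_cancel_iff) simp_all
  qed
  also have "\<dots> = 2 * real n * ln 2" by (simp add: ln_realpow)
  finally show ?thesis by simp
qed

text \<open>Halving, with ln 2 \<le> 1, turns the bound 4 k for k into 6 k for 2 k. The surplus up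
  to 8 k absorbs the extra term for n = 2 k + 1, which is at most ln n \<le> 2 k.\<close>

lemma cheb_psi_le: "cheb_psi n \<le> 4 * real n"
proof (induction n rule: less_induct)
  case (less n)
  have ln2: "ln 2 \<le> (1::real)" using ln_le_minus_one[of "2::real"] by simp
  show ?case
  proof (cases "n \<le> 1")
    case True
    then consider "n = 0" | "n = 1" by linarith
    then show ?thesis by cases (simp_all add: cheb_psi_def)
  next
    case False
    define k where "k = n div 2"
    have k: "k < n" using False by (simp add: k_def)
    have "2 * real k * ln 2 \<le> 2 * real k * 1" using ln2 by (intro mult_left_mono) auto
    then have k2: "cheb_psi (2 * k) \<le> 6 * real k" using cheb_psi_double[of k] less.IH[OF k] by linarith
    show ?thesis
    proof (cases "even n")
      case True
      then have "n = 2 * k" by (simp add: k_def)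
      then show ?thesis using k2 by simp
    next
      case False
      then have n: "n = Suc (2 * k)" by (simp add: k_def)
      have "mangoldt n \<le> ln (real n)" using n by (intro mangoldt_le_ln) simp
      also have "\<dots> \<le> real n - 1" using ln_le_minus_one[of "real n"] n by simp
      finally have "mangoldt n \<le> 2 * real k" using n by simp
      moreover have "cheb_psi n = cheb_psi (2 * k) + mangoldt n" unfolding n cheb_psi_def by simp
      ultimately show ?thesis using k2 n by simp
    qed
  qed
qed

section \<open>Partial sums as truncated Laplace transforms\<close>

text \<open>The weight of the \<open>n\<close>-th partial sum \<open>E n\<close> in the integral of \<open>E \<lfloor>t\<rfloor> * t powr (-2 - z)\<close>,
  which is the Dirichlet series at \<open>1 + z\<close> divided by \<open>1 + z\<close>.\<close>

definition laplace_weight :: "nat \<Rightarrow> complex \<Rightarrow> complex" where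
  "laplace_weight n z = integral {real n..real n + 1} (\<lambda>t. of_real t powr (-2 - z))"

lemma laplace_weight_integral:
  fixes z :: complex
  assumes n: "n > 0"
  shows "((\<lambda>t. (1 + z) * of_real t powr (-2 - z)) has_integral
           (of_nat n powr (-1 - z) - of_nat (Suc n) powr (-1 - z))) {real n..real n + 1}"
proof -
  have "((\<lambda>t. (1 + z) * of_real t powr (-2 - z)) has_integral
      (- (of_real (real n + 1) powr (-1 - z)) - - (of_real (real n) powr (-1 - z)))) {real n..real n + 1}"
  proof (rule fundamental_theorem_of_calculus)
    fix t assume t: "t \<in> {real n..real n + 1}"
    have "of_real t \<notin> \<real>\<^sub>\<le>\<^sub>0" using t n by (simp add: complex_nonpos_Reals_iff)
    then have "((\<lambda>w. - (w powr (-1 - z))) has_field_derivative - ((-1 - z) * of_real t powr (-1 - z - 1))) (at (of_real t))"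
      by (intro DERIV_minus has_field_derivative_powr)
    moreover have "-1 - z - 1 = -2 - z" by simp
    moreover have "- ((-1 - z) * w) = (1 + z) * w" for w by (simp add: algebra_simps)
    ultimately have "((\<lambda>w. - (w powr (-1 - z))) has_field_derivative (1 + z) * of_real t powr (-2 - z)) (at (of_real t))"
      by (simp only:)
    then show "((\<lambda>t. - (of_real t powr (-1 - z))) has_vector_derivative (1 + z) * of_real t powr (-2 - z)) (at t within {real n..real n + 1})"
      by (rule has_vector_derivative_real_field)
  qed simp
  then show ?thesis by (simp add: add.commute)
qed

lemma laplace_weight_integrable:
  assumes n: "n > 0"
  shows "(\<lambda>t. complex_of_real t powr (-2 - z)) integrable_on {real n..real n + 1}"
  using n by (intro integrable_continuous_real continuous_intros) (auto simp: complex_nonpos_Reals_iff)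

lemma laplace_weight_eq:
  assumes n: "n > 0"
  shows "(1 + z) * laplace_weight n z = of_nat n powr (-1 - z) - of_nat (Suc n) powr (-1 - z)"
proof -
  show ?thesis
    using integral_unique[OF laplace_weight_integral[OF n, of z]]
    unfolding laplace_weight_def by simp
qed

text \<open>The factor n stands for the size of the n-th partial sum. Under the integral it is at
  most t, which raises the exponent to -1 - Re z and produces a bound that telescopes in n, for
  either sign of Re z.\<close>

lemma laplace_weight_bound:
  assumes n: "n > 0" and x: "Re z \<noteq> 0"
  shows "real n * norm (laplace_weight n z) \<le> (real n powr (-Re z) - real (Suc n) powr (-Re z)) / Re z"
proof -
  let ?x = "Re z" and ?I = "{real n..real n + 1}"
  have int: "((\<lambda>t. t powr (-1 - ?x)) has_integral
      (- ((real n + 1) powr (-?x) / ?x) - - (real n powr (-?x) / ?x))) ?I"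
  proof (rule fundamental_theorem_of_calculus)
    fix t assume t: "t \<in> ?I"
    have "((\<lambda>t. - (t powr (-?x) / ?x)) has_real_derivative t powr (-1 - ?x)) (at t)"
      using t n x by (auto intro!: derivative_eq_intros simp: minus_diff_commute)
    then show "((\<lambda>t. - (t powr (-?x) / ?x)) has_vector_derivative t powr (-1 - ?x)) (at t within ?I)"
      by (simp add: has_real_derivative_iff_has_vector_derivative[symmetric] has_field_derivative_at_within)
  qed simp
  have "real n * norm (laplace_weight n z) = norm (integral ?I (\<lambda>t. of_nat n * of_real t powr (-2 - z)))"
    unfolding laplace_weight_def integral_mult_right by (simp add: norm_mult)
  also have "\<dots> \<le> integral ?I (\<lambda>t. t powr (-1 - ?x))"
  proof (rule Henstock_Kurzweil_Integration.integral_norm_bound_integral)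
    show "(\<lambda>t. of_nat n * complex_of_real t powr (-2 - z)) integrable_on ?I"
      using integrable_on_mult_right[OF laplace_weight_integrable[OF n]] .
    show "(\<lambda>t. t powr (-1 - ?x)) integrable_on ?I" using int by blast
    fix t assume t: "t \<in> ?I"
    have "norm (of_nat n * complex_of_real t powr (-2 - z)) = real n * t powr (-2 - ?x)"
      using t n norm_powr_real_powr[of "complex_of_real t" "-2 - z"] by (simp add: norm_mult)
    also have "\<dots> \<le> t * t powr (-2 - ?x)" using t by (intro mult_right_mono) auto
    also have "\<dots> = t powr (-1 - ?x)" using t n powr_mult_base[of t "-2 - ?x"] by simp
    finally show "norm (of_nat n * complex_of_real t powr (-2 - z)) \<le> t powr (-1 - ?x)" .
  qed
  also have "\<dots> = (real n powr (-?x) - real (Suc n) powr (-?x)) / ?x"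
    using integral_unique[OF int] by (simp add: diff_divide_distrib add.commute)
  finally show ?thesis .
qed

text \<open>Dividing \<open>laplace_weight_eq\<close> by 1 + z would suggest a singularity at -1.
  The integral form shows that there is none, so the finite sums of weights are entire, as Newman's
  left semicircle requires.\<close>

lemma laplace_weight_holomorphic:
  assumes n: "n > 0"
  shows "laplace_weight n holomorphic_on UNIV"
proof -
  have "(\<lambda>z. integral (cbox (real n) (real n + 1)) (\<lambda>t. of_real t powr (-2 - z))) holomorphic_on UNIV"
  proof (rule leibniz_rule_holomorphic)
    fix z :: complex and t assume t: "t \<in> cbox (real n) (real n + 1)"
    have "((\<lambda>z. of_real t powr (-2 - z)) has_field_derivative (Ln (of_real t) * of_real t powr (-2 - z) * (-1))) (at z)"
      using t n by (intro DERIV_chain2[OF has_field_derivative_powr_right]) (auto intro!: derivative_eq_intros)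
    then show "((\<lambda>z. of_real t powr (-2 - z)) has_field_derivative - (Ln (of_real t) * of_real t powr (-2 - z))) (at z within UNIV)"
      by simp
  next
    show "(\<lambda>t. complex_of_real t powr (-2 - z)) integrable_on cbox (real n) (real n + 1)" for z
      using laplace_weight_integrable[OF n, of z] by simp
  next
    show "continuous_on (UNIV \<times> cbox (real n) (real n + 1)) (\<lambda>(z, t). - (Ln (complex_of_real t) * of_real t powr (-2 - z)))"
      unfolding case_prod_unfold using n
      by (intro continuous_intros) (auto simp: complex_nonpos_Reals_iff)
  qed simp
  then show ?thesis by (simp add: laplace_weight_def[abs_def])
qed

text \<open>\<open>S N z\<close> is the integral of E (floor t) t^(-2-z) from 1 to N. For Re z > 0,
  summation by parts shows that it converges to the Dirichlet series at 1 + z divided by 1 + z.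
  Since E is O(n), the telescoping bounds control both the tail and the sum itself in the form
  required by \<open>newman_tauberian\<close>, and at z = 0 the weights are 1 / n - 1 / (n +
  1).\<close>

theorem tauberian_partial_sums:
  fixes u :: "nat \<Rightarrow> real"
  defines "E \<equiv> (\<lambda>n. \<Sum>k=1..n. u k)"
  assumes u: "\<And>n. n > 0 \<Longrightarrow> \<bar>u n\<bar> \<le> 1 + ln (real n)" and E: "\<And>n. \<bar>E n\<bar> \<le> B * real n"
    and U: "open U" "{s. 1 \<le> Re s} \<subseteq> U" and Q: "Q holomorphic_on U" "\<And>s. Re s > 1 \<Longrightarrow> dser (\<lambda>n. of_real (u n)) s = Q s"
  shows "convergent (\<lambda>N. \<Sum>n=1..<N. E n * (1 / real n - 1 / real (Suc n)))"
proof -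
  define S where "S = (\<lambda>N z. \<Sum>n=1..<N. of_real (E n) * laplace_weight n z)"
  define g where "g = (\<lambda>z. Q (1 + z) / (1 + z))"
  \<comment> \<open>Re z > -1 keeps z away from the zero of the denominator 1 + z of g.\<close>
  let ?V = "{z. 1 + z \<in> U} \<inter> {z. Re z > -1}"
  have B: "B \<ge> 0" using E[of 1] abs_ge_zero[of "E 1"] by linarith
  have term_bound: "norm (of_real (E n) * laplace_weight n z) \<le> B * ((real n powr (-Re z) - real (Suc n) powr (-Re z)) / Re z)"
    if "n > 0" "Re z \<noteq> 0" for n z
  proof -
    have "norm (of_real (E n) * laplace_weight n z) \<le> (B * real n) * norm (laplace_weight n z)"
      unfolding norm_mult norm_of_real using E[of n] by (intro mult_right_mono) auto
    also have "\<dots> \<le> B * ((real n powr (-Re z) - real (Suc n) powr (-Re z)) / Re z)"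
      unfolding mult.assoc using laplace_weight_bound[OF that] B by (rule mult_left_mono)
    finally show ?thesis .
  qed
  have tail: "norm (S M z - S N z) \<le> B * ((real N powr (-Re z) - real M powr (-Re z)) / Re z)"
    if "0 < N" "N \<le> M" "Re z \<noteq> 0" for M N z
  proof -
    have "S M z - S N z = (\<Sum>n=N..<M. of_real (E n) * laplace_weight n z)"
      unfolding S_def using that sum_diff_nat_ivl[of 1 N M] by simp
    also have "norm \<dots> \<le> (\<Sum>n=N..<M. B * ((real n powr (-Re z) - real (Suc n) powr (-Re z)) / Re z))"
      using that by (intro sum_norm_le term_bound) auto
    also have "\<dots> = B * ((real N powr (-Re z) - real M powr (-Re z)) / Re z)"
      using that(2) by (induction M rule: dec_induct) (simp_all add: diff_divide_distrib right_diff_distrib)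
    finally show ?thesis .
  qed
  have lim: "(\<lambda>M. S (Suc M) z) \<longlonglongrightarrow> g z" if z: "Re z > 0" for z
  proof -
    let ?t = "\<lambda>n. of_real (u n) * of_nat n powr (- (1 + z))"
    have "1 + z \<noteq> 0" using z by (auto simp: complex_eq_iff)
    have abel: "(1 + z) * S (Suc M) z = (\<Sum>n<Suc M. ?t n) - of_real (E M) * of_nat (Suc M) powr (- (1 + z))" for M
    proof (induction M)
      case 0
      then show ?case by (simp add: S_def E_def)
    next
      case (Suc M)
      have "(1 + z) * S (Suc (Suc M)) z = (1 + z) * S (Suc M) z + of_real (E (Suc M)) * ((1 + z) * laplace_weight (Suc M) z)"
        by (simp add: S_def algebra_simps)
      also have "(1 + z) * laplace_weight (Suc M) z = of_nat (Suc M) powr (- (1 + z)) - of_nat (Suc (Suc M)) powr (- (1 + z))"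
        using laplace_weight_eq[of "Suc M" z] by simp
      finally have eq: "(1 + z) * S (Suc (Suc M)) z = (1 + z) * S (Suc M) z
          + of_real (E (Suc M)) * (of_nat (Suc M) powr (- (1 + z)) - of_nat (Suc (Suc M)) powr (- (1 + z)))" .
      have ES: "E (Suc M) = E M + u (Suc M)" by (simp add: E_def)
      show ?case unfolding eq Suc ES sum.lessThan_Suc[of _ "Suc M"] of_real_add by (simp only: algebra_simps)
    qed
    have "(\<lambda>M. \<Sum>n<Suc M. ?t n) \<longlonglongrightarrow> Q (1 + z)"
    proof -
      have "norm (complex_of_real (u n)) \<le> 1 + ln (real n)" if "n > 0" for n using u[OF that] by simp
      from dser_sums[OF this, of "1 + z"] have "?t sums Q (1 + z)" using z Q(2)[of "1 + z"] by simp
      then show ?thesis unfolding sums_def by (rule LIMSEQ_Suc)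
    qed
    moreover have "(\<lambda>M. of_real (E M) * of_nat (Suc M) powr (- (1 + z)) :: complex) \<longlonglongrightarrow> 0"
    proof (rule Lim_null_comparison)
      have "norm (of_real (E M) * of_nat (Suc M) powr (- (1 + z)) :: complex) \<le> B * real (Suc M) powr (- Re z)" for M
      proof -
        have "norm (of_real (E M) * of_nat (Suc M) powr (- (1 + z)) :: complex) = \<bar>E M\<bar> * real (Suc M) powr (- 1 - Re z)"
          by (simp only: norm_mult norm_nat_powr norm_of_real) simp
        also have "\<dots> \<le> (B * real (Suc M)) * real (Suc M) powr (- 1 - Re z)"
          using E[of M] B by (intro mult_right_mono) (auto intro: order_trans simp: algebra_simps)
        also have "\<dots> = B * real (Suc M) powr (- Re z)"
          using powr_mult_base[of "real (Suc M)" "- 1 - Re z"] by simp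
        finally show ?thesis .
      qed
      then show "\<forall>\<^sub>F M in sequentially. norm (of_real (E M) * of_nat (Suc M) powr (- (1 + z)) :: complex) \<le> B * real (Suc M) powr (- Re z)"
        by (intro always_eventually allI)
      have "(\<lambda>M. real (Suc M) powr (- Re z)) \<longlonglongrightarrow> 0"
        using z by (intro tendsto_neg_powr filterlim_compose[OF filterlim_real_sequentially filterlim_Suc]) auto
      then show "(\<lambda>M. B * real (Suc M) powr (- Re z)) \<longlonglongrightarrow> 0"
        by (rule tendsto_mult_right_zero)
    qed
    ultimately have "(\<lambda>M. (1 + z) * S (Suc M) z) \<longlonglongrightarrow> Q (1 + z) - 0"
      unfolding abel by (rule tendsto_diff)
    then have "(\<lambda>M. (1 + z) * S (Suc M) z / (1 + z)) \<longlonglongrightarrow> (Q (1 + z) - 0) / (1 + z)"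
      using \<open>1 + z \<noteq> 0\<close> by (intro tendsto_divide tendsto_const)
    then show ?thesis using \<open>1 + z \<noteq> 0\<close> by (simp add: g_def)
  qed
  have "(\<lambda>N. S N 0) \<longlonglongrightarrow> g 0"
  proof (rule newman_tauberian[OF _ _ _ _ B])
    have "open ((\<lambda>z. 1 + z) -` U)" by (rule open_vimage[OF U(1)]) (intro continuous_intros)
    then show "open ?V" by (intro open_Int open_halfspace_Re_gt) (simp add: vimage_def)
    show "{z. 0 \<le> Re z} \<subseteq> ?V" using U(2) by auto
    have "1 + z \<noteq> 0" if "Re z > -1" for z :: complex using that by (auto simp: complex_eq_iff)
    moreover have "(\<lambda>z. Q (1 + z)) holomorphic_on ?V"
    proof -
      have "(\<lambda>z. 1 + z) holomorphic_on ?V" by (intro holomorphic_intros)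
      moreover have "(\<lambda>z. 1 + z) ` ?V \<subseteq> U" by auto
      ultimately show ?thesis
        using holomorphic_on_compose_gen[of "\<lambda>z. 1 + z" ?V Q U] Q(1) unfolding o_def by blast
    qed
    ultimately show "g holomorphic_on ?V" unfolding g_def by (intro holomorphic_intros) auto
    show "S N holomorphic_on UNIV" for N
      unfolding S_def by (intro holomorphic_intros laplace_weight_holomorphic) auto
    show "norm (g z - S N z) \<le> B * real N powr - Re z / Re z" if N: "0 < N" and z: "0 < Re z" for N z
    proof -
      have "(\<lambda>M. norm (S (Suc M) z - S N z)) \<longlonglongrightarrow> norm (g z - S N z)"
        by (intro tendsto_norm tendsto_diff lim z tendsto_const)
      then show ?thesis
      proof (rule tendsto_upperbound)
        show "\<forall>\<^sub>F M in sequentially. norm (S (Suc M) z - S N z) \<le> B * real N powr - Re z / Re z"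
          using eventually_ge_at_top[of N]
        proof eventually_elim
          case (elim M)
          have "norm (S (Suc M) z - S N z) \<le> B * ((real N powr (-Re z) - real (Suc M) powr (-Re z)) / Re z)"
            using elim N z by (intro tail) auto
          also have "\<dots> \<le> B * (real N powr (-Re z) / Re z)"
            using z B by (intro mult_left_mono divide_right_mono) auto
          finally show ?case by simp
        qed
      qed simp
    qed
    show "norm (S N z) \<le> B * real N powr - Re z / - Re z" if N: "0 < N" and z: "Re z < 0" for N z
    proof -
      have "S 1 z = 0" by (simp add: S_def)
      then have "norm (S N z) \<le> B * ((1 - real N powr (-Re z)) / Re z)"
        using tail[of 1 N z] N z by simp
      also have "\<dots> = B * ((real N powr (-Re z) - 1) / - Re z)" using z by (simp add: field_simps)
      also have "\<dots> \<le> B * (real N powr (-Re z) / - Re z)"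
        using z B by (intro mult_left_mono divide_right_mono) auto
      finally show ?thesis by simp
    qed
  qed
  moreover have "S N 0 = of_real (\<Sum>n=1..<N. E n * (1 / real n - 1 / real (Suc n)))" for N
  proof -
    have "laplace_weight n 0 = of_real (1 / real n - 1 / real (Suc n))" if "n > 0" for n
      using laplace_weight_eq[OF that, of 0] that by (simp add: powr_minus divide_inverse)
    then show ?thesis unfolding S_def by simp
  qed
  ultimately have "(\<lambda>N. complex_of_real (\<Sum>n=1..<N. E n * (1 / real n - 1 / real (Suc n)))) \<longlonglongrightarrow> g 0" by (simp only:)
  from tendsto_Re[OF this] show ?thesis unfolding convergent_def by auto
qed

text \<open>If \<open>p N\<close> exceeds \<open>(c + \<epsilon>) N\<close>, monotonicity keeps \<open>p n - c n\<close> of size \<open>\<epsilon> N\<close> on an interval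
  of length proportional to \<open>N\<close>, whose contribution to the series is bounded below.\<close>

theorem monotone_tauberian:
  fixes p :: "nat \<Rightarrow> real"
  assumes p: "mono p" and c: "c \<ge> 0"
    and conv: "convergent (\<lambda>N. \<Sum>n=1..<N. (p n - c * real n) * (1 / real n - 1 / real (Suc n)))"
  shows "(\<lambda>n. p n / real n) \<longlonglongrightarrow> c"
proof -
  define T where "T = (\<lambda>N. \<Sum>n=1..<N. (p n - c * real n) * (1 / real n - 1 / real (Suc n)))"
  have "Cauchy T" using conv unfolding T_def by (rule convergent_Cauchy)
  then have cauchy: "\<exists>N0. \<forall>M\<ge>N0. \<forall>N\<ge>N0. \<bar>T M - T N\<bar> < \<delta>" if "\<delta> > 0" for \<delta>
    using that unfolding Cauchy_def dist_real_def by blast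
  have Tdiff: "T M - T N = (\<Sum>n=N..<M. (p n - c * real n) * (1 / real n - 1 / real (Suc n)))" if "1 \<le> N" "N \<le> M" for M N
    unfolding T_def using that sum_diff_nat_ivl[of 1 N M] by simp
  have tele: "(\<Sum>n=N..<M. k * (1 / real n - 1 / real (Suc n))) = k * (1 / real N - 1 / real M)" if "N \<le> M" for k N M
    using that by (induction M rule: dec_induct) (simp_all add: right_diff_distrib)
  have w: "1 / real n - 1 / real (Suc n) \<ge> 0" if "n \<ge> 1" for n using that by (simp add: field_simps)
  have upper: "\<forall>\<^sub>F N in sequentially. p N < (c + \<epsilon>) * real N" if e: "\<epsilon> > 0" for \<epsilon>
  proof -
    \<comment> \<open>Up to (1 + \<eta>) N the term c n grows by at most half of the excess
      \<epsilon> N. The block then contributes at least \<delta>, defined below, independently of N,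
      which contradicts the Cauchy property.\<close>
    define \<eta> where "\<eta> = \<epsilon> / (2 * (c + 1))"
    have \<eta>: "\<eta> > 0" "c * \<eta> \<le> \<epsilon> / 2" using e c by (auto simp: \<eta>_def field_simps)
    define \<delta> where "\<delta> = (\<epsilon> / 2) * (1 - 1 / (1 + \<eta>))"
    have "\<delta> > 0" using e \<eta> by (simp add: \<delta>_def field_simps)
    then obtain N0 where N0: "\<And>M N. M \<ge> N0 \<Longrightarrow> N \<ge> N0 \<Longrightarrow> \<bar>T M - T N\<bar> < \<delta>" using cauchy by blast
    show ?thesis using eventually_ge_at_top[of "max N0 1"]
    proof eventually_elim
      case (elim N)
      show ?case
      proof (rule ccontr)
        assume "\<not> p N < (c + \<epsilon>) * real N"
        then have big: "(c + \<epsilon>) * real N \<le> p N" by simp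
        define M where "M = nat \<lceil>(1 + \<eta>) * real N\<rceil>"
        have M: "(1 + \<eta>) * real N \<le> real M" unfolding M_def by linarith
        have MN: "N \<le> M"
        proof -
          have "real N \<le> (1 + \<eta>) * real N" using \<eta> by (simp add: algebra_simps)
          with M show ?thesis by linarith
        qed
        have "(\<epsilon> / 2 * real N) * (1 / real N - 1 / real M) = (\<Sum>n=N..<M. (\<epsilon> / 2 * real N) * (1 / real n - 1 / real (Suc n)))"
          by (rule tele[OF MN, symmetric])
        also have "\<dots> \<le> (\<Sum>n=N..<M. (p n - c * real n) * (1 / real n - 1 / real (Suc n)))"
        proof (rule sum_mono)
          fix n assume n: "n \<in> {N..<M}"
          have "real n < (1 + \<eta>) * real N" using n unfolding M_def by (simp add: less_ceiling_iff zless_nat_eq_int_zless)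
          then have "c * real n \<le> c * ((1 + \<eta>) * real N)" using c by (intro mult_left_mono) auto
          also have "\<dots> = c * real N + c * \<eta> * real N" by (simp add: algebra_simps)
          also have "\<dots> \<le> c * real N + \<epsilon> / 2 * real N" using \<eta>(2) by (intro add_left_mono mult_right_mono) auto
          finally have "c * real n \<le> c * real N + \<epsilon> / 2 * real N" .
          moreover have "p N \<le> p n" using n p by (auto simp: mono_def)
          ultimately have "\<epsilon> / 2 * real N \<le> p n - c * real n" using big by (simp add: algebra_simps)
          then show "(\<epsilon> / 2 * real N) * (1 / real n - 1 / real (Suc n)) \<le> (p n - c * real n) * (1 / real n - 1 / real (Suc n))"
            using w[of n] n elim by (intro mult_right_mono) auto
        qed
        also have "\<dots> = T M - T N" using Tdiff MN elim by simp
        also have "\<dots> < \<delta>" using N0[of M N] MN elim by (simp add: abs_less_iff)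
        finally have lt: "(\<epsilon> / 2 * real N) * (1 / real N - 1 / real M) < \<delta>" .
        have N1: "real N > 0" using elim by simp
        have "real N / real M \<le> real N / ((1 + \<eta>) * real N)"
          using M N1 \<eta> MN by (intro divide_left_mono) (auto intro!: mult_pos_pos)
        then have "real N / real M \<le> 1 / (1 + \<eta>)" using N1 by simp
        then have "\<delta> \<le> \<epsilon> / 2 * (1 - real N / real M)" unfolding \<delta>_def using e by (intro mult_left_mono) auto
        also have "\<dots> = (\<epsilon> / 2 * real N) * (1 / real N - 1 / real M)" using N1 by (simp add: right_diff_distrib)
        finally show False using lt by simp
      qed
    qed
  qed
  have lower: "\<forall>\<^sub>F N in sequentially. (c - \<epsilon>) * real N < p N" if e: "\<epsilon> > 0" for \<epsilon>
  proof -
    \<comment> \<open>The cap 1/2 keeps the start M of the block at N / 2 or later, hence beyond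
      \<open>N0\<close>.\<close>
    define \<eta> where "\<eta> = min (1 / 2) (\<epsilon> / (2 * (c + 1)))"
    have \<eta>: "\<eta> > 0" using e c by (simp add: \<eta>_def)
    have \<eta>2: "\<eta> \<le> 1 / 2" unfolding \<eta>_def by (rule min.cobounded1)
    note \<eta> = \<eta> \<eta>2
    have "c * \<eta> \<le> c * (\<epsilon> / (2 * (c + 1)))" using c by (intro mult_left_mono) (auto simp: \<eta>_def)
    also have "\<dots> \<le> \<epsilon> / 2" using e c by (simp add: field_simps)
    finally have \<eta>c: "c * \<eta> \<le> \<epsilon> / 2" .
    \<comment> \<open>Here \<eta> / 2 replaces \<eta> because M is rounded up: the rounding error 1
      is at most \<eta> N / 2 once N \<ge> 2 / \<eta>.\<close>
    define \<delta> where "\<delta> = (\<epsilon> / 2) * (1 / (1 - \<eta> / 2) - 1)"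
    have "\<delta> > 0" using e \<eta> by (simp add: \<delta>_def field_simps)
    then obtain N0 where N0: "\<And>M N. M \<ge> N0 \<Longrightarrow> N \<ge> N0 \<Longrightarrow> \<bar>T M - T N\<bar> < \<delta>" using cauchy by blast
    show ?thesis using eventually_ge_at_top[of "2 * N0 + 2"] eventually_ge_at_top[of "nat \<lceil>2 / \<eta>\<rceil>"]
    proof eventually_elim
      case (elim N)
      show ?case
      proof (rule ccontr)
        assume "\<not> (c - \<epsilon>) * real N < p N"
        then have small: "p N \<le> (c - \<epsilon>) * real N" by simp
        define M where "M = nat \<lceil>(1 - \<eta>) * real N\<rceil>"
        have M: "(1 - \<eta>) * real N \<le> real M" unfolding M_def by linarith
        have pos: "(1 - \<eta>) * real N \<ge> 0" using \<eta> by simp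
        have M': "real M \<le> (1 - \<eta>) * real N + 1" unfolding M_def using pos by linarith
        have "2 / \<eta> \<le> real N" using elim(2) by linarith
        then have "1 \<le> \<eta> / 2 * real N" using \<eta> by (simp add: field_simps)
        then have M2: "real M \<le> (1 - \<eta> / 2) * real N" using M' by (simp add: algebra_simps)
        have MN: "M \<le> N"
        proof -
          have "(1 - \<eta> / 2) * real N \<le> 1 * real N" using \<eta> by (intro mult_right_mono) auto
          with M2 show ?thesis by linarith
        qed
        have "1 / 2 * real N \<le> (1 - \<eta>) * real N" using \<eta> by (intro mult_right_mono) auto
        then have "real N / 2 \<le> real M" using M by simp
        then have M0: "M \<ge> N0" "M \<ge> 1" using elim(1) by linarith+
        have N1: "real N > 0" "real M > 0" using elim M0 by auto
        have "T N - T M = (\<Sum>n=M..<N. (p n - c * real n) * (1 / real n - 1 / real (Suc n)))"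
          using Tdiff MN M0 by simp
        also have "\<dots> \<le> (\<Sum>n=M..<N. (- (\<epsilon> / 2 * real N)) * (1 / real n - 1 / real (Suc n)))"
        proof (rule sum_mono)
          fix n assume n: "n \<in> {M..<N}"
          have "(1 - \<eta>) * real N \<le> real n" using M n by simp
          then have "c * ((1 - \<eta>) * real N) \<le> c * real n" using c by (intro mult_left_mono) auto
          moreover have "c * \<eta> * real N \<le> \<epsilon> / 2 * real N" using \<eta>c by (intro mult_right_mono) auto
          moreover have "p n \<le> p N" using n p by (auto simp: mono_def)
          ultimately have "p n - c * real n \<le> - (\<epsilon> / 2 * real N)" using small by (simp add: algebra_simps)
          then show "(p n - c * real n) * (1 / real n - 1 / real (Suc n)) \<le> (- (\<epsilon> / 2 * real N)) * (1 / real n - 1 / real (Suc n))"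
            using w[of n] n M0 by (intro mult_right_mono) auto
        qed
        also have "\<dots> = - (\<epsilon> / 2 * real N) * (1 / real M - 1 / real N)" by (rule tele[OF MN])
        also have "\<dots> = - (\<epsilon> / 2 * real N * (1 / real M - 1 / real N))" by (rule mult_minus_left)
        finally have "\<epsilon> / 2 * real N * (1 / real M - 1 / real N) \<le> T M - T N" by (simp only: minus_diff_eq[of "T N", symmetric] le_minus_iff)
        also have "\<dots> < \<delta>" using N0[of M N] MN M0 by (simp add: abs_less_iff)
        finally have lt: "\<epsilon> / 2 * real N * (1 / real M - 1 / real N) < \<delta>" .
        have "real N / ((1 - \<eta> / 2) * real N) \<le> real N / real M"
          using M2 N1 \<eta> by (intro divide_left_mono) (auto intro!: mult_pos_pos)
        then have "1 / (1 - \<eta> / 2) \<le> real N / real M" using N1 by simp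
        then have "\<delta> \<le> \<epsilon> / 2 * (real N / real M - 1)" unfolding \<delta>_def using e by (intro mult_left_mono) auto
        also have "\<dots> = \<epsilon> / 2 * real N * (1 / real M - 1 / real N)" using N1 by (simp add: right_diff_distrib)
        finally show False using lt by simp
      qed
    qed
  qed
  show ?thesis
  proof (rule tendstoI)
    fix e :: real assume e: "e > 0"
    show "\<forall>\<^sub>F n in sequentially. dist (p n / real n) c < e"
      using upper[OF e] lower[OF e] eventually_gt_at_top[of 0]
    proof eventually_elim
      case (elim n)
      then have "p n / real n < c + e" "c - e < p n / real n" by (simp_all add: field_simps)
      then show ?case by (simp add: dist_real_def abs_less_iff)
    qed
  qed
qed

section \<open>Primes in arithmetic progressions\<close>

definition psi_ap :: "nat \<Rightarrow> nat \<Rightarrow> nat \<Rightarrow> real" where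
  "psi_ap a r n = (\<Sum>k=1..n. if [k = r] (mod a) then mangoldt k else 0)"

lemma psi_ap_nonneg: "0 \<le> psi_ap a r n"
  unfolding psi_ap_def by (intro sum_nonneg) (simp add: mangoldt_nonneg)

lemma psi_ap_le: "psi_ap a r n \<le> 4 * real n"
proof -
  have "psi_ap a r n \<le> cheb_psi n"
    unfolding psi_ap_def cheb_psi_def by (intro sum_mono) (simp add: mangoldt_nonneg)
  with cheb_psi_le[of n] show ?thesis by linarith
qed

lemma mono_psi_ap: "mono (psi_ap a r)"
  unfolding psi_ap_def by (intro monoI sum_mono2) (auto simp: mangoldt_nonneg)

text \<open>The constant sequence has period 1 and mean 1, so its series has residue 1 at s = 1. It
  supplies the pole to be subtracted from the series of a residue class.\<close>

lemma zeta_extension: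
  obtains Z where "Z holomorphic_on {s. Re s > 0}" "\<And>s. Re s > 1 \<Longrightarrow> dser (\<lambda>_. 1) s = 1 / (s - 1) + Z s"
proof -
  obtain G where G: "G holomorphic_on {s. Re s > 0}" "\<And>s. Re s > 1 \<Longrightarrow> G s = (s - 1) * dser (\<lambda>_. 1) s"
    "G 1 = (\<Sum>n<1::nat. 1) / of_nat 1"
    by (rule dser_continuation[of 1 "\<lambda>_. 1"]) (simp, simp, simp, rule that, assumption+)
  define Z where "Z = (\<lambda>s. if s = 1 then deriv G 1 else (G s - G 1) / (s - 1))"
  have Z: "Z holomorphic_on {s. Re s > 0}" unfolding Z_def by (rule pole_lemma_open[OF G(1) open_halfspace_Re_gt])
  have "dser (\<lambda>_. 1) s = 1 / (s - 1) + Z s" if "Re s > 1" for s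
  proof -
    have "s - 1 \<noteq> 0" using that by auto
    then show ?thesis using G(2)[OF that] G(3) by (simp add: Z_def field_simps)
  qed
  with Z show ?thesis using that by blast
qed

lemma sum_cnj_pole_order:
  assumes a: "a > 0" and r: "coprime r a"
  shows "(\<Sum>X\<in>dchars a. cnj (X r) * of_nat (pole_order a X)) = 1"
proof -
  have "(\<Sum>X\<in>dchars a. cnj (X r) * of_nat (pole_order a X)) = (\<Sum>X\<in>dchars a. if X = princ a then cnj (princ a r) else 0)"
    by (intro sum.cong) (auto simp: pole_order_def[OF a])
  also have "\<dots> = cnj (princ a r)"
    using finite_dchars[OF a] princ_in_dchars by (simp add: sum.delta)
  finally show ?thesis using r by (simp add: princ_def)
qed

text \<open>Orthogonality writes the series of the residue class as a combination of the
  \<open>von_mangoldt_series X\<close>. Only the principal character contributes a pole, with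
  residue 1 / \<phi>(a), and the constant subtracted in u cancels it.\<close>

lemma arithmetic_progression_series_extension:
  assumes a: "a > 0" and r: "coprime r a"
  defines "u \<equiv> \<lambda>n. (if [n = r] (mod a) then mangoldt n else 0) - 1 / real (totient a)"
  shows "\<exists>U Q. open U \<and> {s. 1 \<le> Re s} \<subseteq> U \<and> Q holomorphic_on U \<and>
    (\<forall>s. Re s > 1 \<longrightarrow> dser (\<lambda>n. of_real (u n)) s = Q s)"
proof -
  define c :: complex where "c = 1 / of_nat (totient a)"
  have phi: "totient a > 0" using a by (simp add: totient_gt_0_iff)
  have "\<forall>X\<in>dchars a. \<exists>p. open (fst p) \<and> {s. 1 \<le> Re s} \<subseteq> fst p \<and> snd p holomorphic_on fst p \<and>
    (\<forall>s. Re s > 1 \<longrightarrow> von_mangoldt_series X s = of_nat (pole_order a X) / (s - 1) + snd p s)"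
    using von_mangoldt_series_extension[OF a] by simp
  from bchoice[OF this] obtain p where p: "\<And>X. X \<in> dchars a \<Longrightarrow> open (fst (p X))"
    "\<And>X. X \<in> dchars a \<Longrightarrow> {s. 1 \<le> Re s} \<subseteq> fst (p X)"
    "\<And>X. X \<in> dchars a \<Longrightarrow> snd (p X) holomorphic_on fst (p X)"
    "\<And>X s. X \<in> dchars a \<Longrightarrow> Re s > 1 \<Longrightarrow> von_mangoldt_series X s = of_nat (pole_order a X) / (s - 1) + snd (p X) s"
    by metis
  obtain Z where Z: "Z holomorphic_on {s. Re s > 0}" "\<And>s. Re s > 1 \<Longrightarrow> dser (\<lambda>_. 1) s = 1 / (s - 1) + Z s"
    using zeta_extension by blast
  let ?U = "(\<Inter>X\<in>dchars a. fst (p X)) \<inter> {s. Re s > 0}"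
  define Q where "Q = (\<lambda>s. (\<Sum>X\<in>dchars a. c * cnj (X r) * snd (p X) s) - c * Z s)"
  have "open ?U" using finite_dchars[OF a] p(1) by (intro open_Int open_INT open_halfspace_Re_gt) auto
  moreover have "{s. 1 \<le> Re s} \<subseteq> ?U"
  proof
    fix s :: complex assume s: "s \<in> {s. 1 \<le> Re s}"
    then have "s \<in> fst (p X)" if "X \<in> dchars a" for X using p(2)[OF that] by blast
    with s show "s \<in> ?U" by simp
  qed
  moreover have "Q holomorphic_on ?U"
    unfolding Q_def
    by (intro holomorphic_intros holomorphic_on_subset[OF p(3)] holomorphic_on_subset[OF Z(1)]) auto
  moreover have "dser (\<lambda>n. of_real (u n)) s = Q s" if s: "Re s > 1" for s
  proof -
    have "norm (1::complex) \<le> 1 + ln (real n)" if "n > 0" for n using that by simp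
    from dser_sums[of "\<lambda>_. 1", OF this s] have one: "(\<lambda>n. 1 * of_nat n powr (-s)) sums dser (\<lambda>_. 1) s" .
    have "(\<lambda>n. (\<Sum>X\<in>dchars a. c * cnj (X r) * (mangoldt n * X n * of_nat n powr (-s))) - c * (1 * of_nat n powr (-s)))
      sums ((\<Sum>X\<in>dchars a. c * cnj (X r) * von_mangoldt_series X s) - c * dser (\<lambda>_. 1) s)"
      unfolding von_mangoldt_series_def
      by (intro sums_diff sums_sum sums_mult one dser_sums[OF dchar_coeff(2)[OF a] s])
    moreover have "(\<Sum>X\<in>dchars a. c * cnj (X r) * (mangoldt n * X n * of_nat n powr (-s))) - c * (1 * of_nat n powr (-s))
        = of_real (u n) * of_nat n powr (-s)" for n
    proof -
      have "(\<Sum>X\<in>dchars a. c * cnj (X r) * (mangoldt n * X n * of_nat n powr (-s)))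
          = c * (mangoldt n * of_nat n powr (-s)) * (\<Sum>X\<in>dchars a. cnj (X r) * X n)"
        unfolding sum_distrib_left by (intro sum.cong) (auto simp: mult_ac)
      also have "\<dots> = (if [n = r] (mod a) then mangoldt n else 0) * of_nat n powr (-s)"
        unfolding dchars_orthogonality[OF a r] using phi by (simp add: c_def)
      finally show ?thesis by (simp add: u_def c_def algebra_simps)
    qed
    ultimately have "dser (\<lambda>n. of_real (u n)) s = (\<Sum>X\<in>dchars a. c * cnj (X r) * von_mangoldt_series X s) - c * dser (\<lambda>_. 1) s"
      by (simp add: dser_def sums_iff)
    also have "(\<Sum>X\<in>dchars a. c * cnj (X r) * von_mangoldt_series X s)
        = c / (s - 1) * (\<Sum>X\<in>dchars a. cnj (X r) * of_nat (pole_order a X)) + (\<Sum>X\<in>dchars a. c * cnj (X r) * snd (p X) s)"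
      unfolding sum_distrib_left sum.distrib[symmetric]
      by (intro sum.cong refl) (simp add: p(4)[OF _ s] distrib_left)
    finally show ?thesis
      unfolding sum_cnj_pole_order[OF a r] Z(2)[OF s] by (simp add: Q_def algebra_simps)
  qed
  ultimately show ?thesis by blast
qed

theorem prime_number_theorem_arithmetic_progression:
  assumes a: "a > 0" and r: "coprime r a"
  shows "(\<lambda>n. psi_ap a r n / real n) \<longlonglongrightarrow> 1 / real (totient a)"
proof -
  define c where "c = 1 / real (totient a)"
  have "totient a > 0" using a by (simp add: totient_gt_0_iff)
  then have c: "0 \<le> c" "c \<le> 1" by (auto simp: c_def Suc_le_eq)
  define u where "u = (\<lambda>n. (if [n = r] (mod a) then mangoldt n else 0) - c)"
  have E: "(\<Sum>k=1..n. u k) = psi_ap a r n - c * real n" for n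
    by (simp add: u_def psi_ap_def sum_subtractf)
  have "convergent (\<lambda>N. \<Sum>n=1..<N. (\<Sum>k=1..n. u k) * (1 / real n - 1 / real (Suc n)))"
  proof -
    obtain U Q where UQ: "open U" "{s. 1 \<le> Re s} \<subseteq> U" "Q holomorphic_on U"
      "\<And>s. Re s > 1 \<Longrightarrow> dser (\<lambda>n. of_real (u n)) s = Q s"
      using arithmetic_progression_series_extension[OF a r] unfolding u_def c_def by blast
    show ?thesis
    proof (rule tauberian_partial_sums[OF _ _ UQ])
      show "\<bar>u n\<bar> \<le> 1 + ln (real n)" if "n > 0" for n
        using mangoldt_le_ln[OF that] mangoldt_nonneg[of n] c that by (auto simp: u_def abs_le_iff)
      \<comment> \<open>5 adds the Chebyshev constant 4 and the bound c \<le> 1.\<close>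
      show "\<bar>\<Sum>k=1..n. u k\<bar> \<le> 5 * real n" for n
      proof -
        have "c * real n \<le> 1 * real n" using c by (intro mult_right_mono) auto
        moreover have "0 \<le> c * real n" using c by simp
        ultimately show ?thesis
          unfolding E abs_le_iff using psi_ap_nonneg[of a r n] psi_ap_le[of a r n] by linarith
      qed
    qed
  qed
  then have "(\<lambda>n. psi_ap a r n / real n) \<longlonglongrightarrow> c"
    unfolding E by (rule monotone_tauberian[OF mono_psi_ap c(1)])
  then show ?thesis by (simp add: c_def)
qed

section \<open>Least common multiples\<close>

text \<open>The exponent of p in the lcm is the larger of two exponents, so one of the numbers
  attains it. With two different primes in d this fails: 6 divides the lcm of 2 and 3.\<close>

lemma primepow_dvd_lcm:
  fixes x y :: nat
  assumes "primepow d" "x \<noteq> 0" "y \<noteq> 0" "d dvd lcm x y"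
  shows "d dvd x \<or> d dvd y"
proof -
  obtain p k where p: "prime p" "d = p ^ k" using assms(1) by (auto simp: primepow_def)
  have p1: "\<not> is_unit p" using p(1) not_prime_unit by blast
  have "k \<le> multiplicity p (lcm x y)"
    using assms p p1 by (simp add: power_dvd_iff_le_multiplicity lcm_eq_0_iff)
  also have "multiplicity p (lcm x y) = max (multiplicity p x) (multiplicity p y)"
    using assms p by (simp add: multiplicity_lcm prime_imp_prime_elem)
  finally have "k \<le> multiplicity p x \<or> k \<le> multiplicity p y" by linarith
  then show ?thesis unfolding p(2) by (auto intro: multiplicity_dvd')
qed

lemma primepow_dvd_Lcm_iff:
  fixes S :: "nat set"
  assumes S: "finite S" "0 \<notin> S" and d: "primepow d"
  shows "d dvd Lcm S \<longleftrightarrow> (\<exists>x\<in>S. d dvd x)"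
  using S
proof (induction S rule: finite_induct)
  case empty
  then show ?case using d by (auto simp: primepow_def prime_power_eq_one_iff)
next
  case (insert x S)
  have "Lcm S \<noteq> 0" using insert by (simp add: Lcm_0_iff)
  then have "d dvd lcm x (Lcm S) \<longleftrightarrow> d dvd x \<or> d dvd Lcm S"
    using primepow_dvd_lcm[OF d, of x "Lcm S"] insert.prems by (auto intro: dvd_lcmI1 dvd_lcmI2)
  with insert show ?case by simp
qed

text \<open>The von Mangoldt function lives on prime powers, and a prime power divides the lcm only
  if it divides some member of S.\<close>

lemma ln_Lcm_eq_sum_mangoldt:
  fixes S :: "nat set"
  assumes S: "finite S" "0 \<notin> S"
  shows "ln (real (Lcm S)) = (\<Sum>d | \<exists>x\<in>S. d dvd x. mangoldt d)"
proof -
  have L: "Lcm S \<noteq> 0" using S by (simp add: Lcm_0_iff)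
  have "ln (real (Lcm S)) = (\<Sum>d | d dvd Lcm S. mangoldt d)" using mangoldt_sum[OF L, where ?'a = real] by simp
  also have "\<dots> = (\<Sum>d | \<exists>x\<in>S. d dvd x. mangoldt d)"
  proof (rule sum.mono_neutral_right)
    show "finite {d. d dvd Lcm S}" using L by simp
    show "{d. \<exists>x\<in>S. d dvd x} \<subseteq> {d. d dvd Lcm S}" by (auto intro: dvd_trans dvd_Lcm)
    show "\<forall>d\<in>{d. d dvd Lcm S} - {d. \<exists>x\<in>S. d dvd x}. mangoldt d = (0::real)"
      using primepow_dvd_Lcm_iff[OF S] by (auto simp: mangoldt_def)
  qed
  finally show ?thesis .
qed

section \<open>Sums of the von Mangoldt function over unions of intervals\<close>

definition ap_psi :: "nat \<Rightarrow> nat \<Rightarrow> real \<Rightarrow> real" where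
  "ap_psi a s x = psi_ap a s (nat \<lfloor>x\<rfloor>)"

lemma sum_mangoldt_interval:
  assumes "x \<le> y" "0 \<le> x"
  shows "(\<Sum>d | [d = s] (mod a) \<and> x < real d \<and> real d \<le> y. mangoldt d) = ap_psi a s y - ap_psi a s x"
proof -
  have cut: "ap_psi a s z = (\<Sum>d\<in>{d. [d = s] (mod a) \<and> 0 < d \<and> real d \<le> z}. mangoldt d)" if "z \<ge> 0" for z
  proof -
    have "{d. [d = s] (mod a) \<and> 0 < d \<and> real d \<le> z} = {d\<in>{1..nat \<lfloor>z\<rfloor>}. [d = s] (mod a)}"
      using that by (auto simp: le_nat_floor le_nat_iff le_floor_iff)
    then show ?thesis unfolding ap_psi_def psi_ap_def by (simp only: sum.inter_filter finite_atLeastAtMost)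
  qed
  have fin: "finite {d. P d \<and> real d \<le> y}" for P
    by (rule finite_subset[of _ "{..nat \<lceil>y\<rceil>}"]) (auto, linarith)
  let ?X = "{d. [d = s] (mod a) \<and> 0 < d \<and> real d \<le> x}"
    and ?Y = "{d. [d = s] (mod a) \<and> x < real d \<and> real d \<le> y}"
  have "{d. [d = s] (mod a) \<and> 0 < d \<and> real d \<le> y} = ?X \<union> ?Y"
    using assms by auto
  moreover have "finite ?X"
    by (rule finite_subset[OF _ fin[of "\<lambda>_. True"]]) (use assms in auto)
  moreover have "finite ?Y"
    by (rule finite_subset[OF _ fin[of "\<lambda>_. True"]]) auto
  moreover have "?X \<inter> ?Y = {}" by auto
  ultimately have "(\<Sum>d\<in>{d. [d = s] (mod a) \<and> 0 < d \<and> real d \<le> y}. mangoldt d) = (\<Sum>d\<in>?X. mangoldt d) + (\<Sum>d\<in>?Y. mangoldt d :: real)"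
    by (simp only: sum.union_disjoint)
  then show ?thesis using cut[OF assms(2)] cut[of y] assms by simp
qed

lemma ap_psi_asymptotic:
  assumes a: "a > 0" and s: "coprime s a" and y: "(\<lambda>n. y n / real n) \<longlonglongrightarrow> \<alpha>" and \<alpha>: "\<alpha> > 0"
  shows "(\<lambda>n. ap_psi a s (y n) / real n) \<longlonglongrightarrow> \<alpha> / real (totient a)"
proof -
  define N where "N = (\<lambda>n. nat \<lfloor>y n\<rfloor>)"
  have y_inf: "filterlim y at_top sequentially"
  proof -
    have "filterlim (\<lambda>n. y n / real n * real n) at_top sequentially"
      by (rule filterlim_tendsto_pos_mult_at_top[OF y \<alpha> filterlim_real_sequentially])
    then show ?thesis
      by (rule iffD1[OF filterlim_cong[OF refl refl eventually_mono[OF eventually_gt_at_top[of 0]]], rotated]) simp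
  qed
  have Ny: "\<bar>real (N n) - y n\<bar> \<le> 1" if "y n \<ge> 0" for n
    using that unfolding N_def by linarith
  have ev: "\<forall>\<^sub>F n in sequentially. y n \<ge> 0" using y_inf by (simp add: filterlim_at_top)
  have N_lim: "(\<lambda>n. real (N n) / real n) \<longlonglongrightarrow> \<alpha>"
  proof -
    have "(\<lambda>n. (real (N n) - y n) / real n) \<longlonglongrightarrow> 0"
    proof (rule Lim_null_comparison)
      show "\<forall>\<^sub>F n in sequentially. norm ((real (N n) - y n) / real n) \<le> 1 / real n"
        using ev eventually_gt_at_top[of 0]
        by eventually_elim (use Ny in \<open>auto simp: divide_right_mono\<close>)
      show "(\<lambda>n. 1 / real n) \<longlonglongrightarrow> 0" by (rule lim_1_over_n)
    qed
    from tendsto_add[OF this y] show ?thesis by (simp add: diff_divide_distrib)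
  qed
  have N_inf: "filterlim N at_top sequentially"
  proof -
    have "filterlim (\<lambda>n. real (N n)) at_top sequentially"
    proof -
      have "filterlim (\<lambda>n. real (N n) / real n * real n) at_top sequentially"
        by (rule filterlim_tendsto_pos_mult_at_top[OF N_lim \<alpha> filterlim_real_sequentially])
      then show ?thesis
        by (rule iffD1[OF filterlim_cong[OF refl refl eventually_mono[OF eventually_gt_at_top[of 0]]], rotated]) simp
    qed
    then show ?thesis by (simp add: filterlim_sequentially_iff_filterlim_real)
  qed
  have "(\<lambda>n. psi_ap a s (N n) / real (N n)) \<longlonglongrightarrow> 1 / real (totient a)"
    by (rule filterlim_compose[OF prime_number_theorem_arithmetic_progression[OF a s] N_inf])
  from tendsto_mult[OF this N_lim]
  have "(\<lambda>n. psi_ap a s (N n) / real (N n) * (real (N n) / real n)) \<longlonglongrightarrow> \<alpha> / real (totient a)" by simp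
  then show ?thesis
  proof (rule Lim_transform_eventually)
    have "\<forall>\<^sub>F n in sequentially. N n > 0" using N_inf[unfolded filterlim_at_top, rule_format, of 1]
      by (rule eventually_mono) simp
    then show "\<forall>\<^sub>F n in sequentially. psi_ap a s (N n) / real (N n) * (real (N n) / real n) = ap_psi a s (y n) / real n"
    proof eventually_elim
      case (elim n)
      moreover have "nat \<lfloor>y n\<rfloor> = N n" by (simp add: N_def)
      ultimately show ?case by (simp add: ap_psi_def)
    qed
  qed
qed

text \<open>The intervals \<open>(u / q i, v / q i]\<close> need not be disjoint. Assigning each \<open>d\<close> to the largest
  admissible \<open>i\<close> cuts the \<open>i\<close>-th one down to \<open>(max (u / q i) (v / q (i + 1)), v / q i]\<close>, and from
  the index \<open>k\<close> on, where consecutive intervals overlap, the union is a full initial segment.\<close>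

lemma sum_mangoldt_interval_union:
  fixes q :: "nat \<Rightarrow> real" and u v :: real
  assumes q: "strict_mono q" "\<And>i. q i > 0" "filterlim q at_top sequentially"
    and uv: "0 \<le> v" "u \<le> v" and overlap: "\<And>i. i \<ge> k \<Longrightarrow> u / q i \<le> v / q (Suc i)"
  shows "(\<Sum>d | [d = s] (mod a) \<and> 0 < d \<and> (\<exists>i. u < real d * q i \<and> real d * q i \<le> v). mangoldt d)
    = (\<Sum>i<k. ap_psi a s (v / q i) - ap_psi a s (max (u / q i) (v / q (Suc i)))) + ap_psi a s (v / q k)"
proof -
  \<comment> \<open>\<open>T j\<close> collects the d with an admissible index at least j, and
    \<open>B j\<close> those whose largest admissible index is j.\<close>
  define T where "T = (\<lambda>j. {d. [d = s] (mod a) \<and> 0 < d \<and> (\<exists>i\<ge>j. u < real d * q i \<and> real d * q i \<le> v)})"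
  define B where "B = (\<lambda>j. {d. [d = s] (mod a) \<and> max (u / q j) (v / q (Suc j)) < real d \<and> real d \<le> v / q j})"
  have qle: "q i \<le> q j" if "i \<le> j" for i j using q(1) that by (simp add: strict_mono_less_eq)
  have fin_le: "finite {d. real d \<le> y}" for y
    by (rule finite_subset[of _ "{..nat \<lceil>y\<rceil>}"]) (auto, linarith)
  have finT: "finite (T j)" for j
  proof (rule finite_subset[OF _ fin_le[of "v / q 0"]], rule subsetI)
    fix d assume "d \<in> T j"
    then obtain i where i: "real d * q i \<le> v" by (auto simp: T_def)
    have "real d * q 0 \<le> real d * q i" using qle[of 0 i] by (intro mult_left_mono) auto
    with i show "d \<in> {d. real d \<le> v / q 0}" using q(2)[of 0] by (simp add: pos_le_divide_eq)
  qed
  have finB: "finite (B j)" for j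
    by (rule finite_subset[OF _ fin_le[of "v / q j"]]) (auto simp: B_def)
  have split: "T j = B j \<union> T (Suc j)" for j
  proof (intro equalityI subsetI)
    fix d assume d: "d \<in> T j"
    then obtain i where i: "i \<ge> j" "u < real d * q i" "real d * q i \<le> v" by (auto simp: T_def)
    show "d \<in> B j \<union> T (Suc j)"
    proof (cases "i = j")
      case False
      then show ?thesis using d i by (auto simp: T_def intro!: exI[of _ i])
    next
      case True
      show ?thesis
      proof (cases "real d * q (Suc j) \<le> v")
        case True
        have "real d * q j \<le> real d * q (Suc j)" using qle[of j "Suc j"] by (intro mult_left_mono) auto
        then have "u < real d * q (Suc j)" using i \<open>i = j\<close> by simp
        then show ?thesis using True d by (auto simp: T_def intro!: exI[of _ "Suc j"])
      next
        case False
        then show ?thesis using d i \<open>i = j\<close> q(2)[of j] q(2)[of "Suc j"]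
          by (auto simp: B_def T_def pos_divide_less_eq pos_le_divide_eq)
      qed
    qed
  next
    fix d assume "d \<in> B j \<union> T (Suc j)"
    then show "d \<in> T j"
    proof
      assume d: "d \<in> B j"
      have "0 \<le> v / q (Suc j)" using uv(1) q(2)[of "Suc j"] by simp
      with d have "0 < real d" by (simp add: B_def)
      with d show ?thesis using q(2)[of j]
        by (auto simp: B_def T_def pos_divide_less_eq pos_le_divide_eq intro!: exI[of _ j])
    qed (auto simp: T_def intro: Suc_leD)
  qed
  have disj: "B j \<inter> T (Suc j) = {}" for j
  proof (rule ccontr)
    assume "B j \<inter> T (Suc j) \<noteq> {}"
    then obtain d i where d: "v / q (Suc j) < real d" "i \<ge> Suc j" "real d * q i \<le> v" by (auto simp: B_def T_def)
    have "real d * q (Suc j) \<le> real d * q i" using qle[OF d(2)] by (intro mult_left_mono) auto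
    then show False using d q(2)[of "Suc j"] by (simp add: pos_divide_less_eq)
  qed
  have step: "(\<Sum>d\<in>T j. mangoldt d :: real) = (\<Sum>d\<in>B j. mangoldt d) + (\<Sum>d\<in>T (Suc j). mangoldt d)" for j
    unfolding split[of j] using finB finT disj by (intro sum.union_disjoint) auto
  have peel: "(\<Sum>d\<in>T 0. mangoldt d :: real) = (\<Sum>i<j. \<Sum>d\<in>B i. mangoldt d) + (\<Sum>d\<in>T j. mangoldt d)" for j
  proof (induction j)
    case (Suc j)
    then show ?case using step[of j] by simp
  qed simp
  have Bsum: "(\<Sum>d\<in>B j. mangoldt d) = ap_psi a s (v / q j) - ap_psi a s (max (u / q j) (v / q (Suc j)))" for j
    unfolding B_def
  proof (rule sum_mangoldt_interval)
    have "v / q (Suc j) \<le> v / q j" using q(2) uv(1) qle[of j "Suc j"] by (intro divide_left_mono) auto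
    moreover have "u / q j \<le> v / q j" using q(2)[of j] uv(2) by (intro divide_right_mono) auto
    ultimately show "max (u / q j) (v / q (Suc j)) \<le> v / q j" by simp
    show "0 \<le> max (u / q j) (v / q (Suc j))" using uv(1) q(2)[of "Suc j"] by (simp add: le_max_iff_disj)
  qed
  have Tk: "T k = {d. [d = s] (mod a) \<and> 0 < real d \<and> real d \<le> v / q k}"
  proof (intro equalityI subsetI)
    fix d assume d: "d \<in> T k"
    then obtain i where i: "i \<ge> k" "real d * q i \<le> v" by (auto simp: T_def)
    have "real d * q k \<le> real d * q i" using qle[OF i(1)] by (intro mult_left_mono) auto
    then have "real d * q k \<le> v" using i(2) by linarith
    then show "d \<in> {d. [d = s] (mod a) \<and> 0 < real d \<and> real d \<le> v / q k}"
      using d q(2)[of k] by (auto simp: T_def pos_le_divide_eq)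
  next
    fix d assume "d \<in> {d. [d = s] (mod a) \<and> 0 < real d \<and> real d \<le> v / q k}"
    then have d: "[d = s] (mod a)" "0 < d" "real d * q k \<le> v" using q(2)[of k] by (auto simp: pos_le_divide_eq)
    have "\<exists>i. v < q i \<and> k \<le> i"
      using eventually_conj[OF filterlim_at_top_dense[THEN iffD1, OF q(3), rule_format, of v] eventually_ge_at_top[of k]]
      by (auto dest: eventually_happens)
    then obtain i where i: "v < q i" "k \<le> i" by blast
    have "q i \<le> real d * q i" using d(2) q(2)[of i] by simp
    then have ex: "k \<le> i \<and> v < real d * q i" using i by simp
    \<comment> \<open>The index just before the products first exceed v is admissible: d > v / q m,
      and by the overlap v / q m is at least u / q (m - 1).\<close>
    define m where "m = (LEAST i. k \<le> i \<and> v < real d * q i)"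
    have m: "k \<le> m" "v < real d * q m" using LeastI[of "\<lambda>i. k \<le> i \<and> v < real d * q i", OF ex] by (auto simp: m_def)
    have "m \<noteq> k" using m d by auto
    then obtain j where j: "m = Suc j" "k \<le> j" using m(1) by (cases m) auto
    have "real d * q j \<le> v"
      using not_less_Least[of j "\<lambda>i. k \<le> i \<and> v < real d * q i"] j by (auto simp: m_def[symmetric])
    moreover have "u / q j < real d"
      using overlap[OF j(2)] m(2) q(2)[of "Suc j"] unfolding j(1)
      by (smt (verit) pos_divide_less_eq)
    then have "u < real d * q j" using q(2)[of j] by (simp add: pos_divide_less_eq)
    ultimately show "d \<in> T k" using d j by (auto simp: T_def)
  qed
  have zero: "ap_psi a s 0 = 0" by (simp add: ap_psi_def psi_ap_def)
  have "(\<Sum>d\<in>T k. mangoldt d) = ap_psi a s (v / q k)"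
    unfolding Tk using sum_mangoldt_interval[of 0 "v / q k" s a] uv(1) q(2)[of k] by (simp add: zero)
  moreover have "{d. [d = s] (mod a) \<and> 0 < d \<and> (\<exists>i. u < real d * q i \<and> real d * q i \<le> v)} = T 0"
    by (simp add: T_def)
  ultimately show ?thesis using peel[of k] by (simp add: Bsum)
qed

text \<open>If d q lies in S, then d and q are units modulo a, and the class r of q forces the class
  of d to be bb / r, represented by \<open>s r\<close>. Distinct r give distinct classes of d, so
  the divisors fall into disjoint sets.\<close>

lemma sum_mangoldt_divisors_residue_classes:
  fixes S :: "nat set" and u v :: int
  assumes a: "a > 0" and bb: "coprime bb a" and pos: "0 \<notin> S"
    and S: "S = {x. u < int x \<and> int x \<le> v \<and> [x = bb] (mod a)}"
    and s: "\<And>r. coprime r a \<Longrightarrow> [s r * r = bb] (mod a)"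
  shows "(\<Sum>d | \<exists>x\<in>S. d dvd x. mangoldt d :: real) = (\<Sum>r | r \<in> {1..a} \<and> coprime r a.
     \<Sum>d | [d = s r] (mod a) \<and> 0 < d \<and> (\<exists>i. real_of_int u < real d * real (r + a * i) \<and> real d * real (r + a * i) \<le> real_of_int v). mangoldt d)"
proof -
  define D where "D = (\<lambda>r. {d. [d = s r] (mod a) \<and> 0 < d \<and> (\<exists>i. u < int (d * (r + a * i)) \<and> int (d * (r + a * i)) \<le> v)})"
  let ?R = "{r. r \<in> {1..a} \<and> coprime r a}"
  have finS: "finite S" unfolding S by (rule finite_subset[of _ "{..nat v}"]) auto
  have fin: "finite {d. \<exists>x\<in>S. d dvd x}"
  proof -
    have "{d. \<exists>x\<in>S. d dvd x} = (\<Union>x\<in>S. {d. d dvd x})" by auto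
    moreover have "finite {d. d dvd x}" if "x \<in> S" for x using that pos by (intro finite_divisors_nat) (metis gr0I)
    ultimately show ?thesis using finS by simp
  qed
  have cop: "coprime x a" if "[x = bb] (mod a)" for x
    using cong_imp_coprime[OF cong_sym[OF that] bb] .
  have eq: "{d. \<exists>x\<in>S. d dvd x} = (\<Union>r\<in>?R. D r)"
  proof (intro equalityI subsetI)
    fix d assume "d \<in> {d. \<exists>x\<in>S. d dvd x}"
    then obtain x where x: "x \<in> S" "d dvd x" by blast
    then obtain q where q: "x = d * q" by (elim dvdE)
    have "x > 0" using x pos by (metis gr0I)
    then have dq: "d > 0" "q > 0" using q by auto
    \<comment> \<open>The shift by one puts the residue into {1..a}.\<close>
    define r where "r = (q - 1) mod a + 1"
    define i where "i = (q - 1) div a"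
    have qri: "q = r + a * i" using dq by (simp add: r_def i_def)
    have r: "r \<in> {1..a}" using a by (simp add: r_def Suc_le_eq)
    have xb: "[x = bb] (mod a)" using x by (simp add: S)
    have "coprime (d * q) a" using cop[OF xb] q by simp
    then have "coprime q a" by simp
    moreover have qr: "[q = r] (mod a)"
      using cong_add_lcancel_0_nat[of r "a * i" a] by (simp add: qri cong_0_iff)
    ultimately have cr: "coprime r a" by (metis cong_imp_coprime)
    have "[d * r = d * q] (mod a)" using qr by (intro cong_mult cong_refl) (rule cong_sym)
    then have "[d * r = s r * r] (mod a)" using xb s[OF cr] q by (metis cong_sym cong_trans)
    then have "[d = s r] (mod a)" using cr by (simp add: cong_mult_rcancel_nat)
    moreover have "u < int (d * (r + a * i))" "int (d * (r + a * i)) \<le> v"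
      using x q unfolding qri S by auto
    ultimately show "d \<in> (\<Union>r\<in>?R. D r)" using r cr dq unfolding D_def by blast
  next
    fix d assume "d \<in> (\<Union>r\<in>?R. D r)"
    then obtain r i where r: "coprime r a" "[d = s r] (mod a)" "u < int (d * (r + a * i))" "int (d * (r + a * i)) \<le> v"
      by (auto simp: D_def)
    have "[d * (r + a * i) = s r * r] (mod a)"
      using r(2) cong_add_lcancel_0_nat[of r "a * i" a] by (intro cong_mult) (simp_all add: cong_0_iff)
    then have "[d * (r + a * i) = bb] (mod a)" using s[OF r(1)] by (rule cong_trans)
    then have "d * (r + a * i) \<in> S" using r by (simp add: S)
    then show "d \<in> {d. \<exists>x\<in>S. d dvd x}" by (blast intro: dvd_triv_left)
  qed
  have disj: "D r \<inter> D r' = {}" if r: "r \<in> ?R" "r' \<in> ?R" "r \<noteq> r'" for r r'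
  proof (rule ccontr)
    assume "D r \<inter> D r' \<noteq> {}"
    then obtain d where d: "[d = s r] (mod a)" "[d = s r'] (mod a)" by (auto simp: D_def)
    have 1: "[d * r = bb] (mod a)" and 2: "[d * r' = bb] (mod a)"
      using d s[of r] s[of r'] r by (auto intro: cong_trans[OF cong_mult[OF _ cong_refl]])
    have "coprime d a" using cop[OF 1] by simp
    then have "[r = r'] (mod a)"
      using cong_trans[OF 1 cong_sym[OF 2]] by (simp add: cong_mult_lcancel_nat)
    then have "int a dvd int r - int r'" by (metis cong_iff_dvd_diff cong_int_iff)
    moreover have "\<bar>int r - int r'\<bar> < int a" using r by auto
    ultimately have "int r - int r' = 0"
      using dvd_imp_le_int[of "int r - int r'" "int a"] by fastforce
    with r(3) show False by simp
  qed
  have total: "(\<Sum>d | \<exists>x\<in>S. d dvd x. mangoldt d :: real) = (\<Sum>r\<in>?R. \<Sum>d\<in>D r. mangoldt d)"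
    unfolding eq
  proof (rule sum.UNION_disjoint)
    show "finite ?R" by simp
    show "\<forall>r\<in>?R. finite (D r)"
    proof
      fix r assume "r \<in> ?R"
      then have "D r \<subseteq> {d. \<exists>x\<in>S. d dvd x}" unfolding eq by blast
      then show "finite (D r)" using fin by (rule finite_subset)
    qed
  qed (use disj in blast)
  have D_eq: "D r = {d. [d = s r] (mod a) \<and> 0 < d \<and> (\<exists>i. real_of_int u < real d * real (r + a * i) \<and> real d * real (r + a * i) \<le> real_of_int v)}" for r
  proof -
    have iff: "(u < int x) = (real_of_int u < real x)" "(int x \<le> v) = (real x \<le> real_of_int v)" for x
      by linarith+
    show ?thesis unfolding D_def iff unfolding of_nat_mult ..
  qed
  show ?thesis using total unfolding D_eq .
qed

section \<open>The number of gaps \<open>K\<close> and the value \<open>A\<close>\<close>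

context
  fixes l m a r :: int
  assumes lm: "l > m" "m \<ge> 0" and a: "a \<ge> 1" and r: "1 \<le> r" "r \<le> a"
begin

text \<open>With q = r + a (j - 1) the right side reads l q \<le> m (q + a): to leading order, the
  intervals with indices j - 1 and j do not overlap. So \<open>K\<close> counts the indices whose
  interval is separate from the next.\<close>

lemma le_K_iff: "j \<le> K l m a r \<longleftrightarrow> (l - m) * (r + a * (j - 1)) \<le> a * m"
proof -
  have pos: "real_of_int (a * (l - m)) > 0" using lm a by simp
  have "j \<le> K l m a r \<longleftrightarrow> real_of_int j * real_of_int (a * (l - m)) \<le> real_of_int (a * l - (l - m) * r)"
    unfolding K_def le_floor_iff using pos by (simp only: pos_le_divide_eq)
  also have "\<dots> \<longleftrightarrow> j * (a * (l - m)) \<le> a * l - (l - m) * r"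
    by (simp only: of_int_mult[symmetric] of_int_le_iff)
  also have "\<dots> \<longleftrightarrow> (l - m) * (r + a * (j - 1)) \<le> a * m" by (simp add: algebra_simps)
  finally show ?thesis .
qed

lemma K_nonneg: "0 \<le> K l m a r"
proof -
  have "(l - m) * (r - a) \<le> 0" using lm r by (simp add: mult_nonneg_nonpos)
  moreover have "0 \<le> a * m" using a lm by simp
  ultimately show ?thesis unfolding le_K_iff by simp
qed

text \<open>The first case of \<open>A\<close> forces \<open>K\<close> to be 0 or 1. For 1 the first
  two intervals abut, (a + r) m = l r, and the two pieces add up to l / r.\<close>

lemma A_eq: "A l m a r = (\<Sum>i<nat (K l m a r). real_of_int (l - m) / real_of_int (r + a * int i))
   + real_of_int l / real_of_int (r + a * K l m a r)"
proof (cases "real_of_int ((a + r) * m) / real_of_int r \<le> real_of_int l")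
  case False
  have "(\<Sum>i = 0..K l m a r - 1. real_of_int (l - m) / real_of_int (r + a * i))
      = (\<Sum>i<nat (K l m a r). real_of_int (l - m) / real_of_int (r + a * int i))"
    by (rule sum.reindex_bij_witness[where i = int and j = nat]) auto
  then show ?thesis using False by (simp add: A_def)
next
  case True
  then have "real_of_int ((a + r) * m) \<le> real_of_int (l * r)" using r by (simp add: pos_divide_le_eq)
  then have le: "(a + r) * m \<le> l * r" by (simp only: of_int_le_iff)
  have A: "A l m a r = real_of_int l / real_of_int r" using True by (simp add: A_def)
  have "\<not> 2 \<le> K l m a r"
  proof
    assume "2 \<le> K l m a r"
    then have "(l - m) * (r + a) \<le> a * m" by (simp add: le_K_iff)
    moreover have "(l - m) * a > 0" using lm a by simp
    ultimately show False using le by (simp add: algebra_simps)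
  qed
  then consider "K l m a r = 0" | "K l m a r = 1" using K_nonneg by linarith
  then show ?thesis
  proof cases
    case 1
    then show ?thesis using A by simp
  next
    case 2
    then have "(l - m) * r \<le> a * m" using le_K_iff[of 1] by simp
    with le have "(a + r) * m = l * r" by (simp add: algebra_simps)
    then have "real_of_int l * real_of_int r = (real_of_int a + real_of_int r) * real_of_int m"
      by (metis of_int_add of_int_mult)
    then have "real_of_int l / (real_of_int r + real_of_int a) = real_of_int m / real_of_int r"
      using r a by (simp add: field_simps)
    then show ?thesis using A 2 by (simp add: diff_divide_distrib)
  qed
qed

lemma A_pos: "A l m a r > 0"
proof -
  have "0 \<le> a * K l m a r" using a K_nonneg by simp
  then have "0 < r + a * K l m a r" using r by linarith
  then have "0 < real_of_int (r + a * K l m a r)" by (simp only: of_int_0_less_iff)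
  then have "0 < real_of_int l / real_of_int (r + a * K l m a r)" using lm by (intro divide_pos_pos) auto
  moreover have "0 \<le> (\<Sum>i<nat (K l m a r). real_of_int (l - m) / real_of_int (r + a * int i))"
    using lm r a by (intro sum_nonneg divide_nonneg_nonneg) auto
  ultimately show ?thesis unfolding A_eq by simp
qed

end

lemma residue_class_asymptotic:
  fixes l m a b :: int and r s :: nat
  assumes lm: "l > m" "m \<ge> 0" and a: "a \<ge> 1" and r: "1 \<le> r" "int r \<le> a" and s: "coprime s (nat a)"
  shows "(\<lambda>n. (\<Sum>d | [d = s] (mod nat a) \<and> 0 < d \<and>
       (\<exists>i. real_of_int (a * m * int n + b) < real d * real (r + nat a * i) \<and>
            real d * real (r + nat a * i) \<le> real_of_int (a * l * int n + b)). mangoldt d) / real n)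
     \<longlonglongrightarrow> real_of_int a * A l m a (int r) / real (totient (nat a))"
proof -
  define q where "q = (\<lambda>i. real (r + nat a * i))"
  define k where "k = nat (K l m a (int r))"
  define u where "u = (\<lambda>n. real_of_int (a * m * int n + b))"
  define v where "v = (\<lambda>n. real_of_int (a * l * int n + b))"
  let ?psi = "ap_psi (nat a) s" and ?phi = "real (totient (nat a))"
  have r': "1 \<le> int r" using r by simp
  have qi: "q i = real_of_int (int r + a * int i)" for i using a by (simp add: q_def)
  have q0: "q i > 0" for i
  proof -
    have "0 < r + nat a * i" using r by simp
    then show ?thesis unfolding q_def of_nat_0_less_iff .
  qed
  have qmono: "strict_mono q" using a by (auto simp: strict_mono_def q_def)
  have qtop: "filterlim q at_top sequentially"
  proof -
    have "filterlim (\<lambda>i. real i) at_top sequentially" by (rule filterlim_real_sequentially)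
    then show ?thesis
    proof (rule filterlim_at_top_mono)
      have "i \<le> r + nat a * i" for i
      proof -
        have "1 * i \<le> nat a * i" using a by (intro mult_right_mono) auto
        then show ?thesis by linarith
      qed
      then show "\<forall>\<^sub>F i in sequentially. real i \<le> q i"
        unfolding q_def of_nat_le_iff by (intro always_eventually allI)
    qed
  qed
  have K: "int k = K l m a (int r)" using K_nonneg[OF lm a r' r(2)] by (simp add: k_def)
  have below: "real_of_int l * q i \<le> real_of_int m * q (Suc i)" if "i < k" for i
  proof -
    have "int i + 1 \<le> K l m a (int r)" using that K by simp
    then have "(l - m) * (int r + a * int i) \<le> a * m" unfolding le_K_iff[OF lm a r' r(2)] by simp
    then have "l * (int r + a * int i) \<le> m * (int r + a * int (Suc i))" by (simp add: algebra_simps)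
    then show ?thesis unfolding qi by (metis of_int_le_iff of_int_mult)
  qed
  \<comment> \<open>Integrality gives the summand 1; multiplied by a n, it compensates the term a b
    in the overlap condition once n \<ge> |b|.\<close>
  have above: "(l - m) * (int r + a * int i) \<ge> a * m + 1" if "i \<ge> k" for i
  proof -
    have "\<not> int i + 1 \<le> K l m a (int r)" using that K by simp
    then show ?thesis unfolding le_K_iff[OF lm a r' r(2)] by simp
  qed
  have eq: "\<forall>\<^sub>F n in sequentially. (\<Sum>d | [d = s] (mod nat a) \<and> 0 < d \<and> (\<exists>i. u n < real d * q i \<and> real d * q i \<le> v n). mangoldt d)
      = (\<Sum>i<k. ?psi (v n / q i) - ?psi (max (u n / q i) (v n / q (Suc i)))) + ?psi (v n / q k)"
    using eventually_ge_at_top[of "nat \<bar>b\<bar>"]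
  proof eventually_elim
    case (elim n)
    have n: "int n \<ge> \<bar>b\<bar>" using elim by linarith
    have "a * l \<ge> 1 * 1" using a lm by (intro mult_mono) auto
    then have "a * l * int n \<ge> 1 * int n" by (intro mult_right_mono) auto
    then have v0: "0 \<le> v n" unfolding v_def using n by linarith
    have "a * m * int n \<le> a * l * int n" using a lm by (intro mult_right_mono mult_left_mono) auto
    then have uv: "u n \<le> v n" unfolding u_def v_def of_int_le_iff by simp
    have ov: "u n / q i \<le> v n / q (Suc i)" if "i \<ge> k" for i
    proof -
      let ?q = "int r + a * int i"
      have "int n * (a * m + 1) \<le> int n * ((l - m) * ?q)" using above[OF that] by (intro mult_left_mono) auto
      then have "a * (int n * (a * m + 1)) \<le> a * (int n * ((l - m) * ?q))"
        by (rule mult_left_mono) (use a in simp)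
      moreover have "a * b \<le> a * int n" using n a by (intro mult_left_mono) auto
      ultimately have "(a * m * int n + b) * (?q + a) \<le> (a * l * int n + b) * ?q" by (simp add: algebra_simps)
      then have "real_of_int (a * m * int n + b) * real_of_int (?q + a) \<le> real_of_int (a * l * int n + b) * real_of_int ?q"
        by (metis of_int_le_iff of_int_mult)
      then have "u n * q (Suc i) \<le> v n * q i" by (simp add: u_def v_def qi algebra_simps)
      then show ?thesis using q0 by (simp add: divide_le_eq le_divide_eq mult_ac)
    qed
    show ?case by (rule sum_mangoldt_interval_union[OF qmono q0 qtop v0 uv ov])
  qed
  have lin: "(\<lambda>n. real_of_int (c * int n + b) / q i / real n) \<longlonglongrightarrow> real_of_int c / q i" for c i
  proof -
    have "(\<lambda>n. real_of_int c / q i + real_of_int b / q i * (1 / real n)) \<longlonglongrightarrow> real_of_int c / q i + real_of_int b / q i * 0"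
      by (intro tendsto_intros lim_1_over_n)
    moreover have "\<forall>\<^sub>F n in sequentially. real_of_int c / q i + real_of_int b / q i * (1 / real n) = real_of_int (c * int n + b) / q i / real n"
      using eventually_gt_at_top[of 0] by eventually_elim (simp add: add_divide_distrib)
    ultimately show ?thesis by (auto dest: Lim_transform_eventually)
  qed
  have vlim: "(\<lambda>n. v n / q i / real n) \<longlonglongrightarrow> real_of_int (a * l) / q i" for i
    unfolding v_def by (rule lin)
  have ulim: "(\<lambda>n. u n / q i / real n) \<longlonglongrightarrow> real_of_int (a * m) / q i" for i
    unfolding u_def by (rule lin)
  have al: "real_of_int (a * l) > 0" using a lm by simp
  have psi_v: "(\<lambda>n. ?psi (v n / q i) / real n) \<longlonglongrightarrow> real_of_int (a * l) / q i / ?phi" for i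
    using a al q0[of i] by (intro ap_psi_asymptotic s vlim) auto
  \<comment> \<open>Before index k the intervals do not overlap to leading order, so u / q i
    determines the limit of the maximum, also when the two limits coincide.\<close>
  have psi_max: "(\<lambda>n. ?psi (max (u n / q i) (v n / q (Suc i))) / real n) \<longlonglongrightarrow> real_of_int (a * m) / q i / ?phi"
    if i: "i < k" for i
  proof (rule ap_psi_asymptotic[OF _ s])
    have "real_of_int a * (real_of_int l * q i) \<le> real_of_int a * (real_of_int m * q (Suc i))"
      using below[OF i] a by (intro mult_left_mono) auto
    then have le: "real_of_int (a * l) / q (Suc i) \<le> real_of_int (a * m) / q i"
      using q0[of i] q0[of "Suc i"] by (simp add: divide_le_eq le_divide_eq mult_ac)
    have "(\<lambda>n. max (u n / q i / real n) (v n / q (Suc i) / real n)) \<longlonglongrightarrow> max (real_of_int (a * m) / q i) (real_of_int (a * l) / q (Suc i))"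
      by (intro tendsto_max ulim vlim)
    then show "(\<lambda>n. max (u n / q i) (v n / q (Suc i)) / real n) \<longlonglongrightarrow> real_of_int (a * m) / q i"
      using le by (simp add: max_divide_distrib_right max_absorb1)
    \<comment> \<open>\<open>ap_psi_asymptotic\<close> demands a positive limit. The existence of an
      i below k excludes m = 0.\<close>
    have "0 < real_of_int (a * l) / q (Suc i)" using al q0 by simp
    with le show "real_of_int (a * m) / q i > 0" by linarith
  qed (use a in simp)
  have "(\<lambda>n. (\<Sum>i<k. ?psi (v n / q i) / real n - ?psi (max (u n / q i) (v n / q (Suc i))) / real n) + ?psi (v n / q k) / real n)
     \<longlonglongrightarrow> (\<Sum>i<k. real_of_int (a * l) / q i / ?phi - real_of_int (a * m) / q i / ?phi) + real_of_int (a * l) / q k / ?phi"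
    by (intro tendsto_add tendsto_sum tendsto_diff psi_v psi_max) auto
  also have "(\<Sum>i<k. real_of_int (a * l) / q i / ?phi - real_of_int (a * m) / q i / ?phi) + real_of_int (a * l) / q k / ?phi
      = real_of_int a * A l m a (int r) / ?phi"
    unfolding A_eq[OF lm a r' r(2)] K[symmetric] nat_int qi[symmetric]
    by (simp add: sum_distrib_left sum_divide_distrib distrib_left add_divide_distrib right_diff_distrib diff_divide_distrib)
  finally have lim: "(\<lambda>n. (\<Sum>i<k. ?psi (v n / q i) / real n - ?psi (max (u n / q i) (v n / q (Suc i))) / real n) + ?psi (v n / q k) / real n)
     \<longlonglongrightarrow> real_of_int a * A l m a (int r) / ?phi" .
  have "(\<lambda>n. (\<Sum>d | [d = s] (mod nat a) \<and> 0 < d \<and> (\<exists>i. u n < real d * q i \<and> real d * q i \<le> v n). mangoldt d) / real n)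
     \<longlonglongrightarrow> real_of_int a * A l m a (int r) / ?phi"
  proof (rule Lim_transform_eventually[OF lim])
    show "\<forall>\<^sub>F n in sequentially. (\<Sum>i<k. ?psi (v n / q i) / real n - ?psi (max (u n / q i) (v n / q (Suc i))) / real n) + ?psi (v n / q k) / real n
       = (\<Sum>d | [d = s] (mod nat a) \<and> 0 < d \<and> (\<exists>i. u n < real d * q i \<and> real d * q i \<le> v n). mangoldt d) / real n"
      using eq
    proof eventually_elim
      case (elim n)
      show ?case unfolding elim by (simp only: add_divide_distrib sum_divide_distrib diff_divide_distrib)
    qed
  qed
  then show ?thesis unfolding q_def u_def v_def .
qed

text \<open>Moves the progression to natural numbers. All terms are positive because i \<ge> 1 makes
  them at least a + b.\<close>

lemma arithmetic_progression_image:
  fixes l m a b :: int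
  assumes m: "m \<ge> 0" and a: "a \<ge> 1" and ab: "a + b \<ge> 1"
  shows "(\<lambda>i. a * i + b) ` {m * int n<..l * int n} = int ` {x. a * m * int n + b < int x \<and>
    int x \<le> a * l * int n + b \<and> [x = nat (b mod a)] (mod nat a)}" (is "?L = int ` ?S")
    and "0 \<notin> {x. a * m * int n + b < int x \<and>
    int x \<le> a * l * int n + b \<and> [x = nat (b mod a)] (mod nat a)}"
proof -
  have cong: "[x = nat (b mod a)] (mod nat a) \<longleftrightarrow> [int x = b] (mod a)" for x
  proof -
    have "[x = nat (b mod a)] (mod nat a) \<longleftrightarrow> [int x = int (nat (b mod a))] (mod int (nat a))" by (rule cong_int_iff[symmetric])
    also have "\<dots> \<longleftrightarrow> [int x = b mod a] (mod a)" using a by simp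
    also have "\<dots> \<longleftrightarrow> [int x = b] (mod a)" by simp
    finally show ?thesis .
  qed
  have ge: "a * i + b \<ge> 1" if "i > m * int n" for i
  proof -
    have "m * int n \<ge> 0" using m by simp
    then have "a * 1 \<le> a * i" using that a by (intro mult_left_mono) auto
    with ab show ?thesis by simp
  qed
  have iff1: "a * m * int n + b < a * i + b \<longleftrightarrow> m * int n < i" for i
    using a by (simp add: mult.assoc)
  have iff2: "a * i + b \<le> a * l * int n + b \<longleftrightarrow> i \<le> l * int n" for i
    using a by (simp add: mult.assoc)
  have mem: "x \<in> ?S \<longleftrightarrow> (\<exists>i. int x = a * i + b \<and> m * int n < i \<and> i \<le> l * int n)" for x
  proof
    assume x: "x \<in> ?S"
    then have "a dvd int x - b" using cong by (simp add: cong_iff_dvd_diff)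
    then obtain i where "int x - b = a * i" by (elim dvdE)
    then have "int x = a * i + b" by simp
    then show "\<exists>i. int x = a * i + b \<and> m * int n < i \<and> i \<le> l * int n" using x iff1 iff2 by auto
  next
    assume "\<exists>i. int x = a * i + b \<and> m * int n < i \<and> i \<le> l * int n"
    then obtain i where i: "int x = a * i + b" "m * int n < i" "i \<le> l * int n" by blast
    have "a dvd int x - b" using i(1) by simp
    then have "[int x = b] (mod a)" by (simp add: cong_iff_dvd_diff)
    then show "x \<in> ?S" using i iff1 iff2 cong by simp
  qed
  show "?L = int ` ?S"
  proof (intro equalityI subsetI)
    fix y assume "y \<in> ?L"
    then obtain i where "y = a * i + b" "i \<in> {m * int n<..l * int n}" by (elim imageE)
    then have i: "y = a * i + b" "m * int n < i" "i \<le> l * int n" by auto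
    have y: "int (nat y) = y" using i ge[OF i(2)] by simp
    have "nat y \<in> ?S" by (rule iffD2[OF mem exI[of _ i]]) (use y i in simp)
    with y[symmetric] show "y \<in> int ` ?S" by (rule image_eqI)
  next
    fix y assume "y \<in> int ` ?S"
    then obtain x where "y = int x" "x \<in> ?S" by (elim imageE)
    then show "y \<in> ?L" using mem[of x] by auto
  qed
  show "0 \<notin> ?S"
  proof
    assume "0 \<in> ?S"
    then obtain i where "int 0 = a * i + b" "m * int n < i" using mem[of 0] by blast
    then show False using ge[of i] by simp
  qed
qed

theorem theorem1p1:
  fixes l m a b :: int
  assumes "l > m" and "m \<ge> 0"
    and "a \<ge> 1" and "a + b \<ge> 1" and "gcd a b = 1"
  shows "(\<lambda>n::nat. ln (real_of_int (LCM i\<in>{m * int n<..l * int n}. a * i + b)))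
           \<sim>[sequentially]
         (\<lambda>n::nat. real_of_int a * real n / real (totient (nat a))
                     * (\<Sum>r | r \<in> {1..a} \<and> gcd r a = 1. A l m a r))"
proof -
  define a' where "a' = nat a"
  have a': "a' > 0" "int a' = a" using assms(3) by (auto simp: a'_def)
  define bb where "bb = nat (b mod a)"
  define R where "R = {r. r \<in> {1..a'} \<and> coprime r a'}"
  define f where "f = (\<lambda>n::nat. ln (real_of_int (LCM i\<in>{m * int n<..l * int n}. a * i + b)))"
  define C where "C = real_of_int a / real (totient a') * (\<Sum>r | r \<in> {1..a} \<and> gcd r a = 1. A l m a r)"
  have "coprime (b mod a) a" using assms(3,5) by (simp add: coprime_iff_gcd_eq_1 gcd.commute)
  then have bb: "coprime bb a'"
    using assms(3) by (metis a'(2) bb_def coprime_int_iff int_nat_eq pos_mod_sign zero_less_one order_less_le_trans)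
  have "\<exists>s. [s * r = bb] (mod a')" if r: "coprime r a'" for r
  proof -
    obtain t where "[r * t = Suc 0] (mod a')" using cong_solve_coprime_nat[OF r] ..
    then have "[r * t * bb = Suc 0 * bb] (mod a')" by (intro cong_mult cong_refl)
    then have "[t * bb * r = bb] (mod a')" by (simp add: mult_ac)
    then show ?thesis ..
  qed
  \<comment> \<open>\<open>s r\<close> represents bb times the inverse of r modulo a.\<close>
  then obtain s where s: "\<And>r. coprime r a' \<Longrightarrow> [s r * r = bb] (mod a')" by metis
  have cs: "coprime (s r) a'" if "coprime r a'" for r
    using cong_imp_coprime[OF cong_sym[OF s[OF that]] bb] by simp
  define F :: "nat \<Rightarrow> nat \<Rightarrow> real" where "F = (\<lambda>r n. \<Sum>d | [d = s r] (mod a') \<and> 0 < d \<and>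
       (\<exists>i. real_of_int (a * m * int n + b) < real d * real (r + a' * i) \<and>
            real d * real (r + a' * i) \<le> real_of_int (a * l * int n + b)). mangoldt d)"
  have f_eq: "f n = (\<Sum>r\<in>R. F r n)" for n
  proof -
    let ?S = "{x. a * m * int n + b < int x \<and> int x \<le> a * l * int n + b \<and> [x = bb] (mod a')}"
    have S: "(\<lambda>i. a * i + b) ` {m * int n<..l * int n} = int ` ?S" "0 \<notin> ?S"
      using arithmetic_progression_image[OF assms(2,3,4)] unfolding bb_def a'_def by blast+
    have fin: "finite ?S" by (rule finite_subset[of _ "{..nat (a * l * int n + b)}"]) auto
    have "f n = ln (real (Lcm ?S))" unfolding f_def S(1) by simp
    also have "\<dots> = (\<Sum>d | \<exists>x\<in>?S. d dvd x. mangoldt d)" by (rule ln_Lcm_eq_sum_mangoldt[OF fin S(2)])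
    also have "\<dots> = (\<Sum>r\<in>R. F r n)"
      unfolding R_def F_def by (rule sum_mangoldt_divisors_residue_classes[OF a'(1) bb S(2) refl s])
    finally show ?thesis .
  qed
  have "(\<lambda>n. f n / real n) \<longlonglongrightarrow> (\<Sum>r\<in>R. real_of_int a * A l m a (int r) / real (totient a'))"
    unfolding f_eq sum_divide_distrib
  proof (rule tendsto_sum)
    fix r assume "r \<in> R"
    then have "1 \<le> r" "int r \<le> a" "coprime (s r) (nat a)"
      using cs[of r] a' by (auto simp: R_def a'_def)
    then show "(\<lambda>n. F r n / real n) \<longlonglongrightarrow> real_of_int a * A l m a (int r) / real (totient a')"
      unfolding F_def a'_def by (rule residue_class_asymptotic[OF assms(1,2,3)])
  qed
  also have "(\<Sum>r\<in>R. real_of_int a * A l m a (int r) / real (totient a')) = C"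
  proof -
    have "(\<Sum>r\<in>R. A l m a (int r)) = (\<Sum>r | r \<in> {1..a} \<and> gcd r a = 1. A l m a r)"
    proof (rule sum.reindex_bij_witness[where i = nat and j = int])
      show "int r \<in> {r \<in> {1..a}. gcd r a = 1}" if "r \<in> R" for r
        using that a'(2) by (auto simp: R_def coprime_iff_gcd_eq_1[symmetric] coprime_int_iff simp flip: a'(2))
      show "nat r \<in> R" if "r \<in> {r \<in> {1..a}. gcd r a = 1}" for r
      proof -
        have "coprime (int (nat r)) (int a')" using that a'(2) by (simp add: coprime_iff_gcd_eq_1)
        then have "coprime (nat r) a'" by (simp only: coprime_int_iff)
        then show ?thesis using that a'(2) by (auto simp: R_def)
      qed
    qed auto
    then show ?thesis by (simp add: C_def sum_distrib_left[symmetric] sum_divide_distrib[symmetric])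
  qed
  finally have lim: "(\<lambda>n. f n / real n) \<longlonglongrightarrow> C" .
  \<comment> \<open>A limit of f n / n gives an asymptotic equivalence only if it is
    nonzero.\<close>
  have Cpos: "C > 0"
  proof -
    have "(\<Sum>r | r \<in> {1..a} \<and> gcd r a = 1. A l m a r) > 0"
    proof (rule sum_pos)
      show "{r. r \<in> {1..a} \<and> gcd r a = 1} \<noteq> {}" using assms(3) by (auto intro!: exI[of _ 1])
      show "A l m a r > 0" if "r \<in> {r. r \<in> {1..a} \<and> gcd r a = 1}" for r
        using A_pos[OF assms(1,2,3)] that by auto
      show "finite {r. r \<in> {1..a} \<and> gcd r a = 1}" by (rule finite_subset[of _ "{1..a}"]) auto
    qed
    moreover have "totient a' > 0" using a' by (simp add: totient_gt_0_iff)
    ultimately show ?thesis using assms(3) by (simp add: C_def)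
  qed
  have "f \<sim>[sequentially] (\<lambda>n. C * real n)"
  proof (rule asymp_equivI')
    have "(\<lambda>n. f n / real n / C) \<longlonglongrightarrow> C / C" using Cpos by (intro tendsto_intros lim) auto
    then show "(\<lambda>n. f n / (C * real n)) \<longlonglongrightarrow> 1" using Cpos by (simp add: mult.commute)
  qed
  then show ?thesis unfolding f_def C_def a'_def by (simp add: mult_ac)
qed

end
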